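(* Let $\mu\in\mathcal M_0(\mathbb Z)$ and let $\tau^{AY}_\mu$ be the randomized Azéma–Yor stopping time of the context. Then $\tau^{AY}_\mu\in\mathrm{SEP}(\mathbb F^{S,\boldsymbol\eta},\mu)$, i.e. $\tau^{AY}_\mu<\infty$ a.s., $S_{\tau^{AY}_\mu}\sim\mu$ and $(S_{t\wedge\tau^{AY}_\mu})_{t\ge0}$ is uniformly integrable. Moreover, for every filtration $\mathbb F$ with respect to which $S$ is a simple symmetric random walk and every $\sigma\in\mathrm{SEP}(\mathbb F,\mu)$, $$\mathbb P(S^*_\sigma\ge n)\le\mathbb P(S^*_{\tau^{AY}_\mu}\ge n)=\bar\mu(b_\mu(n))\frac{\psi_\mu(b_\mu(n))-b_\mu(n)}{n-b_\mu(n)}\qquad\text{for all integers } n\ge1,$$ with the convention $\frac00=1$.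
   Context: Discrete time $t\in\{0,1,2,\dots\}$; $S$ is a simple symmetric random walk with $S_0=0$; $S^*_t:=\max_{u\le t}S_u$; $H_j:=\inf\{t\ge0:S_t=j\}$ ($H_\infty:=\infty$). "$S$ is a simple symmetric random walk with respect to $\mathbb F$" means $S$ is $\mathbb F$-adapted and $S_{t+1}-S_t$ is independent of $\mathcal F_t$, equal to $\pm1$ with probability $1/2$ each. $\mathcal M_0(\mathbb Z)$: probability measures on $\mathbb Z$ with finite first moment and mean zero. $\mathrm{SEP}(\mathbb F,\mu)$: set of $\mathbb F$-stopping times $\tau$ with $S_\tau\sim\mu$ and $(S_{t\wedge\tau})_{t\ge0}$ uniformly integrable. For $\mu\in\mathcal M_0(\mathbb Z)$: $\bar\mu(x):=\mu([x,\infty))$, $\bar x:=\sup\{n:\mu(\{n\})>0\}$, $\underline x:=\inf\{n:\mu(\{n\})>0\}$; $\psi_\mu(x):=\frac1{\bar\mu(x)}\int_{[x,\infty)}y\,\mu(dy)$ if $\bar\mu(x)>0$, $\psi_\mu(x):=x$ otherwise; $b_\mu(y):=\sup\{x:\psi_\mu(x)\le y\}$, $y\ge0$. If $\mu=\delta_0$, set $\tau^{AY}_\mu:=0$. Otherwise ($\underline x<0<\bar x$): for $1\le n<\bar x$, list the finite nonempty set of integers $\{b_\mu(y):y\in[n,n+1]\}\cap(-\infty,n]$ as $x^n_1>\dots>x^n_{m_n+1}$; list the integers in $\{b_\mu(y):y\in[0,1]\}$ as $x^0_1>\dots>x^0_{m_0+1}$ if $\underline x>-\infty$, or as an infinite decreasing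 sequence $x^0_1>x^0_2>\dots$ if $\underline x=-\infty$ (then $m_0+1:=\infty$). For $1\le n<\bar x$ and for $n=0$ when $\underline x>-\infty$: $\Gamma^n:=\bar\mu(x^n_{m_n+1})\frac{\psi_\mu(x^n_{m_n+1})-x^n_{m_n+1}}{n-x^n_{m_n+1}}$; $g^n_k:=\frac{n+1-x^n_k}{\Gamma^n}\mu(\{x^n_k\})$ ($2\le k\le m_n$); $g^n_{m_n+1}:=\frac{n+1-x^n_{m_n+1}}{\Gamma^n}\big[\mu(\{x^n_{m_n+1}\})-\bar\mu(x^n_{m_n+1})\frac{n-\psi_\mu(x^n_{m_n+1})}{n-x^n_{m_n+1}}\big]$; $f^n_{m_n+1}:=0$, $f^n_k:=f^n_{k+1}+g^n_{k+1}$ ($1\le k\le m_n$), $f^n_0:=1$; $\rho^n_k:=1-f^n_k/f^n_{k-1}$ for $1\le k\le m_n$, $\rho^n_{m_n+1}:=1$. When $\underline x=-\infty$: $g^0_k:=(1-x^0_k)\mu(\{x^0_k\})$ ($k\ge2$), $f^0_k:=\sum_{i\ge k+1}g^0_i$ ($k\ge1$), $f^0_0:=1$, $\rho^0_k:=1-f^0_k/f^0_{k-1}$ ($k\ge1$). (These $\rho^n_k$ lie in $[0,1]$.) Let $\boldsymbol\eta=(\eta^n_k:0\le n<\bar x,\ k\in\mathbb Z\cap[1,m_n+1])$ be mutually independent Bernoulli variables independent of $S$ with $\mathbb P(\eta^n_k=0)=\rho^n_k=1-\mathbb P(\eta^n_k=1)$, and $\mathbb F^{S,\boldsymbol\eta}$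 the filtration $\mathcal F^{S,\boldsymbol\eta}_t:=\sigma(S_u,\ \eta^{S^*_u}_k: k\in\mathbb Z\cap[1,m_{S^*_u}+1],\ u\le t)$. Then $$\tau^{AY}_\mu:=\inf\{t\ge0:\ S_t\le x^{S^*_t}_k\text{ and }\eta^{S^*_t}_k=0\text{ for some }k\in\mathbb Z\cap[1,m_{S^*_t}+1]\}\wedge H_{\bar x}.$$ *)

theory Defs
  imports "HOL-Probability.Probability"
begin

definition is_filtration :: "'a measure \<Rightarrow> (nat \<Rightarrow> 'a measure) \<Rightarrow> bool" where
  "is_filtration M F \<longleftrightarrow> (\<forall>t. subalgebra M (F t)) \<and> (\<forall>s t. s \<le> t \<longrightarrow> sets (F s) \<subseteq> sets (F t))"

definition ssrw_wrt :: "'a measure \<Rightarrow> (nat \<Rightarrow> 'a measure) \<Rightarrow> (nat \<Rightarrow> 'a \<Rightarrow> int) \<Rightarrow> bool" where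
  "ssrw_wrt M F S \<longleftrightarrow> is_filtration M F
     \<and> (\<forall>\<omega>\<in>space M. S 0 \<omega> = 0)
     \<and> (\<forall>t. S t \<in> measurable (F t) (count_space UNIV))
     \<and> (\<forall>t. \<forall>A\<in>sets (F t). \<forall>B. measure M (A \<inter> {\<omega>\<in>space M. S (Suc t) \<omega> - S t \<omega> \<in> B})
                 = measure M A * measure M {\<omega>\<in>space M. S (Suc t) \<omega> - S t \<omega> \<in> B})
     \<and> (\<forall>t. measure M {\<omega>\<in>space M. S (Suc t) \<omega> - S t \<omega> = 1} = 1/2
          \<and> measure M {\<omega>\<in>space M. S (Suc t) \<omega> - S t \<omega> = -1} = 1/2)"

definition nat_filt :: "'a measure \<Rightarrow> (nat \<Rightarrow> 'a \<Rightarrow> int) \<Rightarrow> nat \<Rightarrow> 'a measure" where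
  "nat_filt M S t = sigma (space M) {S u -` A \<inter> space M | u A. u \<le> t}"

definition stopping_time_wrt :: "'a measure \<Rightarrow> (nat \<Rightarrow> 'a measure) \<Rightarrow> ('a \<Rightarrow> enat) \<Rightarrow> bool" where
  "stopping_time_wrt M F \<tau> \<longleftrightarrow> (\<forall>t. {\<omega>\<in>space M. \<tau> \<omega> \<le> enat t} \<in> sets (F t))"

definition Smax :: "(nat \<Rightarrow> 'a \<Rightarrow> int) \<Rightarrow> nat \<Rightarrow> 'a \<Rightarrow> int" where
  "Smax S t \<omega> = Max ((\<lambda>u. S u \<omega>) ` {..t})"

definition stopped :: "(nat \<Rightarrow> 'a \<Rightarrow> int) \<Rightarrow> ('a \<Rightarrow> enat) \<Rightarrow> nat \<Rightarrow> 'a \<Rightarrow> int" where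
  "stopped S \<tau> t \<omega> = (case \<tau> \<omega> of enat n \<Rightarrow> S (min t n) \<omega> | \<infinity> \<Rightarrow> S t \<omega>)"

definition unif_integrable :: "'a measure \<Rightarrow> (nat \<Rightarrow> 'a \<Rightarrow> real) \<Rightarrow> bool" where
  "unif_integrable M X \<longleftrightarrow> (\<forall>t. integrable M (X t))
     \<and> (\<forall>e>0. \<exists>K. \<forall>t. (\<integral>\<omega>. indicator {\<omega>. K < \<bar>X t \<omega>\<bar>} \<omega> * \<bar>X t \<omega>\<bar> \<partial>M) < e)"

definition SEP :: "'a measure \<Rightarrow> (nat \<Rightarrow> 'a measure) \<Rightarrow> (nat \<Rightarrow> 'a \<Rightarrow> int) \<Rightarrow> int pmf \<Rightarrow> ('a \<Rightarrow> enat) \<Rightarrow> bool" where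
  "SEP M F S \<mu> \<tau> \<longleftrightarrow> stopping_time_wrt M F \<tau>
     \<and> (AE \<omega> in M. \<tau> \<omega> \<noteq> \<infinity>)
     \<and> (\<forall>x. measure M {\<omega>\<in>space M. \<tau> \<omega> \<noteq> \<infinity> \<and> S (the_enat (\<tau> \<omega>)) \<omega> = x} = pmf \<mu> x)
     \<and> unif_integrable M (\<lambda>t \<omega>. real_of_int (stopped S \<tau> t \<omega>))"

definition mubar :: "int pmf \<Rightarrow> real \<Rightarrow> real" where
  "mubar \<mu> x = measure_pmf.prob \<mu> {y. x \<le> real_of_int y}"

definition xbar :: "int pmf \<Rightarrow> ereal" where
  "xbar \<mu> = Sup ((\<lambda>y. ereal (real_of_int y)) ` set_pmf \<mu>)"

definition xlow :: "int pmf \<Rightarrow> ereal" where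
  "xlow \<mu> = Inf ((\<lambda>y. ereal (real_of_int y)) ` set_pmf \<mu>)"

definition psi :: "int pmf \<Rightarrow> real \<Rightarrow> real" where
  "psi \<mu> x = (if mubar \<mu> x > 0
     then (\<integral>y. indicator {y. x \<le> real_of_int y} y * real_of_int y \<partial>measure_pmf \<mu>) / mubar \<mu> x
     else x)"

text \<open>b_mu(y) = sup {x. psi_mu(x) \<le> y}, taken in the extended reals (sup of the empty set is -\<infinity>).\<close>
definition bmu :: "int pmf \<Rightarrow> real \<Rightarrow> ereal" where
  "bmu \<mu> y = Sup (ereal ` {x. psi \<mu> x \<le> y})"

definition Xset :: "int pmf \<Rightarrow> nat \<Rightarrow> int set" where
  "Xset \<mu> n = {k::int. (\<exists>y\<in>{real n..real n + 1}. bmu \<mu> y = ereal (real_of_int k))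
                      \<and> (1 \<le> n \<longrightarrow> k \<le> int n)}"

definition kth_largest :: "int set \<Rightarrow> nat \<Rightarrow> int" where
  "kth_largest A k = (THE x. x \<in> A \<and> card {y\<in>A. x < y} = k - 1)"

definition xk :: "int pmf \<Rightarrow> nat \<Rightarrow> nat \<Rightarrow> int" where
  "xk \<mu> n k = kth_largest (Xset \<mu> n) k"

text \<open>Lsz mu n = m_n + 1 (possibly \<infinity>, when n = 0 and the support is unbounded below).\<close>
definition fin_case :: "int pmf \<Rightarrow> nat \<Rightarrow> bool" where
  "fin_case \<mu> n \<longleftrightarrow> 1 \<le> n \<or> xlow \<mu> > -\<infinity>"

definition Lsz :: "int pmf \<Rightarrow> nat \<Rightarrow> enat" where
  "Lsz \<mu> n = (if fin_case \<mu> n then enat (card (Xset \<mu> n)) else \<infinity>)"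

definition Gam :: "int pmf \<Rightarrow> nat \<Rightarrow> real" where
  "Gam \<mu> n = (let L = card (Xset \<mu> n); x = real_of_int (xk \<mu> n L) in
     mubar \<mu> x * (psi \<mu> x - x) / (real n - x))"

definition gfin :: "int pmf \<Rightarrow> nat \<Rightarrow> nat \<Rightarrow> real" where
  "gfin \<mu> n k = (let L = card (Xset \<mu> n); x = real_of_int (xk \<mu> n k) in
     if k = L then (real n + 1 - x) / Gam \<mu> n
                    * (pmf \<mu> (xk \<mu> n k) - mubar \<mu> x * (real n - psi \<mu> x) / (real n - x))
     else (real n + 1 - x) / Gam \<mu> n * pmf \<mu> (xk \<mu> n k))"

definition ffin :: "int pmf \<Rightarrow> nat \<Rightarrow> nat \<Rightarrow> real" where
  "ffin \<mu> n k = (if k = 0 then 1 else (\<Sum>i\<in>{k+1..card (Xset \<mu> n)}. gfin \<mu> n i))"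

definition rhofin :: "int pmf \<Rightarrow> nat \<Rightarrow> nat \<Rightarrow> real" where
  "rhofin \<mu> n k = (if k = card (Xset \<mu> n) then 1 else 1 - ffin \<mu> n k / ffin \<mu> n (k - 1))"

definition ginf :: "int pmf \<Rightarrow> nat \<Rightarrow> real" where
  "ginf \<mu> k = (1 - real_of_int (xk \<mu> 0 k)) * pmf \<mu> (xk \<mu> 0 k)"

definition finf :: "int pmf \<Rightarrow> nat \<Rightarrow> real" where
  "finf \<mu> k = (if k = 0 then 1 else (\<Sum>i. ginf \<mu> (i + k + 1)))"

definition rhoinf :: "int pmf \<Rightarrow> nat \<Rightarrow> real" where
  "rhoinf \<mu> k = 1 - finf \<mu> k / finf \<mu> (k - 1)"

definition rho :: "int pmf \<Rightarrow> nat \<Rightarrow> nat \<Rightarrow> real" where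
  "rho \<mu> n k = (if fin_case \<mu> n then rhofin \<mu> n k else rhoinf \<mu> k)"

definition AYidx :: "int pmf \<Rightarrow> (nat \<times> nat) set" where
  "AYidx \<mu> = {(n, k). ereal (real n) < xbar \<mu> \<and> 1 \<le> k \<and> enat k \<le> Lsz \<mu> n}"

definition first_time :: "(nat \<Rightarrow> bool) \<Rightarrow> enat" where
  "first_time P = (if \<exists>t. P t then enat (LEAST t. P t) else \<infinity>)"

definition Hbar :: "int pmf \<Rightarrow> (nat \<Rightarrow> 'a \<Rightarrow> int) \<Rightarrow> 'a \<Rightarrow> enat" where
  "Hbar \<mu> S \<omega> = (if xbar \<mu> = \<infinity> then \<infinity>
                   else first_time (\<lambda>t. ereal (real_of_int (S t \<omega>)) = xbar \<mu>))"

text \<open>eta values are booleans: eta = 0 is encoded as False, eta = 1 as True.\<close>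
definition tauAY :: "int pmf \<Rightarrow> (nat \<Rightarrow> 'a \<Rightarrow> int) \<Rightarrow> (nat \<Rightarrow> nat \<Rightarrow> 'a \<Rightarrow> bool) \<Rightarrow> 'a \<Rightarrow> enat" where
  "tauAY \<mu> S \<eta> \<omega> = (if \<mu> = return_pmf 0 then 0 else
     min (first_time (\<lambda>t. \<exists>k. (nat (Smax S t \<omega>), k) \<in> AYidx \<mu>
             \<and> S t \<omega> \<le> xk \<mu> (nat (Smax S t \<omega>)) k \<and> \<not> \<eta> (nat (Smax S t \<omega>)) k \<omega>))
         (Hbar \<mu> S \<omega>))"

text \<open>The filtration F^{S,eta}: generated by S_u and eta^{S^*_u}_k (k \<in> [1, m_{S^*_u}+1]), u \<le> t.
  The variable eta^{S^*_u}_k is encoded as Some value when the index is admissible, None otherwise.\<close>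
definition eta_obs :: "int pmf \<Rightarrow> (nat \<Rightarrow> 'a \<Rightarrow> int) \<Rightarrow> (nat \<Rightarrow> nat \<Rightarrow> 'a \<Rightarrow> bool) \<Rightarrow> nat \<Rightarrow> nat \<Rightarrow> 'a \<Rightarrow> bool option" where
  "eta_obs \<mu> S \<eta> u k \<omega> = (if (nat (Smax S u \<omega>), k) \<in> AYidx \<mu>
       then Some (\<eta> (nat (Smax S u \<omega>)) k \<omega>) else None)"

definition FSeta :: "'a measure \<Rightarrow> int pmf \<Rightarrow> (nat \<Rightarrow> 'a \<Rightarrow> int) \<Rightarrow> (nat \<Rightarrow> nat \<Rightarrow> 'a \<Rightarrow> bool) \<Rightarrow> nat \<Rightarrow> 'a measure" where
  "FSeta M \<mu> S \<eta> t = sigma (space M)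
     ({S u -` A \<inter> space M | u A. u \<le> t} \<union> {eta_obs \<mu> S \<eta> u k -` B \<inter> space M | u k B. u \<le> t})"

definition div00 :: "real \<Rightarrow> real \<Rightarrow> real" where
  "div00 a b = (if a = 0 \<and> b = 0 then 1 else a / b)"

definition AYbound :: "int pmf \<Rightarrow> nat \<Rightarrow> real" where
  "AYbound \<mu> n = (let b = real_of_ereal (bmu \<mu> (real n)) in
     mubar \<mu> b * div00 (psi \<mu> b - b) (real n - b))"

end

theory Submission
  imports Defs
begin

text \<open>
  For each level \<open>n\<close> let \<open>B n\<close> be the largest \<open>x\<^sup>n\<^sub>k\<close> with \<open>\<eta>\<^sup>n\<^sub>k = 0\<close> (and \<open>B n = n\<close> from the top of the
  support on). The \<open>B n\<close> are independent of each other and of the walk, and almost surely the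
  Azema-Yor time is the first \<open>t\<close> at which the walk is at or below \<open>B\<close> of its running maximum.
  Enlarging the initial sigma-algebra by all \<open>\<eta>\<close> keeps \<open>S\<close> a simple random walk, and the martingale
  run while the maximum equals \<open>n\<close> shows that, given \<open>B\<close>, level \<open>n + 1\<close> is reached from level \<open>n\<close>
  with probability \<open>(n - B n) / (n + 1 - B n)\<close>. With \<open>call k = E(X - k)\<^sup>+\<close> for \<open>X \<sim> \<mu>\<close>, the claimed bound is
  the minimum of \<open>call k / (n - k)\<close> over \<open>k < n\<close>; call it \<open>reach_prob n\<close>. In these terms the excursion
  below level \<open>n\<close> deposits exactly the part of \<open>\<mu>\<close> whose upper quantiles lie between
  \<open>reach_prob (n + 1)\<close> and \<open>reach_prob n\<close>, and summing over \<open>n\<close> recovers \<open>\<mu>\<close>. Uniform integrability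
  follows from convexity together with \<open>n * reach_prob n \<longrightarrow> 0\<close>, and optimality is Doob's argument
  \<open>(n - k) P(S\<^sup>*\<^sub>\<sigma> \<ge> n) \<le> E(S\<^sub>\<sigma> - k)\<^sup>+\<close> at the minimising \<open>k\<close>.
\<close>

section \<open>Centred integer distributions\<close>

text \<open>The obstacle is that one atom of \<mu> may be needed at several levels, so the rule has
  to split it. The splitting becomes visible on the graph of \<open>call\<close>, a convex function
  whose slopes are the values \<open>- tail\<close>: for n \<ge> 1, \<open>reach_prob n\<close> is
  minus the slope of the line through (n, 0) that supports this graph. Contact is made at a lattice
  point, the slope lies between two neighbouring values of \<open>- tail\<close>, and the share of
  the atom there that falls to level n is a difference between a tail and a slope. The factor
  \<open>n + 1 - x\<close> in the weights g undoes gambler's ruin: of the walks that arrive at n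
  with barrier x, a fraction 1 / (n + 1 - x) ends at x. Two filtrations are involved.
  \<open>FSeta\<close>, the one of the claim, reveals the coins \<eta> level by level; in the
  enlarged one all coins are known at time 0, so that barriers act as constants in every martingale
  argument. At level 0 the list of levels can be infinite; then there is no contact point, and
  limits at minus infinity, supplied by the mean being zero, take its place.\<close>

locale centred_pmf =
  fixes \<mu> :: "int pmf"
  assumes integrable_id: "integrable (measure_pmf \<mu>) real_of_int"
    and mean_zero: "measure_pmf.expectation \<mu> real_of_int = 0"
begin

definition tail :: "int \<Rightarrow> real" where
  "tail k = mubar \<mu> (real_of_int k)"

definition call :: "int \<Rightarrow> real" where
  "call k = measure_pmf.expectation \<mu> (\<lambda>x. max 0 (real_of_int x - real_of_int k))"

text \<open>
  \<open>gap y k\<close> is \<open>E[y - X; X \<ge> k]\<close>; its sign decides whether \<open>psi k \<le> y\<close>, so \<open>bmu y\<close> is the point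
  where \<open>gap y\<close> turns negative.
\<close>

definition gap :: "real \<Rightarrow> int \<Rightarrow> real" where
  "gap y k = (y - real_of_int k) * tail k - call k"

lemma tail_alt: "tail k = measure_pmf.prob \<mu> {k..}"
  by (simp add: tail_def mubar_def atLeast_def)

lemma tail_expectation: "tail k = measure_pmf.expectation \<mu> (indicator {k..})"
  by (simp add: tail_alt)

lemma mubar_ceiling: "mubar \<mu> x = tail \<lceil>x\<rceil>"
  by (simp add: tail_def mubar_def ceiling_le_iff)

lemma tail_nonneg [simp]: "0 \<le> tail k" by (simp add: tail_alt)

lemma tail_le_1 [simp]: "tail k \<le> 1" by (simp add: tail_alt)

lemma tail_antimono: "j \<le> k \<Longrightarrow> tail k \<le> tail j"
  unfolding tail_alt by (rule measure_pmf.finite_measure_mono) auto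

lemma tail_diff: "tail k - tail (k + 1) = pmf \<mu> k"
proof -
  have "{k..} = {k} \<union> {k+1..}" by auto
  then have "tail k = measure_pmf.prob \<mu> ({k} \<union> {k+1..})" by (simp add: tail_alt)
  also have "\<dots> = measure_pmf.prob \<mu> {k} + measure_pmf.prob \<mu> {k+1..}"
    by (rule measure_pmf.finite_measure_Union) auto
  finally show ?thesis by (simp add: tail_alt measure_pmf_single)
qed

lemma integrable_bounded_by_id:
  assumes "\<And>x. \<bar>f x\<bar> \<le> C + \<bar>real_of_int x\<bar>"
  shows "integrable (measure_pmf \<mu>) (f :: int \<Rightarrow> real)"
proof (rule Bochner_Integration.integrable_bound)
  show "integrable (measure_pmf \<mu>) (\<lambda>x. C + \<bar>real_of_int x\<bar>)"
    using integrable_id by simp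
  show "AE x in measure_pmf \<mu>. norm (f x) \<le> norm (C + \<bar>real_of_int x\<bar>)"
  proof (rule AE_I2)
    fix x show "norm (f x) \<le> norm (C + \<bar>real_of_int x\<bar>)"
      using assms[of x] by (simp add: order_trans[OF _ abs_ge_self])
  qed
qed simp

lemma integrable_call: "integrable (measure_pmf \<mu>) (\<lambda>x. max 0 (real_of_int x - real_of_int k))"
  by (rule integrable_bounded_by_id[where C="\<bar>real_of_int k\<bar>"]) linarith

lemma integrable_indicator_atLeast: "integrable (measure_pmf \<mu>) (indicator {k..} :: int \<Rightarrow> real)"
  by (rule integrable_bounded_by_id[where C=1]) (auto simp: indicator_def)

lemma call_nonneg [simp]: "0 \<le> call k"
  by (simp add: call_def)

lemma call_diff: "call k - call (k + 1) = tail (k + 1)"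
proof -
  have "call k - call (k+1) = measure_pmf.expectation \<mu>
      (\<lambda>x. max 0 (real_of_int x - real_of_int k) - max 0 (real_of_int x - real_of_int (k+1)))"
    unfolding call_def by (rule Bochner_Integration.integral_diff[symmetric]) (rule integrable_call)+
  also have "\<dots> = measure_pmf.expectation \<mu> (indicator {k+1..})"
    by (rule Bochner_Integration.integral_cong) (auto simp: indicator_def max_def)
  finally show ?thesis by (simp add: tail_alt)
qed

lemma partial_expectation:
  "measure_pmf.expectation \<mu> (\<lambda>x. indicator {k..} x * real_of_int x) = call k + real_of_int k * tail k"
proof -
  have "call k + real_of_int k * tail k = measure_pmf.expectation \<mu>
      (\<lambda>x. max 0 (real_of_int x - real_of_int k) + real_of_int k * indicator {k..} x)"
    unfolding call_def tail_expectation
    using integrable_call[of k] integrable_indicator_atLeast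
    by (subst Bochner_Integration.integral_add) auto
  also have "\<dots> = measure_pmf.expectation \<mu> (\<lambda>x. indicator {k..} x * real_of_int x)"
    by (rule Bochner_Integration.integral_cong) (auto simp: indicator_def max_def)
  finally show ?thesis ..
qed

lemma gap_expectation:
  "gap y k = y * tail k - measure_pmf.expectation \<mu> (\<lambda>x. indicator {k..} x * real_of_int x)"
  unfolding gap_def partial_expectation by (simp add: algebra_simps)

text \<open>In the reading E[y - X; X \<ge> k], moving from \<open>k\<close> to \<open>k + 1\<close>
  removes just the atom at \<open>k\<close>, and its contribution has the sign of
  \<open>y - k\<close>.\<close>

lemma gap_diff: "gap y k - gap y (k + 1) = (y - real_of_int k) * pmf \<mu> k"
proof -
  have "call k = call (k + 1) + tail (k + 1)" "tail k = pmf \<mu> k + tail (k + 1)"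
    using call_diff[of k] tail_diff[of k] by auto
  then show ?thesis by (simp add: gap_def algebra_simps)
qed

text \<open>The decrements involved sit at indices below \<open>k\<close>, all of them at most
  \<open>y\<close>; hence the admissible range ends at \<open>y + 1\<close> rather than at
  \<open>y\<close>.\<close>

lemma gap_antimono:
  assumes "j \<le> k" "real_of_int k \<le> y + 1"
  shows "gap y k \<le> gap y j"
  using assms
proof (induction k rule: int_ge_induct)
  case (step i)
  have "0 \<le> (y - real_of_int i) * pmf \<mu> i" using step.prems by simp
  then have "gap y (i + 1) \<le> gap y i" using gap_diff[of y i] by simp
  then show ?case using step by simp
qed simp

lemma gap_mono_level: "y \<le> z \<Longrightarrow> gap y k \<le> gap z k"
  by (simp add: gap_def mult_right_mono)

lemma gap_level_diff: "gap z k - gap y k = (z - y) * tail k"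
  by (simp add: gap_def algebra_simps)

lemma call_pos: "0 < tail (k + 1) \<Longrightarrow> 0 < call k"
  using call_diff[of k] call_nonneg[of "k+1"] by linarith

lemma call_zero: assumes "tail k = 0" shows "call k = 0"
proof -
  have "AE x in measure_pmf \<mu>. x \<notin> {k..}"
    using assms unfolding tail_alt by (subst (asm) measure_pmf.prob_eq_0) auto
  then have "AE x in measure_pmf \<mu>. max 0 (real_of_int x - real_of_int k) = 0"
    by eventually_elim auto
  then show ?thesis unfolding call_def by (rule integral_eq_zero_AE)
qed

lemma call_zero': assumes "tail (k + 1) = 0" shows "call k = 0"
  using call_diff[of k] call_zero[OF assms] assms by simp

lemma gap_nonpos: "y \<le> real_of_int k \<Longrightarrow> gap y k \<le> 0"
  unfolding gap_def using call_nonneg[of k] mult_nonpos_nonneg[of "y - real_of_int k" "tail k"]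
  by (smt (verit) tail_nonneg)

text \<open>On {X \<ge> k} the variable \<open>y - X\<close> is at most 0, and it is negative with
  positive probability: in the first case on the mass beyond \<open>k\<close>, in the second on all
  of {X \<ge> k}.\<close>

lemma gap_neg:
  assumes "0 < tail (k + 1) \<and> y \<le> real_of_int k \<or> 0 < tail k \<and> y < real_of_int k"
  shows "gap y k < 0"
  using assms
proof
  assume "0 < tail (k + 1) \<and> y \<le> real_of_int k"
  then show ?thesis using call_pos[of k] mult_nonpos_nonneg[of "y - real_of_int k" "tail k"]
    unfolding gap_def by simp
next
  assume "0 < tail k \<and> y < real_of_int k"
  then have "(y - real_of_int k) * tail k < 0" by (simp add: mult_neg_pos)
  then show ?thesis using call_nonneg[of k] unfolding gap_def by linarith
qed

lemma tail_tendsto: "(\<lambda>i. tail (- int i)) \<longlonglongrightarrow> 1"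
proof -
  have "(\<lambda>i. measure_pmf.prob \<mu> {- int i..}) \<longlonglongrightarrow> measure_pmf.prob \<mu> (\<Union>i. {- int i..})"
    by (rule measure_pmf.finite_Lim_measure_incseq) (auto simp: incseq_def)
  moreover have "(\<Union>i. {- int i..}) = (UNIV :: int set)"
  proof -
    have "x \<in> (\<Union>i. {- int i..})" for x :: int by (rule UN_I[of "nat (-x)"]) auto
    then show ?thesis by auto
  qed
  ultimately show ?thesis by (simp add: tail_alt)
qed

text \<open>Mean zero enters here: the limit is y - E X. It is positive at every level n \<ge> 1,
  which provides a sign change there, but it vanishes at level 0, the source of the separate
  treatment of that level.\<close>

lemma gap_tendsto: "(\<lambda>i. gap y (- int i)) \<longlonglongrightarrow> y"
proof -
  have "(\<lambda>i. measure_pmf.expectation \<mu> (\<lambda>x. indicator {- int i..} x * real_of_int x))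
      \<longlonglongrightarrow> measure_pmf.expectation \<mu> real_of_int"
  proof (rule integral_dominated_convergence[where w="\<lambda>x. \<bar>real_of_int x\<bar>"])
    show "AE x in measure_pmf \<mu>. (\<lambda>i. indicator {- int i..} x * real_of_int x) \<longlonglongrightarrow> real_of_int x"
    proof (rule AE_I2)
      fix x :: int
      have "eventually (\<lambda>i. indicator {- int i..} x * real_of_int x = real_of_int x) sequentially"
        unfolding eventually_sequentially by (rule exI[of _ "nat (-x)"]) (auto simp: indicator_def)
      then show "(\<lambda>i. indicator {- int i..} x * real_of_int x) \<longlonglongrightarrow> real_of_int x"
        by (rule tendsto_eventually)
    qed
  qed (use integrable_id in \<open>auto simp: indicator_def\<close>)
  then have "(\<lambda>i. y * tail (- int i) - measure_pmf.expectation \<mu> (\<lambda>x. indicator {- int i..} x * real_of_int x))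
      \<longlonglongrightarrow> y * 1 - 0"
    unfolding mean_zero by (intro tendsto_intros tail_tendsto)
  then show ?thesis by (simp add: gap_expectation)
qed

lemma call_tendsto: "(\<lambda>i. call (int i)) \<longlonglongrightarrow> 0"
proof -
  have "(\<lambda>i. call (int i)) \<longlonglongrightarrow> measure_pmf.expectation \<mu> (\<lambda>x. 0)"
    unfolding call_def
  proof (rule integral_dominated_convergence[where w="\<lambda>x. \<bar>real_of_int x\<bar>"])
    show "AE x in measure_pmf \<mu>. (\<lambda>i. max 0 (real_of_int x - real_of_int (int i))) \<longlonglongrightarrow> 0"
    proof (rule AE_I2)
      fix x :: int
      have "eventually (\<lambda>i. max 0 (real_of_int x - real_of_int (int i)) = 0) sequentially"
        unfolding eventually_sequentially by (rule exI[of _ "nat x"]) auto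
      then show "(\<lambda>i. max 0 (real_of_int x - real_of_int (int i))) \<longlonglongrightarrow> 0"
        by (rule tendsto_eventually)
    qed
  qed (use integrable_id in auto)
  then show ?thesis by simp
qed

text \<open>Discrete convexity: the one-step slopes of \<open>call\<close> are the increasing values
  \<open>- tail\<close>, so the slope of a chord lies between those of its first and its last
  step.\<close>

lemma call_linear_bounds:
  assumes "j \<le> k"
  shows "real_of_int (k - j) * tail k \<le> call j - call k" "call j - call k \<le> real_of_int (k - j) * tail (j + 1)"
proof -
  have "real_of_int (k - j) * tail k \<le> call j - call k \<and> call j - call k \<le> real_of_int (k - j) * tail (j + 1)"
    using assms
  proof (induction k rule: int_ge_induct)
    case (step i)
    have "real_of_int (i - j) * tail (i + 1) \<le> real_of_int (i - j) * tail i"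
      using step.hyps by (intro mult_left_mono tail_antimono) auto
    moreover have "tail (i + 1) \<le> tail (j + 1)" using step.hyps by (intro tail_antimono) simp
    ultimately show ?case using step.IH call_diff[of i] by (simp add: algebra_simps)
  qed simp
  then show "real_of_int (k - j) * tail k \<le> call j - call k" "call j - call k \<le> real_of_int (k - j) * tail (j + 1)"
    by auto
qed

section \<open>Reading \<open>psi\<close> and \<open>bmu\<close> off the sign of
  \<open>gap\<close>\<close>

lemma psi_eq:
  "psi \<mu> x = (if 0 < tail \<lceil>x\<rceil> then (call \<lceil>x\<rceil> + real_of_int \<lceil>x\<rceil> * tail \<lceil>x\<rceil>) / tail \<lceil>x\<rceil> else x)"
proof -
  have "{y. x \<le> real_of_int y} = {\<lceil>x\<rceil>..}" by (auto simp: ceiling_le_iff)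
  then show ?thesis by (simp add: psi_def mubar_ceiling partial_expectation)
qed

lemma psi_le_iff: "psi \<mu> x \<le> y \<longleftrightarrow> (if 0 < tail \<lceil>x\<rceil> then 0 \<le> gap y \<lceil>x\<rceil> else x \<le> y)"
  by (auto simp: psi_eq gap_def divide_le_eq algebra_simps)

text \<open>With mass left beyond \<open>k\<close>, the set of x with psi x \<le> y is the half-line
  up to \<open>k\<close>: \<open>gap y\<close> is nonincreasing up to \<open>y + 1\<close> and
  negative above \<open>y\<close> as long as mass remains, so its sign changes only once.\<close>

lemma bmu_eqI:
  assumes "0 < tail (k + 1)" "0 \<le> gap y k" "gap y (k + 1) < 0"
  shows "bmu \<mu> y = ereal (real_of_int k)"
proof -
  \<comment> \<open>If \<open>y\<close> were at most \<open>k\<close>, the mass beyond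
    \<open>k\<close> would force \<open>gap y k\<close> to be negative.\<close>
  have ky: "real_of_int k < y"
    using gap_neg[of k y] assms by linarith
  have "psi \<mu> x \<le> y \<longleftrightarrow> x \<le> real_of_int k" for x
  proof (cases "x \<le> real_of_int k")
    case True
    then have c: "\<lceil>x\<rceil> \<le> k" by (simp add: ceiling_le_iff)
    have "tail (k + 1) \<le> tail \<lceil>x\<rceil>" using c by (intro tail_antimono) simp
    then have "0 < tail \<lceil>x\<rceil>" using assms by linarith
    moreover have "gap y k \<le> gap y \<lceil>x\<rceil>" using c ky by (intro gap_antimono) auto
    ultimately show ?thesis using True assms by (simp add: psi_le_iff)
  next
    case False
    then have c: "k + 1 \<le> \<lceil>x\<rceil>" by linarith
    have "\<not> psi \<mu> x \<le> y"
    proof (cases "0 < tail \<lceil>x\<rceil>")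
      case True
      have "gap y \<lceil>x\<rceil> < 0"
      proof (cases "real_of_int \<lceil>x\<rceil> \<le> y")
        case True
        then have "gap y \<lceil>x\<rceil> \<le> gap y (k + 1)" using c by (intro gap_antimono) auto
        then show ?thesis using assms by linarith
      next
        case False then show ?thesis using gap_neg[of "\<lceil>x\<rceil>" y] True by auto
      qed
      then show ?thesis using True by (simp add: psi_le_iff)
    next
      case False
      then have z: "tail \<lceil>x\<rceil> = 0" using tail_nonneg[of "\<lceil>x\<rceil>"] by linarith
      \<comment> \<open>Beyond the support \<open>psi x = x\<close> by convention. Were
        \<open>x\<close> at most \<open>y\<close>, \<open>gap y\<close> would vanish at the ceiling
        of \<open>x\<close> and, being monotone, could not be negative at
        \<open>k + 1\<close>.\<close>
      have "\<not> x \<le> y"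
      proof
        assume "x \<le> y"
        then have "gap y \<lceil>x\<rceil> \<le> gap y (k + 1)" using c by (intro gap_antimono) linarith+
        then show False using z call_zero[OF z] assms by (simp add: gap_def)
      qed
      then show ?thesis using z by (simp add: psi_le_iff)
    qed
    then show ?thesis using False by simp
  qed
  then have "{x. psi \<mu> x \<le> y} = {..real_of_int k}" by auto
  then show ?thesis unfolding bmu_def
    by (intro antisym Sup_least Sup_upper) auto
qed

lemma bmu_eqD:
  assumes "bmu \<mu> y = ereal (real_of_int k)" "0 < tail (k + 1)"
  shows "0 \<le> gap y k" "gap y (k + 1) < 0"
proof -
  show "gap y (k + 1) < 0"
  proof (rule ccontr)
    assume "\<not> gap y (k + 1) < 0"
    then have "psi \<mu> (real_of_int (k + 1)) \<le> y" using assms(2) by (simp add: psi_le_iff del: of_int_add)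
    then have "ereal (real_of_int (k + 1)) \<le> bmu \<mu> y" unfolding bmu_def by (intro Sup_upper) blast
    then show False using assms(1) by simp
  qed
  \<comment> \<open>A point of the set at distance less than 1 from its supremum \<open>k\<close>
    has ceiling \<open>k\<close>, and where mass remains \<open>psi\<close> depends on the ceiling
    only.\<close>
  have "ereal (real_of_int k - 1) < bmu \<mu> y" using assms(1) by simp
  then obtain x where x: "psi \<mu> x \<le> y" "real_of_int k - 1 < x"
    unfolding bmu_def less_Sup_iff by auto
  have "ereal x \<le> bmu \<mu> y" unfolding bmu_def using x by (intro Sup_upper) blast
  then have "x \<le> real_of_int k" using assms(1) by simp
  then have c: "\<lceil>x\<rceil> = k" using x(2) by linarith
  have "0 < tail k" using assms(2) tail_antimono[of k "k + 1"] by linarith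
  then show "0 \<le> gap y k" using x(1) by (simp add: psi_le_iff c)
qed

lemma le_of_psi_le: assumes "0 \<le> real_of_int n" "psi \<mu> x \<le> real_of_int n" shows "x \<le> real_of_int n"
proof (cases "0 < tail \<lceil>x\<rceil>")
  case True
  then have "0 \<le> gap (real_of_int n) \<lceil>x\<rceil>" using assms by (simp add: psi_le_iff)
  then have "\<lceil>x\<rceil> \<le> n" using gap_neg[of "\<lceil>x\<rceil>" "real_of_int n"] True by force
  then show ?thesis by (simp add: ceiling_le_iff)
qed (use assms in \<open>simp add: psi_le_iff\<close>)

text \<open>Origin of the convention 0/0 = 1: at or beyond the top of the support both
  \<open>bmu\<close> and \<open>psi\<close> fix \<open>n\<close>, so numerator and denominator of
  the bound vanish together.\<close>

lemma bmu_beyond_support: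
  assumes "tail (n + 1) = 0" "0 \<le> n"
  shows "bmu \<mu> (real_of_int n) = ereal (real_of_int n)" "psi \<mu> (real_of_int n) = real_of_int n"
proof -
  have c: "call n = 0" by (rule call_zero'[OF assms(1)])
  show p: "psi \<mu> (real_of_int n) = real_of_int n" by (simp add: psi_eq c)
  show "bmu \<mu> (real_of_int n) = ereal (real_of_int n)"
    unfolding bmu_def using p assms(2) le_of_psi_le[of n]
    by (intro antisym Sup_least Sup_upper) auto
qed

lemma less_xbar_iff: "ereal (real n) < xbar \<mu> \<longleftrightarrow> 0 < tail (int n + 1)"
proof -
  have "ereal (real n) < xbar \<mu> \<longleftrightarrow> (\<exists>y\<in>set_pmf \<mu>. real n < real_of_int y)"
    unfolding xbar_def less_Sup_iff by auto
  also have "\<dots> \<longleftrightarrow> (\<exists>y\<in>set_pmf \<mu>. int n + 1 \<le> y)"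
    by (intro bex_cong refl) linarith
  also have "\<dots> \<longleftrightarrow> tail (int n + 1) \<noteq> 0"
    by (auto simp: tail_alt measure_pmf_zero_iff)
  finally show ?thesis using tail_nonneg[of "int n + 1"] by linarith
qed

text \<open>For n \<ge> 1 the positive limit of \<open>gap n\<close> at minus infinity gives a
  starting point; the sign change is then the last index below \<open>n\<close> with nonnegative
  gap. At level 0 the limit is 0 and may be approached from below, so a starting point
  \<open>k0\<close> has to be supplied.\<close>

lemma ex_crossing:
  assumes "0 < tail (int n + 1)" "1 \<le> n \<or> k0 < 0 \<and> 0 \<le> gap 0 k0"
  obtains k where "k < int n" "0 \<le> gap (real n) k" "gap (real n) (k + 1) < 0"
proof -
  have neg: "gap (real n) j < 0" if "j = int n" for j using gap_neg[of "int n" "real n"] assms that by simp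
  have "\<exists>j. j < int n \<and> 0 \<le> gap (real n) j"
  proof (cases "1 \<le> n")
    case True
    then have "eventually (\<lambda>i. 0 < gap (real n) (- int i)) sequentially"
      by (intro order_tendstoD(1)[OF gap_tendsto]) simp
    then obtain i where "0 < gap (real n) (- int i)" by (auto simp: eventually_sequentially)
    then show ?thesis using True neg[of "- int i"] by (intro exI[of _ "- int i"]) linarith
  next
    case False
    then have "n = 0" by simp
    then show ?thesis using assms by auto
  qed
  then obtain j where j: "j < int n" "0 \<le> gap (real n) j" by blast
  define A where "A = {i\<in>{j..<int n}. 0 \<le> gap (real n) i}"
  have A: "finite A" "j \<in> A"
    using j by (auto simp: A_def intro: finite_subset[of _ "{j..<int n}"])
  have M: "Max A \<in> A" using A by (intro Max_in) auto
  have "gap (real n) (Max A + 1) < 0"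
  proof (rule ccontr)
    assume n: "\<not> gap (real n) (Max A + 1) < 0"
    then have "Max A + 1 \<noteq> int n" using neg by blast
    then have "Max A + 1 \<in> A" using M n by (auto simp: A_def)
    then have "Max A + 1 \<le> Max A" using A by (intro Max_ge)
    then show False by simp
  qed
  with M that[of "Max A"] show ?thesis by (auto simp: A_def)
qed

end

section \<open>The maximal reaching probability\<close>

context centred_pmf
begin

text \<open>The value at 0 is set by hand, level 0 being the start of the walk; with it the tangency
  relation \<open>reach_prob_optimal\<close> holds at level 0 as well.\<close>

definition reach_prob :: "nat \<Rightarrow> real" where
  "reach_prob m = (if m = 0 then 1 else AYbound \<mu> m)"

lemma call_ge: "- real_of_int k \<le> call k"
proof -
  have "measure_pmf.expectation \<mu> (\<lambda>x. real_of_int x - real_of_int k) \<le> call k"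
    unfolding call_def by (rule integral_mono) (use integrable_id integrable_call in auto)
  moreover have "measure_pmf.expectation \<mu> (\<lambda>x. real_of_int x - real_of_int k) = - real_of_int k"
    using integrable_id mean_zero by simp
  ultimately show ?thesis by simp
qed

lemma reach_prob_beyond_support:
  assumes "tail (int m + 1) = 0"
  shows "reach_prob m = tail (int m)"
proof (cases "m = 0")
  case True
  \<comment> \<open>Without mass above 0, \<open>call (-1)\<close> reduces to \<open>tail 0\<close>,
    while mean zero makes it at least 1.\<close>
  have "call 0 = 0" using call_zero'[of 0] assms True by simp
  then have "tail 0 \<ge> 1" using call_ge[of "-1"] call_diff[of "-1"] by simp
  then show ?thesis using True tail_le_1[of 0] by (simp add: reach_prob_def)
next
  case False
  then show ?thesis using bmu_beyond_support[OF assms]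
    by (simp add: reach_prob_def AYbound_def Let_def div00_def tail_def)
qed

text \<open>Tangency. By \<open>call_diff\<close> the two sign conditions compare the line through
  (x, call x) and (m, 0) with the slopes of \<open>call\<close> on either side of \<open>x\<close>;
  together they say that the line supports the graph. The alternative \<open>x = m - 1\<close>
  covers the top of the support, where \<open>gap m m\<close> is 0 and no strict sign change is
  available.\<close>

lemma reach_prob_optimal:
  assumes "x < int m" "0 \<le> gap (real m) x" "x = int m - 1 \<or> gap (real m) (x + 1) < 0"
  shows "call x = (real m - real_of_int x) * reach_prob m"
proof (cases "m = 0")
  case True
  have "call x \<le> - real_of_int x * tail x" using assms(2) True by (simp add: gap_def)
  also have "\<dots> \<le> - real_of_int x * 1" using assms(1) True by (intro mult_left_mono) auto
  finally show ?thesis using call_ge[of x] True by (simp add: reach_prob_def)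
next
  case m: False
  show ?thesis
  proof (cases "tail (int m + 1) = 0")
    case True
    have c: "call (int m) = 0" by (rule call_zero'[OF True])
    \<comment> \<open>A strict sign change further down is incompatible with
      \<open>gap m m = 0\<close>, because \<open>gap m\<close> is nonincreasing up to
      \<open>m\<close>.\<close>
    have "x = int m - 1"
    proof (rule ccontr)
      assume "x \<noteq> int m - 1"
      then have "gap (real m) (x + 1) < 0" "x + 1 \<le> int m" using assms by auto
      moreover from this(2) have "gap (real m) (int m) \<le> gap (real m) (x + 1)" by (intro gap_antimono) auto
      ultimately show False using c by (simp add: gap_def)
    qed
    then show ?thesis using reach_prob_beyond_support[OF True] call_diff[of "int m - 1"] c by simp
  next
    case False
    then have p: "0 < tail (int m + 1)" using tail_nonneg[of "int m + 1"] by linarith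
    have "gap (real m) (x + 1) < 0" using assms(3) gap_neg[of "int m" "real m"] p by auto
    moreover have "tail (int m + 1) \<le> tail (x + 1)" using assms(1) by (intro tail_antimono) simp
    moreover have tx: "tail (int m + 1) \<le> tail x" using assms(1) by (intro tail_antimono) simp
    ultimately have "bmu \<mu> (real m) = ereal (real_of_int x)" using p assms(2) by (intro bmu_eqI) auto
    moreover have "0 < tail x" using tx p by linarith
    ultimately show ?thesis using m assms(1)
      by (simp add: reach_prob_def AYbound_def Let_def div00_def psi_eq mubar_ceiling field_simps)
  qed
qed

lemma ex_optimal:
  assumes "1 \<le> m"
  obtains b where "b < int m" "0 \<le> gap (real m) b" "b = int m - 1 \<or> gap (real m) (b + 1) < 0"
proof (cases "0 < tail (int m + 1)")
  case True
  then obtain b where "b < int m" "0 \<le> gap (real m) b" "gap (real m) (b + 1) < 0"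
    using ex_crossing[of m] assms by auto
  then show ?thesis using that by blast
next
  case False
  then have "call (int m) = 0" using call_zero'[of "int m"] tail_nonneg[of "int m + 1"] by linarith
  then have "0 \<le> gap (real m) (int m - 1)"
    using call_diff[of "int m - 1"] tail_antimono[of "int m - 1" "int m"] by (simp add: gap_def)
  then show ?thesis using that[of "int m - 1"] by simp
qed

text \<open>A supporting line has a slope between the one-sided slopes of \<open>call\<close> at the
  point of contact.\<close>

lemma optimal_tail_bounds:
  assumes "1 \<le> m" "b < int m" "0 \<le> gap (real m) b" "b = int m - 1 \<or> gap (real m) (b + 1) < 0"
  shows "tail (b + 1) \<le> reach_prob m" "reach_prob m \<le> tail b"
proof -
  have pos: "0 < real m - real_of_int b" using assms by linarith
  note c = reach_prob_optimal[OF assms(2-4)]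
  have "(real m - real_of_int b) * reach_prob m \<le> (real m - real_of_int b) * tail b"
    using assms(3) by (simp add: gap_def c)
  then show "reach_prob m \<le> tail b" using pos by simp
  have "(real m - real_of_int b) * tail (b + 1) \<le> call b"
    using assms(4)
  proof
    assume "b = int m - 1"
    then show ?thesis using call_diff[of b] call_nonneg[of "b + 1"]
      by (smt (verit) mult_cancel_right1 of_int_diff of_int_of_nat_eq of_int_1)
  next
    assume "gap (real m) (b + 1) < 0"
    then show ?thesis using call_diff[of b] by (simp add: gap_def algebra_simps)
  qed
  then show "tail (b + 1) \<le> reach_prob m" using pos by (simp add: c)
qed

lemma reach_prob_nonneg [simp]: "0 \<le> reach_prob m"
proof (cases "m = 0")
  case False
  then obtain b where "b < int m" "0 \<le> gap (real m) b" "b = int m - 1 \<or> gap (real m) (b + 1) < 0"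
    using ex_optimal[of m] by auto
  from optimal_tail_bounds(1)[OF _ this] False tail_nonneg[of "b + 1"] show ?thesis by linarith
qed (simp add: reach_prob_def)

text \<open>Together with \<open>tail_le_reach_prob\<close> this is a dictionary: the sign of
  \<open>gap m x\<close> decides on which side of \<open>tail x\<close> the value
  \<open>reach_prob m\<close> falls. It resolves the minima in \<open>strip\<close>.\<close>

lemma reach_prob_le_tail:
  assumes "x \<le> int m" "0 \<le> gap (real m) x"
  shows "reach_prob m \<le> tail x"
proof (cases "m = 0")
  case True
  show ?thesis
  proof (cases "x = 0")
    case True
    then have "call 0 \<le> 0" using assms \<open>m = 0\<close> by (simp add: gap_def)
    then have "1 \<le> tail 0" using call_ge[of "-1"] call_diff[of "-1"] by simp
    then show ?thesis using \<open>m = 0\<close> True by (simp add: reach_prob_def)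
  next
    case x: False
    have "call x \<le> - real_of_int x * tail x" using assms True by (simp add: gap_def)
    then have "- real_of_int x * 1 \<le> - real_of_int x * tail x" using call_ge[of x] by linarith
    moreover have "0 < - real_of_int x" using x assms True by simp
    ultimately have "1 \<le> tail x" by (simp only: mult_le_cancel_left_pos)
    then show ?thesis using True by (simp add: reach_prob_def)
  qed
next
  case False
  then obtain b where b: "b < int m" "0 \<le> gap (real m) b" "b = int m - 1 \<or> gap (real m) (b + 1) < 0"
    using ex_optimal[of m] by auto
  have bd: "reach_prob m \<le> tail b" using optimal_tail_bounds(2)[OF _ b] False by simp
  show ?thesis
  proof (cases "x \<le> b")
    case True
    then show ?thesis using bd tail_antimono[of x b] by linarith
  next
    case x: False
    have "gap (real m) x \<le> gap (real m) (b + 1)" using x assms by (intro gap_antimono) auto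
    then have b1: "b = int m - 1" using b assms by auto
    then have xm: "x = int m" using x assms by auto
    then have "call (int m) \<le> 0" using assms by (simp add: gap_def)
    then have "call b = tail (int m)" using call_diff[of b] b1 call_nonneg[of "int m"] by simp
    then show ?thesis using reach_prob_optimal[OF b] b1 xm by simp
  qed
qed

lemma tail_le_reach_prob:
  assumes "gap (real m) x < 0"
  shows "tail x \<le> reach_prob m"
proof (cases "m = 0")
  case False
  then obtain b where b: "b < int m" "0 \<le> gap (real m) b" "b = int m - 1 \<or> gap (real m) (b + 1) < 0"
    using ex_optimal[of m] by auto
  have "b < x"
  proof (rule ccontr)
    assume "\<not> b < x"
    then have "gap (real m) b \<le> gap (real m) x" using b by (intro gap_antimono) auto
    then show False using b assms by linarith
  qed
  then have "tail x \<le> tail (b + 1)" by (intro tail_antimono) simp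
  then show ?thesis using optimal_tail_bounds(1)[OF _ b] False by linarith
qed (simp add: reach_prob_def)

lemma tail_le_reach_prob': "tail (int m) \<le> reach_prob m"
proof (cases "gap (real m) (int m) < 0")
  case False
  have "tail (int m + 1) = 0"
    using False gap_neg[of "int m" "real m"] tail_nonneg[of "int m + 1"]
    by (metis less_eq_real_def of_int_of_nat_eq)
  then show ?thesis using reach_prob_beyond_support by simp
qed (rule tail_le_reach_prob)

text \<open>The supporting line stays below the convex function \<open>call\<close>. On either side
  of the contact \<open>b\<close> this is a chord bound combined with the slope bounds at
  \<open>b\<close>.\<close>

lemma reach_prob_minimal:
  assumes "1 \<le> m"
  shows "(real m - real_of_int k) * reach_prob m \<le> call k"
proof -
  obtain b where b: "b < int m" "0 \<le> gap (real m) b" "b = int m - 1 \<or> gap (real m) (b + 1) < 0"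
    using ex_optimal[OF assms] by auto
  note c = reach_prob_optimal[OF b]
  note bd = optimal_tail_bounds[OF assms b]
  show ?thesis
  proof (cases "b \<le> k")
    case True
    have "real_of_int (k - b) * tail (b + 1) \<le> real_of_int (k - b) * reach_prob m"
      using True bd by (intro mult_left_mono) auto
    then show ?thesis using call_linear_bounds(2)[OF True] c by (simp add: algebra_simps)
  next
    case False
    then have kb: "k \<le> b" by simp
    have "real_of_int (b - k) * reach_prob m \<le> real_of_int (b - k) * tail b"
      using kb bd by (intro mult_left_mono) auto
    then show ?thesis using call_linear_bounds(1)[OF kb] c by (simp add: algebra_simps)
  qed
qed

lemma reach_prob_pos:
  assumes "0 < tail (int m + 1)" shows "0 < reach_prob m"
  using assms tail_antimono[of "int m" "int m + 1"] tail_le_reach_prob'[of m] by linarith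

lemma reach_prob_le_1: "reach_prob m \<le> 1"
proof (cases "m = 0")
  case False
  then obtain b where "b < int m" "0 \<le> gap (real m) b" "b = int m - 1 \<or> gap (real m) (b + 1) < 0"
    using ex_optimal[of m] by auto
  then show ?thesis using optimal_tail_bounds(2)[of m b] tail_le_1[of b] False by linarith
qed (simp add: reach_prob_def)

text \<open>The minimiser of level \<open>n\<close> serves as a competitor at level
  \<open>n + 1\<close>.\<close>

lemma reach_prob_antimono: "reach_prob (Suc n) \<le> reach_prob n"
proof (cases "n = 0")
  case True
  then show ?thesis using reach_prob_le_1[of "Suc n"] by (simp add: reach_prob_def[of 0])
next
  case False
  then obtain b where b: "b < int n" "0 \<le> gap (real n) b" "b = int n - 1 \<or> gap (real n) (b + 1) < 0"
    using ex_optimal[of n] by auto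
  have "(real (Suc n) - real_of_int b) * reach_prob (Suc n) \<le> call b"
    by (rule reach_prob_minimal) simp
  also have "\<dots> \<le> (real (Suc n) - real_of_int b) * reach_prob n"
    unfolding reach_prob_optimal[OF b] by (intro mult_right_mono) auto
  finally show ?thesis using b(1) by simp
qed

text \<open>The rate consumed by uniform integrability. A fixed competitor \<open>i\<close> gives
  \<open>(n - i) * reach_prob n \<le> call i\<close>, and for n > 2 i the factor n is at most twice
  n - i, so it suffices that \<open>call i\<close> becomes small.\<close>

lemma n_reach_prob_tendsto: "(\<lambda>n. real n * reach_prob n) \<longlonglongrightarrow> 0"
proof (rule LIMSEQ_I)
  fix e :: real assume "0 < e"
  then have "eventually (\<lambda>i. call (int i) < e / 2) sequentially"
    by (intro order_tendstoD(2)[OF call_tendsto]) simp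
  then obtain i where i: "call (int i) < e / 2" by (auto simp: eventually_sequentially)
  show "\<exists>N. \<forall>n\<ge>N. norm (real n * reach_prob n - 0) < e"
  proof (intro exI allI impI)
    fix n assume n: "n \<ge> 2 * i + 1"
    have "real n * reach_prob n \<le> 2 * (real n - real i) * reach_prob n"
      using n by (intro mult_right_mono) auto
    also have "\<dots> \<le> 2 * call (int i)"
      using reach_prob_minimal[of n "int i"] n
      by (metis (no_types, opaque_lifting) add_leE mult.assoc mult_le_cancel_left_pos of_int_of_nat_eq zero_less_numeral)
    finally show "norm (real n * reach_prob n - 0) < e" using i by simp
  qed
qed

lemma reach_prob_tendsto: "reach_prob \<longlonglongrightarrow> 0"
proof (rule tendsto_sandwich[OF _ _ tendsto_const n_reach_prob_tendsto])
  show "eventually (\<lambda>n. reach_prob n \<le> real n * reach_prob n) sequentially"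
    unfolding eventually_sequentially
    by (rule exI[of _ 1]) (auto intro!: mult_right_mono[of 1 "real _", simplified])
qed simp

text \<open>
  \<open>strip n x\<close> is the mass that \<mu> gives to \<open>[x, \<infinity>)\<close> through its upper quantiles between
  \<open>reach_prob (n + 1)\<close> and \<open>reach_prob n\<close>; \<open>drawdown_cdf n x\<close> turns out to be the probability that the
  barrier at level \<open>n\<close> lies below \<open>x\<close>.
\<close>

definition strip :: "nat \<Rightarrow> int \<Rightarrow> real" where
  "strip n x = min (tail x) (reach_prob n) - min (tail x) (reach_prob (Suc n))"

definition drawdown_cdf :: "nat \<Rightarrow> int \<Rightarrow> real" where
  "drawdown_cdf n x = (if int n < x then 1 else if 0 \<le> gap (real n) x then 0
      else 1 - max 0 (gap (real n + 1) x) / reach_prob n)"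

lemma strip_above: "int n + 1 \<le> x \<Longrightarrow> strip n x = 0"
proof -
  assume x: "int n + 1 \<le> x"
  have "tail x \<le> reach_prob n" "tail x \<le> reach_prob (Suc n)"
    using tail_le_reach_prob'[of n] tail_le_reach_prob'[of "Suc n"]
      tail_antimono[of "int n" x] tail_antimono[of "int (Suc n)" x] x by auto
  then show ?thesis by (simp add: strip_def)
qed

lemma strip_tendsto: "(\<lambda>i. strip n (- int i)) \<longlonglongrightarrow> reach_prob n - reach_prob (Suc n)"
proof -
  have "(\<lambda>i. strip n (- int i)) \<longlonglongrightarrow> min 1 (reach_prob n) - min 1 (reach_prob (Suc n))"
    unfolding strip_def by (intro tendsto_intros tail_tendsto)
  then show ?thesis using reach_prob_le_1[of n] reach_prob_le_1[of "Suc n"] by (simp add: min_def)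
qed

lemma sum_strip: "(\<Sum>n<N. strip n x) = tail x - min (tail x) (reach_prob N)"
  by (induction N) (auto simp: strip_def reach_prob_def min_def)

text \<open>The three cases are the positions of \<open>tail x\<close> below, between and above the
  two values of \<open>reach_prob\<close>, translated into signs of \<open>gap\<close>.\<close>

lemma strip_eq:
  assumes "x \<le> int n"
  shows "strip n x = (if gap (real n + 1) x < 0 then 0
     else if gap (real n) x < 0 then tail x - reach_prob (Suc n) else reach_prob n - reach_prob (Suc n))"
proof -
  have S: "real (Suc n) = real n + 1" by simp
  have 1: "gap (real n) x \<le> gap (real n + 1) x" by (rule gap_mono_level) simp
  show ?thesis
  proof (cases "gap (real n + 1) x < 0")
    case True
    then have "tail x \<le> reach_prob (Suc n)" using tail_le_reach_prob[of "Suc n" x] by (simp add: S add.commute)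
    then show ?thesis using True reach_prob_antimono[of n] by (simp add: strip_def)
  next
    case False
    then have 2: "reach_prob (Suc n) \<le> tail x"
      using reach_prob_le_tail[of x "Suc n"] assms by (simp add: S add.commute)
    show ?thesis
    proof (cases "gap (real n) x < 0")
      case True
      then show ?thesis using False 2 tail_le_reach_prob[of n x] by (simp add: strip_def)
    next
      case c: False
      then show ?thesis using False 2 reach_prob_le_tail[of x n] assms by (simp add: strip_def)
    qed
  qed
qed

text \<open>The balance that dictates the law of the barrier. Level \<open>n\<close> is reached with
  probability \<open>reach_prob n\<close>, and with barrier \<open>x\<close> the walk then ends at
  \<open>x\<close> rather than reaching \<open>n + 1\<close> with probability
  \<open>1 / (n + 1 - x)\<close>; multiplied by the mass of the barrier at \<open>x\<close> this
  must be the share of \<mu> due there.\<close>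

lemma strip_diff_inside:
  assumes pos: "0 < tail (int n + 1)" and x: "x \<le> int n"
  shows "(real n + 1 - real_of_int x) * (strip n x - strip n (x + 1))
     = reach_prob n * (drawdown_cdf n (x + 1) - drawdown_cdf n x)"
proof -
  have Gp: "0 < reach_prob n" by (rule reach_prob_pos[OF pos])
  have negn: "gap (real n) (int n) < 0" using gap_neg[of "int n" "real n"] pos by simp
  have S: "real (Suc n) = real n + 1" by simp
  have lev: "gap (real n) y \<le> gap (real n + 1) y" for y by (rule gap_mono_level) simp
  \<comment> \<open>The alternative \<open>x = n\<close> is the clause \<open>x = m - 1\<close> of
    the tangency relation with \<open>m = n + 1\<close>.\<close>
  have opt1: "call x = (real n + 1 - real_of_int x) * reach_prob (Suc n)"
    if "0 \<le> gap (real n + 1) x" "x = int n \<or> gap (real n + 1) (x + 1) < 0"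
    using reach_prob_optimal[of x "Suc n"] that x by (simp add: S add.commute)
  have opt0: "call x = (real n - real_of_int x) * reach_prob n" "x < int n"
    if "0 \<le> gap (real n) x" "x = int n \<or> gap (real n) (x + 1) < 0"
  proof -
    show "x < int n" using that negn x by (cases "x = int n") auto
    then show "call x = (real n - real_of_int x) * reach_prob n"
      using reach_prob_optimal[of x n] that by auto
  qed
  have z1: "drawdown_cdf n (x + 1) = 1 \<and> strip n (x + 1) = 0"
    if "x = int n \<or> gap (real n + 1) (x + 1) < 0"
  proof (cases "x = int n")
    case True then show ?thesis using strip_above by (simp add: drawdown_cdf_def)
  next
    case False
    then show ?thesis using that x strip_eq[of "x + 1" n] lev[of "x + 1"] by (simp add: drawdown_cdf_def)
  qed
  have mono: "gap (real n) (x + 1) \<le> gap (real n) x" "gap (real n + 1) (x + 1) \<le> gap (real n + 1) x"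
    using x by (auto intro!: gap_antimono)
  \<comment> \<open>The contact of level \<open>n\<close> is never above that of level
    \<open>n + 1\<close>. The cases place \<open>x\<close> above both (A), at the upper contact only
    (B), strictly between (C), at a common contact (D), at the lower contact only (E), or below both
    (F). In C the whole atom is used; in B, D and E it may be shared with neighbouring
    levels.\<close>
  consider (A) "gap (real n + 1) x < 0"
    | (B) "0 \<le> gap (real n + 1) x" "gap (real n) x < 0" "x = int n \<or> gap (real n + 1) (x + 1) < 0"
    | (C) "0 \<le> gap (real n + 1) x" "gap (real n) x < 0" "x < int n" "0 \<le> gap (real n + 1) (x + 1)"
    | (D) "0 \<le> gap (real n) x" "x = int n \<or> gap (real n + 1) (x + 1) < 0"
    | (E) "0 \<le> gap (real n) x" "x < int n" "0 \<le> gap (real n + 1) (x + 1)" "gap (real n) (x + 1) < 0"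
    | (F) "0 \<le> gap (real n) x" "x < int n" "0 \<le> gap (real n + 1) (x + 1)" "0 \<le> gap (real n) (x + 1)"
    using x by force
  then show ?thesis
  proof cases
    case A
    then have "x = int n \<or> gap (real n + 1) (x + 1) < 0" using mono by linarith
    with z1 A x lev[of x] show ?thesis by (simp add: strip_eq drawdown_cdf_def)
  next
    case B
    have "strip n x = tail x - reach_prob (Suc n)" using B x by (simp add: strip_eq)
    moreover have "reach_prob n * drawdown_cdf n x = reach_prob n - gap (real n + 1) x"
      using B x Gp by (simp add: drawdown_cdf_def field_simps)
    ultimately show ?thesis using z1[OF B(3)] opt1[OF B(1,3)]
      by (simp add: gap_def right_diff_distrib)
  next
    case C
    have "strip n x = tail x - reach_prob (Suc n)" using C x by (simp add: strip_eq)
    moreover have "gap (real n) (x + 1) < 0" using C mono by linarith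
    moreover from this have "strip n (x + 1) = tail (x + 1) - reach_prob (Suc n)"
      using C x by (simp add: strip_eq)
    ultimately have "strip n x - strip n (x + 1) = pmf \<mu> x" using tail_diff[of x] by simp
    moreover have "reach_prob n * drawdown_cdf n x = reach_prob n - gap (real n + 1) x"
      "reach_prob n * drawdown_cdf n (x + 1) = reach_prob n - gap (real n + 1) (x + 1)"
      using C x Gp \<open>gap (real n) (x + 1) < 0\<close> by (auto simp: drawdown_cdf_def field_simps)
    ultimately show ?thesis using gap_diff[of "real n + 1" x] by (simp add: right_diff_distrib)
  next
    case D
    have "x = int n \<or> gap (real n) (x + 1) < 0" using D lev[of "x + 1"] by auto
    note o0 = opt0[OF D(1) this]
    have g1: "0 \<le> gap (real n + 1) x" using D(1) lev[of x] by simp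
    have "strip n x = reach_prob n - reach_prob (Suc n)" "drawdown_cdf n x = 0"
      using D x g1 by (auto simp: strip_eq drawdown_cdf_def)
    moreover have "(real n - real_of_int x) * reach_prob n
        = (real n + 1 - real_of_int x) * reach_prob (Suc n)"
      using o0 opt1[OF g1 D(2)] by simp
    then have "(real n + 1 - real_of_int x) * (reach_prob n - reach_prob (Suc n)) = reach_prob n"
      by (simp add: algebra_simps)
    ultimately show ?thesis using z1[OF D(2)] by simp
  next
    case E
    note o0 = opt0[OF E(1) disjI2[OF E(4)]]
    have "strip n x = reach_prob n - reach_prob (Suc n)" "drawdown_cdf n x = 0"
      using E x lev[of x] by (auto simp: strip_eq drawdown_cdf_def)
    moreover have "strip n (x + 1) = tail (x + 1) - reach_prob (Suc n)"
      using E x by (simp add: strip_eq)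
    moreover have "reach_prob n * drawdown_cdf n (x + 1) = reach_prob n - gap (real n + 1) (x + 1)"
      using E x Gp by (auto simp: drawdown_cdf_def field_simps)
    moreover have "call (x + 1) = (real n - real_of_int x) * reach_prob n - tail (x + 1)"
      using call_diff[of x] o0 by simp
    then have "gap (real n + 1) (x + 1) = reach_prob n
        - (real n + 1 - real_of_int x) * (reach_prob n - tail (x + 1))"
      by (simp add: gap_def algebra_simps)
    ultimately show ?thesis by simp
  next
    case F
    then show ?thesis using x lev[of x] by (simp add: strip_eq drawdown_cdf_def)
  qed
qed

text \<open>At or beyond the top of the support \<open>reach_prob (n + 1)\<close> is 0, so
  everything that still arrives at \<open>n\<close> is deposited at \<open>n\<close>.\<close>

lemma strip_diff_beyond:
  assumes "tail (int n + 1) = 0" "x \<le> int n"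
  shows "strip n x - strip n (x + 1) = (if x = int n then reach_prob n else 0)"
proof -
  have S: "tail (int (Suc n) + 1) = 0" using assms(1) tail_antimono[of "int n + 1" "int (Suc n) + 1"]
    tail_nonneg[of "int (Suc n) + 1"] by linarith
  have G1: "reach_prob (Suc n) = 0" using reach_prob_beyond_support[OF S] assms(1) by (simp add: add.commute)
  have G0: "reach_prob n = tail (int n)" by (rule reach_prob_beyond_support[OF assms(1)])
  show ?thesis
  proof (cases "x = int n")
    case True
    then show ?thesis using assms G0 G1 tail_nonneg[of "int n"]
      by (simp add: strip_def min_absorb1 min_absorb2)
  next
    case False
    then have "tail (int n) \<le> tail x" "tail (int n) \<le> tail (x + 1)" using assms by (auto intro!: tail_antimono)
    then show ?thesis using False G0 G1 by (simp add: strip_def min_absorb1 min_absorb2)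
  qed
qed

end

section \<open>The levels and the stopping probabilities\<close>

lemma kth_largest_rank:
  fixes A :: "int set"
  assumes bdd: "\<And>y. y \<in> A \<Longrightarrow> y \<le> C" and x: "x \<in> A"
  shows "kth_largest A (Suc (card {y\<in>A. x < y})) = x"
  unfolding kth_largest_def
proof (rule the_equality)
  show "x \<in> A \<and> card {y \<in> A. x < y} = Suc (card {y \<in> A. x < y}) - 1" using x by simp
next
  have fin: "finite {y\<in>A. z < y}" for z
    by (rule finite_subset[of _ "{z..C}"]) (use bdd in auto)
  have lt: "card {y\<in>A. v < y} < card {y\<in>A. u < y}" if "u < v" "v \<in> A" for u v
    by (rule psubset_card_mono[OF fin]) (use that in force)
  fix z assume "z \<in> A \<and> card {y \<in> A. z < y} = Suc (card {y \<in> A. x < y}) - 1"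
  then show "z = x" using lt[of z x] lt[of x z] x by (cases z x rule: linorder_cases) auto
qed

text \<open>The set may be infinite downwards, as happens at level 0, so the ranks are found by
  descending from the maximum; only the part above a given point is finite.\<close>

lemma ex_rank:
  fixes A :: "int set"
  assumes bdd: "\<And>y. y \<in> A \<Longrightarrow> y \<le> C" and k: "infinite A \<or> k < card A"
  shows "\<exists>x\<in>A. card {y\<in>A. x < y} = k"
  using k
proof (induction k)
  have fin: "finite {y\<in>A. z \<le> y}" for z
    by (rule finite_subset[of _ "{z..C}"]) (use bdd in auto)
  have below: "\<exists>m\<in>A. m < w \<and> (\<forall>y\<in>A. y < w \<longrightarrow> y \<le> m)" if "\<exists>z\<in>A. z < w" for w
  proof -
    from that obtain z where z: "z \<in> A" "z < w" by blast
    define F where "F = {y\<in>A. z \<le> y \<and> y < w}"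
    have F: "finite F" "z \<in> F" unfolding F_def using z by (auto intro: finite_subset[OF _ fin[of z]])
    have m: "Max F \<in> F" using F by (intro Max_in) auto
    have "y \<le> Max F" if "y \<in> A" "y < w" for y
    proof (cases "z \<le> y")
      case True then show ?thesis using that F by (intro Max_ge) (auto simp: F_def)
    next
      case False then show ?thesis using Max_ge[OF F] by linarith
    qed
    then show ?thesis using m by (intro bexI[of _ "Max F"]) (auto simp: F_def)
  qed
  {
    case 0
    then have "A \<noteq> {}" by auto
    then obtain m where "m \<in> A" "\<forall>y\<in>A. y \<le> m"
      using below[of "C + 1"] bdd by (metis ex_in_conv zless_add1_eq order_le_less)
    then have "{y\<in>A. m < y} = {}" by auto
    with \<open>m \<in> A\<close> show ?case by (metis card.empty)
  next
    case (Suc k)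
    then obtain x where x: "x \<in> A" "card {y\<in>A. x < y} = k" by auto
    have "{y\<in>A. x \<le> y} = insert x {y\<in>A. x < y}" using x by auto
    then have cx: "card {y\<in>A. x \<le> y} = Suc k"
      using x by (simp add: finite_subset[OF _ fin[of x]] subset_iff)
    have "\<exists>z\<in>A. z < x"
    proof (rule ccontr)
      assume "\<not> (\<exists>z\<in>A. z < x)"
      then have "A = {y\<in>A. x \<le> y}" by auto
      then show False using cx Suc.prems fin[of x] by auto
    qed
    from below[OF this] obtain m where m: "m \<in> A" "m < x" "\<forall>y\<in>A. y < x \<longrightarrow> y \<le> m" by blast
    have "{y\<in>A. m < y} = {y\<in>A. x \<le> y}" using m by force
    then have "card {y\<in>A. m < y} = Suc k" using cx by simp
    then show ?case using m by blast
  }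
qed

section \<open>The lists of levels in terms of atoms and \<open>gap\<close>\<close>

context centred_pmf
begin

text \<open>For \<open>k \<le> n\<close>, the value \<open>k\<close> is taken on [n, n + 1] iff some
  y there has its sign change at \<open>k\<close>. As the sign change moves up with y, this asks
  that at \<open>n + 1\<close> it is not below \<open>k\<close>, that at \<open>n\<close> it is not
  above \<open>k\<close>, and that \<open>k\<close> carries mass.\<close>

lemma Xset_iff:
  assumes pos: "0 < tail (int n + 1)"
  shows "k \<in> Xset \<mu> n \<longleftrightarrow> 0 < pmf \<mu> k \<and> 0 \<le> gap (real n + 1) k
     \<and> (k \<le> int n \<longrightarrow> gap (real n) (k + 1) < 0) \<and> (k \<le> int n \<or> n = 0)"
proof (cases "k \<le> int n")
  case True
  have tk1: "0 < tail (k + 1)" using pos tail_antimono[of "k + 1" "int n + 1"] True by linarith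
  then have tk: "0 < tail k" using tail_antimono[of k "k + 1"] by linarith
  have "(\<exists>y\<in>{real n..real n + 1}. bmu \<mu> y = ereal (real_of_int k)) \<longleftrightarrow>
      0 < pmf \<mu> k \<and> 0 \<le> gap (real n + 1) k \<and> gap (real n) (k + 1) < 0" (is "?L \<longleftrightarrow> ?R")
  proof
    assume ?L
    then obtain y where y: "y \<in> {real n..real n + 1}" "bmu \<mu> y = ereal (real_of_int k)" by blast
    note g = bmu_eqD[OF y(2) tk1]
    have "0 < (y - real_of_int k) * pmf \<mu> k" using g gap_diff[of y k] by linarith
    then have "0 < pmf \<mu> k" using pmf_nonneg[of \<mu> k] by (metis less_eq_real_def mult_zero_right)
    then show ?R using g gap_mono_level[of y "real n + 1" k] gap_mono_level[of "real n" y "k + 1"] y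
      by auto
  next
    assume R: ?R
    \<comment> \<open>The second argument is \<open>psi k\<close>, the value of y at which
      \<open>gap\<close> vanishes at \<open>k\<close>; there the decrement at the atom
      \<open>k\<close> already makes \<open>gap\<close> negative at \<open>k + 1\<close>.\<close>
    define y where "y = max (real n) (real_of_int k + call k / tail k)"
    have z: "gap (real_of_int k + call k / tail k) k = 0" using tk by (simp add: gap_def)
    have "0 \<le> gap y k" using gap_mono_level[of "real_of_int k + call k / tail k" y k] z by (simp add: y_def)
    moreover have "gap (real_of_int k + call k / tail k) (k + 1) < 0"
    proof -
      have "0 < call k / tail k * pmf \<mu> k" using R tk call_pos[OF tk1] by simp
      then show ?thesis using gap_diff[of "real_of_int k + call k / tail k" k] z by simp
    qed
    then have "gap y (k + 1) < 0" using R by (simp add: y_def max_def)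
    moreover have "call k \<le> (real n + 1 - real_of_int k) * tail k" using R by (simp add: gap_def)
    then have "y \<in> {real n..real n + 1}" using tk by (auto simp: y_def field_simps)
    ultimately show ?L using bmu_eqI[OF tk1] by blast
  qed
  then show ?thesis using True by (simp add: Xset_def)
next
  case False
  show ?thesis
  proof (cases "n = 0")
    \<comment> \<open>The cut at \<open>n\<close> is imposed for n \<ge> 1 only, so at level 0 the
      value \<open>k = 1\<close> can occur, namely when the support ends at 1.\<close>
    case n: True
    have bm: "bmu \<mu> y \<le> ereal 1" if "y \<le> 1" for y
      unfolding bmu_def using le_of_psi_le[of 1] that by (intro Sup_least) (auto intro: order_trans)
    have "k \<in> Xset \<mu> 0 \<longleftrightarrow> k = 1 \<and> tail 2 = 0"
    proof
      assume "k \<in> Xset \<mu> 0"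
      then obtain y where y: "y \<in> {0..1}" "bmu \<mu> y = ereal (real_of_int k)"
        by (auto simp: Xset_def)
      have "k \<le> 1" using bm[of y] y by auto
      then have k: "k = 1" using False n by auto
      have "\<not> 0 < tail 2"
      proof
        assume "0 < tail 2"
        then show False using bmu_eqD(1)[OF y(2)] gap_neg[of 1 y] y k by auto
      qed
      then show "k = 1 \<and> tail 2 = 0" using k tail_nonneg[of 2] by linarith
    next
      assume "k = 1 \<and> tail 2 = 0"
      then show "k \<in> Xset \<mu> 0" using bmu_beyond_support(1)[of 1] by (auto simp: Xset_def intro!: bexI[of _ 1])
    qed
    also have "\<dots> \<longleftrightarrow> 0 < pmf \<mu> k \<and> 0 \<le> gap 1 k"
    proof
      assume "k = 1 \<and> tail 2 = 0"
      then show "0 < pmf \<mu> k \<and> 0 \<le> gap 1 k"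
        using pos n tail_diff[of 1] call_zero'[of 1] by (simp add: gap_def)
    next
      assume R: "0 < pmf \<mu> k \<and> 0 \<le> gap 1 k"
      then have "0 < tail k" using tail_diff[of k] tail_nonneg[of "k + 1"] by linarith
      then have k: "k = 1" using gap_neg[of k 1] R False n by force
      then have "\<not> 0 < tail 2" using gap_neg[of 1 1] R by auto
      then show "k = 1 \<and> tail 2 = 0" using k tail_nonneg[of 2] by linarith
    qed
    finally show ?thesis using n False by simp
  next
    case n: False
    then show ?thesis using False by (simp add: Xset_def)
  qed
qed

lemma xlow_iff: "- \<infinity> < xlow \<mu> \<longleftrightarrow> (\<exists>k. tail k = 1)"
proof
  assume "- \<infinity> < xlow \<mu>"
  then obtain r where r: "ereal r < xlow \<mu>" by (metis ereal_dense2)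
  have "\<lfloor>r\<rfloor> \<le> y" if "y \<in> set_pmf \<mu>" for y
  proof -
    have "xlow \<mu> \<le> ereal (real_of_int y)" unfolding xlow_def using that by (intro Inf_lower) auto
    then have "ereal r < ereal (real_of_int y)" using r by (rule less_le_trans[rotated])
    then show ?thesis by simp linarith
  qed
  then have "tail \<lfloor>r\<rfloor> = 1" unfolding tail_alt
    by (subst measure_pmf.prob_eq_1) (auto simp: AE_measure_pmf_iff)
  then show "\<exists>k. tail k = 1" ..
next
  assume "\<exists>k. tail k = 1"
  then obtain k where "tail k = 1" ..
  then have "\<forall>y\<in>set_pmf \<mu>. k \<le> y" unfolding tail_alt
    by (subst (asm) measure_pmf.prob_eq_1) (auto simp: AE_measure_pmf_iff)
  then have "ereal (real_of_int k) \<le> xlow \<mu>" unfolding xlow_def by (intro Inf_greatest) auto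
  then show "- \<infinity> < xlow \<mu>" by (metis less_le_trans MInfty_neq_ereal(1) ereal_infty_less(2))
qed

text \<open>By mean zero \<open>gap 0 k\<close> is E[X; X < k], which for negative \<open>k\<close>
  is never positive and vanishes only without mass below \<open>k\<close>. Level 0 thus has a sign
  change at a negative index only if the support is bounded below.\<close>

lemma gap_zero_iff:
  assumes "k < 0" shows "0 \<le> gap 0 k \<longleftrightarrow> tail k = 1"
proof
  assume "0 \<le> gap 0 k"
  then have "1 \<le> tail k" using reach_prob_le_tail[of k 0] assms by (simp add: reach_prob_def)
  then show "tail k = 1" using tail_le_1[of k] by linarith
next
  assume *: "tail k = 1"
  have "AE x in measure_pmf \<mu>. x \<in> {k..}"
    using * unfolding tail_alt by (subst (asm) measure_pmf.prob_eq_1) auto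
  then have "measure_pmf.expectation \<mu> (\<lambda>x. indicator {k..} x * real_of_int x)
      = measure_pmf.expectation \<mu> real_of_int"
    by (intro integral_cong_AE) auto
  then show "0 \<le> gap 0 k" by (simp add: gap_expectation mean_zero)
qed

lemma gap_le:
  assumes "real_of_int k \<le> y + 1" shows "gap y k \<le> y"
proof (rule LIMSEQ_le_const[OF gap_tendsto])
  show "\<exists>N. \<forall>i\<ge>N. gap y k \<le> gap y (- int i)"
    by (rule exI[of _ "nat (- k)"]) (use assms in \<open>auto intro!: gap_antimono\<close>)
qed

context
  fixes n :: nat
  assumes pos: "0 < tail (int n + 1)"
begin

lemma Xset_le: "k \<in> Xset \<mu> n \<Longrightarrow> k \<le> int n + 1"
proof -
  assume k: "k \<in> Xset \<mu> n"
  have "0 < pmf \<mu> k" using k by (simp add: Xset_iff[OF pos])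
  then have "0 < tail k" using tail_diff[of k] tail_nonneg[of "k + 1"] by linarith
  moreover have "0 \<le> gap (real n + 1) k" using k by (simp add: Xset_iff[OF pos])
  ultimately have "\<not> real n + 1 < real_of_int k" using gap_neg[of k "real n + 1"] by auto
  then show ?thesis by linarith
qed

text \<open>An index from \<open>x\<close> up to but excluding \<open>z\<close> is no level although
  both sign conditions hold there, so it carries no mass and \<open>gap (n + 1)\<close> does not
  change across it.\<close>

lemma gap_constant_between:
  assumes z: "z \<in> Xset \<mu> n" "x \<le> z" "\<And>y. y \<in> Xset \<mu> n \<Longrightarrow> x \<le> y \<Longrightarrow> z \<le> y"
    and g: "gap (real n) x < 0"
  shows "gap (real n + 1) x = gap (real n + 1) z"
proof -
  have zn: "z \<le> int n + 1" by (rule Xset_le[OF z(1)])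
  have gz: "0 \<le> gap (real n + 1) z" using z(1) by (simp add: Xset_iff[OF pos])
  have step: "gap (real n + 1) j = gap (real n + 1) (j + 1)" if "x \<le> j" "j < z" for j
  proof -
    have "gap (real n) (j + 1) \<le> gap (real n) x" using that zn by (intro gap_antimono) auto
    moreover have "gap (real n + 1) z \<le> gap (real n + 1) j" using that zn by (intro gap_antimono) auto
    moreover have "j \<notin> Xset \<mu> n" using z(3)[of j] that by auto
    ultimately have "\<not> 0 < pmf \<mu> j" using g gz that zn by (simp add: Xset_iff[OF pos])
    then have "pmf \<mu> j = 0" using pmf_nonneg[of \<mu> j] by linarith
    then show ?thesis using gap_diff[of "real n + 1" j] by simp
  qed
  have "x \<le> j \<longrightarrow> gap (real n + 1) j = gap (real n + 1) z" if "j \<le> z" for j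
    using that
  proof (induction j rule: int_le_induct)
    case (step i)
    then show ?case using \<open>\<And>j. x \<le> j \<Longrightarrow> j < z \<Longrightarrow> gap (real n + 1) j = gap (real n + 1) (j + 1)\<close>[of "i - 1"] by auto
  qed simp
  then show ?thesis using z(2) by blast
qed

text \<open>The lowest level is the sign change of \<open>gap n\<close>, hence the contact of the
  supporting line from (n, 0); this is what turns \<open>Gam\<close> into
  \<open>reach_prob n\<close>.\<close>

lemma fin_case_crossing:
  assumes "fin_case \<mu> n"
  obtains b where "b \<in> Xset \<mu> n" "b < int n" "0 \<le> gap (real n) b" "gap (real n) (b + 1) < 0"
    "\<And>y. y \<in> Xset \<mu> n \<Longrightarrow> b \<le> y"
proof -
  have "1 \<le> n \<or> (\<exists>k0<0. 0 \<le> gap 0 k0)"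
  proof (cases "n = 0")
    case True
    then obtain k where "tail k = 1" using assms xlow_iff by (auto simp: fin_case_def)
    \<comment> \<open>The starting point is moved below 0 to suit
      \<open>gap_zero_iff\<close>.\<close>
    then have "tail (min k (-1)) = 1"
      using tail_antimono[of "min k (-1)" k] tail_le_1[of "min k (-1)"] by linarith
    then show ?thesis using gap_zero_iff[of "min k (-1)"] by (intro disjI2 exI[of _ "min k (-1)"]) auto
  qed simp
  then obtain k0 where "1 \<le> n \<or> k0 < 0 \<and> 0 \<le> gap 0 k0" by blast
  from ex_crossing[OF pos this] obtain b where b: "b < int n" "0 \<le> gap (real n) b" "gap (real n) (b + 1) < 0"
    by blast
  have "0 < (real n - real_of_int b) * pmf \<mu> b" using b gap_diff[of "real n" b] by linarith
  then have "0 < pmf \<mu> b" using pmf_nonneg[of \<mu> b] by (metis less_eq_real_def mult_zero_right)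
  moreover have "0 \<le> gap (real n + 1) b" using b gap_mono_level[of "real n" "real n + 1" b] by simp
  ultimately have bX: "b \<in> Xset \<mu> n" using b by (simp add: Xset_iff[OF pos])
  have "b \<le> y" if y: "y \<in> Xset \<mu> n" for y
  proof (rule ccontr)
    assume "\<not> b \<le> y"
    then have "gap (real n) b \<le> gap (real n) (y + 1)" using b by (intro gap_antimono) auto
    then show False using y b \<open>\<not> b \<le> y\<close> by (auto simp: Xset_iff[OF pos])
  qed
  then show ?thesis using that bX b by blast
qed

lemma finite_Xset_ge: "finite {y\<in>Xset \<mu> n. x \<le> y}"
  by (rule finite_subset[of _ "{x..int n + 1}"]) (use Xset_le in auto)

text \<open>Justifies the case split in \<open>Lsz\<close>. If the support is unbounded below,
  \<open>gap 0\<close> is negative at every negative index, and then every atom far enough down is a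
  level.\<close>

lemma finite_Xset_iff: "finite (Xset \<mu> n) \<longleftrightarrow> fin_case \<mu> n"
proof
  assume "fin_case \<mu> n"
  then obtain b where "\<And>y. y \<in> Xset \<mu> n \<Longrightarrow> b \<le> y" using fin_case_crossing by metis
  then have "Xset \<mu> n = {y\<in>Xset \<mu> n. b \<le> y}" by auto
  then show "finite (Xset \<mu> n)" using finite_Xset_ge[of b] by simp
next
  assume fin: "finite (Xset \<mu> n)"
  show "fin_case \<mu> n"
  proof (rule ccontr)
    assume nf: "\<not> fin_case \<mu> n"
    then have n: "n = 0" and nx: "\<And>k. tail k \<noteq> 1" using xlow_iff by (auto simp: fin_case_def)
    have neg: "gap 0 k < 0" if "k < 0" for k using gap_zero_iff[OF that] nx by auto
    have "eventually (\<lambda>i. 0 < gap 1 (- int i)) sequentially"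
      by (intro order_tendstoD(1)[OF gap_tendsto]) simp
    then obtain i where i: "0 < gap 1 (- int i)" by (auto simp: eventually_sequentially)
    obtain C where C: "\<And>y. y \<in> Xset \<mu> n \<Longrightarrow> C \<le> y"
      using finite_imp_Sup_less[OF fin] fin by (metis bdd_below.E bdd_below_finite)
    define c where "c = min (min C (- int i)) (-1)"
    have "tail c < 1" using nx[of c] tail_le_1[of c] by linarith
    then have "\<not> (\<forall>y\<in>set_pmf \<mu>. c \<le> y)"
      unfolding tail_alt by (metis (no_types, lifting) AE_measure_pmf_iff atLeast_iff less_irrefl
          measure_pmf.prob_eq_1 sets_measure_pmf UNIV_I)
    then obtain y where y: "y \<in> set_pmf \<mu>" "y < c" by auto
    have "gap 1 (- int i) \<le> gap 1 y" using y by (intro gap_antimono) (auto simp: c_def)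
    then have "y \<in> Xset \<mu> n"
      using y n i neg[of "y + 1"] unfolding Xset_iff[OF pos] by (auto simp: pmf_positive c_def)
    then have "C \<le> y" by (rule C)
    then show False using y by (simp add: c_def)
  qed
qed

lemma AYidx_iff: "(n, k) \<in> AYidx \<mu> \<longleftrightarrow> 1 \<le> k \<and> (infinite (Xset \<mu> n) \<or> k \<le> card (Xset \<mu> n))"
  using pos by (auto simp: AYidx_def Lsz_def less_xbar_iff finite_Xset_iff)

text \<open>On levels this inverts \<open>xk\<close>. In general it is the index of the last level
  at or above \<open>x\<close>, so a barrier below \<open>x\<close> means that the first
  \<open>ncount x\<close> coins all show 1.\<close>

definition ncount :: "int \<Rightarrow> nat" where
  "ncount x = card {y\<in>Xset \<mu> n. x \<le> y}"

lemma ncount_eq_Suc: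
  assumes "x \<in> Xset \<mu> n" shows "ncount x = Suc (card {y\<in>Xset \<mu> n. x < y})"
proof -
  have "{y\<in>Xset \<mu> n. x \<le> y} = insert x {y\<in>Xset \<mu> n. x < y}" using assms by auto
  moreover have "finite {y\<in>Xset \<mu> n. x < y}" by (rule finite_subset[OF _ finite_Xset_ge[of x]]) auto
  ultimately show ?thesis by (simp add: ncount_def)
qed

lemma xk_ncount: "x \<in> Xset \<mu> n \<Longrightarrow> xk \<mu> n (ncount x) = x"
  using kth_largest_rank[of "Xset \<mu> n" "int n + 1" x] Xset_le by (simp add: ncount_eq_Suc xk_def)

lemma ncount_le_card: "finite (Xset \<mu> n) \<Longrightarrow> ncount x \<le> card (Xset \<mu> n)"
  unfolding ncount_def by (rule card_mono) auto

lemma xk_in: assumes "(n, k) \<in> AYidx \<mu>" shows "xk \<mu> n k \<in> Xset \<mu> n" "ncount (xk \<mu> n k) = k"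
proof -
  have "infinite (Xset \<mu> n) \<or> k - 1 < card (Xset \<mu> n)" using assms by (auto simp: AYidx_iff)
  from ex_rank[OF _ this, of "int n + 1"] obtain x
    where x: "x \<in> Xset \<mu> n" "card {y\<in>Xset \<mu> n. x < y} = k - 1" using Xset_le by blast
  then have "ncount x = k" using assms by (simp add: ncount_eq_Suc AYidx_iff)
  then show "xk \<mu> n k \<in> Xset \<mu> n" "ncount (xk \<mu> n k) = k" using xk_ncount[OF x(1)] x(1) by auto
qed

lemma ncount_antimono: "x \<le> y \<Longrightarrow> ncount y \<le> ncount x"
  unfolding ncount_def by (rule card_mono[OF finite_Xset_ge]) auto

lemma xk_ge_iff:
  assumes "(n, k) \<in> AYidx \<mu>" shows "x \<le> xk \<mu> n k \<longleftrightarrow> k \<le> ncount x"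
proof
  assume "x \<le> xk \<mu> n k"
  then show "k \<le> ncount x" using ncount_antimono[of x "xk \<mu> n k"] xk_in[OF assms] by simp
next
  assume k: "k \<le> ncount x"
  show "x \<le> xk \<mu> n k"
  proof (rule ccontr)
    assume "\<not> x \<le> xk \<mu> n k"
    then have "{y\<in>Xset \<mu> n. x \<le> y} \<subset> {y\<in>Xset \<mu> n. xk \<mu> n k \<le> y}" using xk_in(1)[OF assms] by force
    then have "ncount x < ncount (xk \<mu> n k)" unfolding ncount_def by (rule psubset_card_mono[OF finite_Xset_ge])
    then show False using k xk_in(2)[OF assms] by simp
  qed
qed

lemma AYidx_downward: "(n, k) \<in> AYidx \<mu> \<Longrightarrow> 1 \<le> j \<Longrightarrow> j \<le> k \<Longrightarrow> (n, j) \<in> AYidx \<mu>"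
  by (auto simp: AYidx_iff)

lemma ncount_AYidx: "1 \<le> k \<Longrightarrow> k \<le> ncount x \<Longrightarrow> (n, k) \<in> AYidx \<mu>"
  using ncount_le_card[of x] by (auto simp: AYidx_iff)

lemma xk_less: 
  assumes "(n, Suc k) \<in> AYidx \<mu>" "1 \<le> k" shows "xk \<mu> n (Suc k) < xk \<mu> n k"
proof -
  have "(n, k) \<in> AYidx \<mu>" by (rule AYidx_downward[OF assms(1)]) (use assms in auto)
  then show ?thesis using xk_ge_iff[OF assms(1), of "xk \<mu> n k"] xk_in(2)[of k] by auto
qed

lemma gap_consecutive:
  assumes "(n, Suc k) \<in> AYidx \<mu>" "1 \<le> k"
  shows "gap (real n + 1) (xk \<mu> n (Suc k) + 1) = gap (real n + 1) (xk \<mu> n k)"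
    and "gap (real n) (xk \<mu> n (Suc k) + 1) < 0"
proof -
  have k: "(n, k) \<in> AYidx \<mu>" by (rule AYidx_downward[OF assms(1)]) (use assms in auto)
  note lt = xk_less[OF assms]
  have "xk \<mu> n (Suc k) \<le> int n" using lt Xset_le[OF xk_in(1)[OF k]] by simp
  then show neg: "gap (real n) (xk \<mu> n (Suc k) + 1) < 0"
    using xk_in(1)[OF assms(1)] by (simp add: Xset_iff[OF pos])
  show "gap (real n + 1) (xk \<mu> n (Suc k) + 1) = gap (real n + 1) (xk \<mu> n k)"
  proof (rule gap_constant_between[OF xk_in(1)[OF k] _ _ neg])
    fix y assume y: "y \<in> Xset \<mu> n" "xk \<mu> n (Suc k) + 1 \<le> y"
    then have "\<not> Suc k \<le> ncount y" using xk_ge_iff[OF assms(1), of y] by auto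
    then have "ncount y \<le> k" by simp
    moreover have "1 \<le> ncount y" using ncount_eq_Suc[OF y(1)] by simp
    ultimately show "xk \<mu> n k \<le> y" using xk_ge_iff[of "ncount y" "xk \<mu> n k"] xk_ncount[OF y(1)]
        xk_in(2)[OF k] ncount_AYidx[of "ncount y" y] by auto
  qed (use lt in simp)
qed

section \<open>Telescoping the weights into survival probabilities\<close>

definition surv :: "nat \<Rightarrow> real" where
  "surv k = (if fin_case \<mu> n then ffin \<mu> n k else finf \<mu> k)"

lemma surv_0: "surv 0 = 1" by (simp add: surv_def ffin_def finf_def)

lemma surv_last: "fin_case \<mu> n \<Longrightarrow> surv (card (Xset \<mu> n)) = 0"
proof -
  assume f: "fin_case \<mu> n"
  then obtain b where "b \<in> Xset \<mu> n" using fin_case_crossing by metis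
  then have "card (Xset \<mu> n) \<noteq> 0" using f finite_Xset_iff by auto
  then show ?thesis using f by (simp add: surv_def ffin_def)
qed

lemma xk_last:
  assumes "fin_case \<mu> n" "b \<in> Xset \<mu> n" "\<And>y. y \<in> Xset \<mu> n \<Longrightarrow> b \<le> y"
  shows "xk \<mu> n (card (Xset \<mu> n)) = b"
proof -
  have "{y\<in>Xset \<mu> n. b \<le> y} = Xset \<mu> n" using assms(3) by auto
  then show ?thesis using xk_ncount[OF assms(2)] by (simp add: ncount_def)
qed

lemma weight_eq_gap_diff:
  assumes "(n, Suc k) \<in> AYidx \<mu>" "1 \<le> k"
  shows "(real n + 1 - real_of_int (xk \<mu> n (Suc k))) * pmf \<mu> (xk \<mu> n (Suc k))
    = gap (real n + 1) (xk \<mu> n (Suc k)) - gap (real n + 1) (xk \<mu> n k)"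
  using gap_consecutive(1)[OF assms] gap_diff[of "real n + 1" "xk \<mu> n (Suc k)"] by simp

text \<open>The weights are differences of \<open>gap (n + 1)\<close> along the list, so their tail
  sums telescope. The last weight anchors the sum at \<open>reach_prob n\<close>: its bracket cuts
  the lowest atom down to the share of level \<open>n\<close>.\<close>

lemma surv_formula_fin:
  assumes fin: "fin_case \<mu> n" and k: "1 \<le> k" "k < card (Xset \<mu> n)"
  shows "surv k = 1 - gap (real n + 1) (xk \<mu> n k) / reach_prob n"
proof -
  define L where "L = card (Xset \<mu> n)"
  have finX: "finite (Xset \<mu> n)" using fin by (simp add: finite_Xset_iff)
  obtain b where b: "b \<in> Xset \<mu> n" "b < int n" "0 \<le> gap (real n) b" "gap (real n) (b + 1) < 0"
    "\<And>y. y \<in> Xset \<mu> n \<Longrightarrow> b \<le> y" using fin_case_crossing[OF fin] by metis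
  have xL: "xk \<mu> n L = b" using xk_last[OF fin b(1,5)] by (simp add: L_def)
  have Gp: "0 < reach_prob n" by (rule reach_prob_pos[OF pos])
  have c: "call b = (real n - real_of_int b) * reach_prob n" using reach_prob_optimal[OF b(2,3)] b(4) by simp
  have tb: "0 < tail b" using pos b(2) tail_antimono[of b "int n + 1"] by linarith
  have nb: "0 < real n - real_of_int b" using b(2) by linarith
  have ps: "tail b * (psi \<mu> (real_of_int b) - real_of_int b) = call b"
    using tb by (simp add: psi_eq field_simps)
  have mu: "mubar \<mu> (real_of_int b) = tail b" by (simp add: tail_def)
  \<comment> \<open>The lowest level is the contact \<open>b\<close>, so \<open>Gam\<close> is
    \<open>call b / (n - b)\<close>.\<close>
  have Gam: "Gam \<mu> n = reach_prob n"
    using nb ps by (simp add: Gam_def Let_def L_def[symmetric] xL mu c)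
  have gL: "reach_prob n * gfin \<mu> n L = reach_prob n - gap (real n + 1) (b + 1)"
  proof -
    have "tail b * (real n - psi \<mu> (real_of_int b))
        = tail b * (real n - real_of_int b) - tail b * (psi \<mu> (real_of_int b) - real_of_int b)"
      by (simp add: algebra_simps)
    also have "\<dots> = (tail b - reach_prob n) * (real n - real_of_int b)"
      unfolding ps c by (simp add: algebra_simps)
    finally have "mubar \<mu> (real_of_int b) * (real n - psi \<mu> (real_of_int b)) / (real n - real_of_int b)
        = tail b - reach_prob n" using nb by (simp add: mu)
    then have "reach_prob n * gfin \<mu> n L = (real n + 1 - real_of_int b) * (pmf \<mu> b - (tail b - reach_prob n))"
      using Gp by (simp add: gfin_def Let_def L_def[symmetric] xL Gam)
    also have "\<dots> = (real n + 1 - real_of_int b) * (reach_prob n - tail (b + 1))"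
      using tail_diff[of b] by simp
    also have "\<dots> = reach_prob n - gap (real n + 1) (b + 1)"
    proof -
      have "call (b + 1) = (real n - real_of_int b) * reach_prob n - tail (b + 1)"
        using call_diff[of b] c by simp
      then show ?thesis by (simp add: gap_def algebra_simps)
    qed
    finally show ?thesis .
  qed
  have gi: "reach_prob n * gfin \<mu> n (Suc i) = gap (real n + 1) (xk \<mu> n (Suc i)) - gap (real n + 1) (xk \<mu> n i)"
    if "1 \<le> i" "Suc i < L" for i
  proof -
    have "(n, Suc i) \<in> AYidx \<mu>" using that by (auto simp: AYidx_iff L_def)
    then show ?thesis using that Gp weight_eq_gap_diff[of i]
      by (simp add: gfin_def Let_def L_def[symmetric] Gam)
  qed
  have "k \<le> L - 1" using k by (simp add: L_def)
  \<comment> \<open>The induction runs downwards from the last index but one. The guard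
    \<open>1 \<le> k\<close> keeps it away from \<open>ffin\<close> at 0, which is 1 by definition
    and not a sum.\<close>
  then have "1 \<le> k \<longrightarrow> reach_prob n * ffin \<mu> n k = reach_prob n - gap (real n + 1) (xk \<mu> n k)"
  proof (induction k rule: inc_induct)
    case base
    show ?case
    proof
      assume L1: "1 \<le> L - 1"
      then have S: "Suc (L - 1) = L" by simp
      have "(n, Suc (L - 1)) \<in> AYidx \<mu>" using L1 by (auto simp: AYidx_iff L_def)
      from gap_consecutive(1)[OF this L1] have "gap (real n + 1) (b + 1) = gap (real n + 1) (xk \<mu> n (L - 1))"
        by (simp only: S xL)
      then show "reach_prob n * ffin \<mu> n (L - 1) = reach_prob n - gap (real n + 1) (xk \<mu> n (L - 1))"
        using gL L1 by (simp add: ffin_def L_def[symmetric])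
    qed
  next
    case (step i)
    show ?case
    proof
      assume i: "1 \<le> i"
      have iL: "Suc i < L" using step by simp
      have "ffin \<mu> n i = gfin \<mu> n (Suc i) + ffin \<mu> n (Suc i)"
        using i iL by (simp add: ffin_def L_def[symmetric] sum.atLeast_Suc_atMost)
      then show "reach_prob n * ffin \<mu> n i = reach_prob n - gap (real n + 1) (xk \<mu> n i)"
        using step.IH gi[OF i iL] by (simp add: distrib_left)
    qed
  qed
  then have "reach_prob n * surv k = reach_prob n - gap (real n + 1) (xk \<mu> n k)"
    using fin k by (simp add: surv_def)
  then show ?thesis using Gp by (simp add: field_simps)
qed

text \<open>No last weight anchors the sum here. Instead the levels drop by at least one per index,
  so \<open>gap 1\<close> along them tends to 1, which is \<open>reach_prob 0\<close>.\<close>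

lemma surv_formula_inf:
  assumes inf: "\<not> fin_case \<mu> n" and k: "1 \<le> k"
  shows "surv k = 1 - gap (real n + 1) (xk \<mu> n k) / reach_prob n"
proof -
  have n: "n = 0" using inf by (auto simp: fin_case_def)
  have idx: "(n, i) \<in> AYidx \<mu>" if "1 \<le> i" for i
    using that inf finite_Xset_iff by (simp add: AYidx_iff)
  define f where "f i = gap 1 (xk \<mu> 0 (i + k))" for i
  have dec: "xk \<mu> 0 (i + k) \<le> 1 - int i" for i
  proof (induction i)
    case 0
    show ?case using Xset_le[OF xk_in(1)[OF idx[OF k]]] n by simp
  next
    case (Suc i)
    have "xk \<mu> 0 (Suc (i + k)) < xk \<mu> 0 (i + k)" using xk_less[of "i + k"] idx[of "Suc (i + k)"] k n by simp
    then show ?case using Suc by simp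
  qed
  have "f \<longlonglongrightarrow> 1"
  proof (rule tendsto_sandwich[OF _ _ _ tendsto_const])
    show "eventually (\<lambda>i. gap 1 (- int (i - 1)) \<le> f i) sequentially"
      unfolding eventually_sequentially
    proof (intro exI allI impI)
      fix i :: nat assume "1 \<le> i"
      then show "gap 1 (- int (i - 1)) \<le> f i" unfolding f_def
        using dec[of i] by (intro gap_antimono) auto
    qed
    show "eventually (\<lambda>i. f i \<le> 1) sequentially"
    proof (intro always_eventually allI)
      fix i
      have "xk \<mu> 0 (i + k) \<le> 1" using dec[of i] by simp
      then show "f i \<le> 1" unfolding f_def by (intro gap_le) simp
    qed
    show "(\<lambda>i. gap 1 (- int (i - 1))) \<longlonglongrightarrow> 1"
      by (rule LIMSEQ_imp_Suc) (use gap_tendsto[of 1] in simp)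
  qed
  from telescope_sums[OF this] have "(\<lambda>i. f (Suc i) - f i) sums (1 - f 0)" .
  moreover have "f (Suc i) - f i = ginf \<mu> (i + k + 1)" for i
    using weight_eq_gap_diff[of "i + k"] idx[of "Suc (i + k)"] k n by (simp add: f_def ginf_def)
  ultimately have "(\<Sum>i. ginf \<mu> (i + k + 1)) = 1 - f 0" by (simp add: sums_iff)
  then show ?thesis unfolding surv_def using inf k n by (simp add: finf_def f_def reach_prob_def)
qed

lemma surv_formula:
  assumes "(n, Suc k) \<in> AYidx \<mu>" "1 \<le> k"
  shows "surv k = 1 - gap (real n + 1) (xk \<mu> n k) / reach_prob n"
  using surv_formula_fin[of k] surv_formula_inf[of k] assms finite_Xset_iff by (auto simp: AYidx_iff)

text \<open>Just above level \<open>k + 1\<close>, \<open>gap n\<close> is negative, so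
  \<open>gap (n + 1)\<close>, which exceeds it by \<open>tail\<close>, stays strictly below
  \<open>tail\<close> and hence below \<open>reach_prob n\<close>. Positivity keeps the quotients in
  \<open>rho\<close> away from division by 0.\<close>

lemma surv_pos:
  assumes "(n, Suc k) \<in> AYidx \<mu>" shows "0 < surv k"
proof (cases "k = 0")
  case False
  define x where "x = xk \<mu> n (Suc k) + 1"
  have "gap (real n) x < 0" "gap (real n + 1) x = gap (real n + 1) (xk \<mu> n k)"
    using gap_consecutive[OF assms] False by (auto simp: x_def)
  then have "gap (real n + 1) (xk \<mu> n k) < reach_prob n"
    using gap_level_diff[of "real n + 1" x "real n"] tail_le_reach_prob[of n x] by simp
  then show ?thesis using surv_formula[OF assms] False reach_prob_pos[OF pos] by simp
qed (simp add: surv_0)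

lemma rho_surv:
  assumes "(n, Suc k) \<in> AYidx \<mu>"
  shows "surv k * (1 - rho \<mu> n (Suc k)) = surv (Suc k)"
proof (cases "fin_case \<mu> n \<and> Suc k = card (Xset \<mu> n)")
  case True
  then show ?thesis using surv_last by (simp add: rho_def rhofin_def)
next
  case False
  then have "1 - rho \<mu> n (Suc k) = surv (Suc k) / surv k"
    by (auto simp: rho_def rhofin_def rhoinf_def surv_def)
  then show ?thesis using surv_pos[OF assms] by simp
qed

text \<open>The product telescopes; for independent coins it is the probability that the first
  \<open>K\<close> of them all show 1.\<close>

lemma prod_rho:
  assumes "\<And>k. 1 \<le> k \<Longrightarrow> k \<le> K \<Longrightarrow> (n, k) \<in> AYidx \<mu>"
  shows "(\<Prod>k\<in>{1..K}. 1 - rho \<mu> n k) = surv K"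
  using assms
proof (induction K)
  case (Suc K)
  then have "(\<Prod>k\<in>{1..K}. 1 - rho \<mu> n k) = surv K" by simp
  then show ?case using rho_surv[of K] Suc.prems[of "Suc K"] by (simp add: prod.atLeast_Suc_atMost Suc)
qed (simp add: surv_0)

text \<open>Between levels both \<open>ncount\<close> and \<open>gap (n + 1)\<close> are constant,
  so the formula at the levels extends to every \<open>x \<le> n\<close>. In the two boundary
  regimes, at or below the lowest level all levels count and the value is 0; above the highest none
  counts and \<open>gap (n + 1)\<close> is no longer positive.\<close>

lemma surv_ncount:
  assumes x: "x \<le> int n" shows "surv (ncount x) = drawdown_cdf n x"
proof (cases "gap (real n) x < 0")
  case False
  have "fin_case \<mu> n"
  proof (cases "n = 0")
    case True
    have "x \<noteq> 0" using False True gap_neg[of 0 0] pos by auto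
    then have "tail x = 1" using gap_zero_iff[of x] False True x by simp
    then show ?thesis using xlow_iff by (auto simp: fin_case_def)
  qed (simp add: fin_case_def)
  moreover from this obtain b where b: "b < int n" "gap (real n) (b + 1) < 0"
    "\<And>y. y \<in> Xset \<mu> n \<Longrightarrow> b \<le> y" using fin_case_crossing by metis
  have "x \<le> b"
  proof (rule ccontr)
    assume "\<not> x \<le> b"
    then have "gap (real n) x \<le> gap (real n) (b + 1)" using x by (intro gap_antimono) auto
    then show False using b False by simp
  qed
  then have "{y\<in>Xset \<mu> n. x \<le> y} = Xset \<mu> n" using b(3) by force
  ultimately show ?thesis using False x surv_last by (simp add: ncount_def drawdown_cdf_def)
next
  case True
  show ?thesis
  proof (cases "ncount x = 0")
    case z: True
    then have none: "\<And>y. y \<in> Xset \<mu> n \<Longrightarrow> \<not> x \<le> y" using finite_Xset_ge[of x] by (auto simp: ncount_def)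
    \<comment> \<open>A positive gap would have a last index \<open>j\<close> at which it drops;
      then \<open>j\<close> carries mass and would be a level at or above \<open>x\<close>.\<close>
    have "\<not> 0 < gap (real n + 1) x"
    proof
      assume gx: "0 < gap (real n + 1) x"
      define A where "A = {j\<in>{x..int n}. 0 < gap (real n + 1) j}"
      have A: "finite A" "x \<in> A" using gx x by (auto simp: A_def intro: finite_subset[of _ "{x..int n}"])
      define j where "j = Max A"
      have j: "j \<in> A" unfolding j_def using A by (intro Max_in) auto
      have j1: "gap (real n + 1) (j + 1) \<le> 0"
      proof (rule ccontr)
        assume c: "\<not> gap (real n + 1) (j + 1) \<le> 0"
        then have "j + 1 \<le> int n" using gap_nonpos[of "real n + 1" "j + 1"] j by (force simp: A_def)
        then have "j + 1 \<in> A" using c j by (auto simp: A_def)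
        then show False using Max_ge[OF A(1), of "j + 1"] by (simp add: j_def)
      qed
      have "0 < (real n + 1 - real_of_int j) * pmf \<mu> j"
        using gap_diff[of "real n + 1" j] j j1 by (simp add: A_def)
      then have "0 < pmf \<mu> j" using pmf_nonneg[of \<mu> j] by (metis less_eq_real_def mult_zero_right)
      moreover have "gap (real n) (j + 1) \<le> gap (real n) x"
        using j by (intro gap_antimono) (auto simp: A_def)
      ultimately have "j \<in> Xset \<mu> n" using j True by (auto simp: A_def Xset_iff[OF pos])
      then show False using none j by (auto simp: A_def)
    qed
    then show ?thesis using z True x by (simp add: surv_0 drawdown_cdf_def)
  next
    case nz: False
    define k where "k = ncount x"
    have k: "(n, k) \<in> AYidx \<mu>" using ncount_AYidx[of k x] nz by (simp add: k_def)
    have zx: "x \<le> xk \<mu> n k" using xk_ge_iff[OF k] by (simp add: k_def)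
    have low: "xk \<mu> n k \<le> y" if "y \<in> Xset \<mu> n" "x \<le> y" for y
    proof -
      have "ncount y \<le> k" using that(2) by (simp add: k_def ncount_antimono)
      then show ?thesis using xk_ge_iff[of "ncount y" "xk \<mu> n k"] xk_ncount[OF that(1)]
          ncount_AYidx[of "ncount y" y] xk_in(2)[OF k] ncount_eq_Suc[OF that(1)] by simp
    qed
    have eq: "gap (real n + 1) x = gap (real n + 1) (xk \<mu> n k)"
      by (rule gap_constant_between[OF xk_in(1)[OF k] zx low True])
    have "0 \<le> gap (real n + 1) (xk \<mu> n k)" using xk_in(1)[OF k] by (simp add: Xset_iff[OF pos])
    \<comment> \<open>If \<open>k\<close> were the last index, every level would lie at or above
      \<open>x\<close>, including the sign change \<open>b\<close> of \<open>gap n\<close>, against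
      \<open>gap n x < 0\<close>.\<close>
    moreover have "(n, Suc k) \<in> AYidx \<mu>"
    proof (rule ccontr)
      assume "(n, Suc k) \<notin> AYidx \<mu>"
      then have fin: "finite (Xset \<mu> n)" and ck: "k = card (Xset \<mu> n)" using k by (auto simp: AYidx_iff)
      then obtain b where b: "b \<in> Xset \<mu> n" "b < int n" "0 \<le> gap (real n) b"
        using fin_case_crossing finite_Xset_iff by metis
      have "{y\<in>Xset \<mu> n. x \<le> y} = Xset \<mu> n"
        by (rule card_subset_eq[OF fin]) (use ck in \<open>auto simp: k_def ncount_def\<close>)
      then have "x \<le> b" using b by auto
      then have "gap (real n) b \<le> gap (real n) x" using b by (intro gap_antimono) auto
      then show False using b True by simp
    qed
    ultimately show ?thesis using surv_formula[of k] nz True x eq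
      by (simp add: drawdown_cdf_def k_def[symmetric])
  qed
qed

lemma prod_rho_ncount:
  "x \<le> int n \<Longrightarrow> (\<Prod>k\<in>{1..ncount x}. 1 - rho \<mu> n k) = drawdown_cdf n x"
  using prod_rho[of "ncount x"] ncount_AYidx surv_ncount by auto

end

text \<open>For n \<ge> 1 the values are eventually exactly 0. At level 0 they may stay positive,
  and the limit 1 of \<open>gap 1\<close> is needed.\<close>

lemma drawdown_cdf_tendsto:
  assumes "0 < tail (int n + 1)" shows "(\<lambda>i. drawdown_cdf n (- int i)) \<longlonglongrightarrow> 0"
proof (cases "n = 0")
  case True
  have "\<bar>drawdown_cdf n (- int i)\<bar> \<le> \<bar>1 - gap 1 (- int i)\<bar>" for i
    using True by (auto simp: drawdown_cdf_def reach_prob_def max_def)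
  moreover have "(\<lambda>i. \<bar>1 - gap 1 (- int i)\<bar>) \<longlonglongrightarrow> \<bar>1 - 1\<bar>" by (intro tendsto_intros gap_tendsto)
  ultimately show ?thesis using Lim_null_comparison[of "\<lambda>i. drawdown_cdf n (- int i)" "\<lambda>i. \<bar>1 - gap 1 (- int i)\<bar>"]
    by simp
next
  case False
  then have "eventually (\<lambda>i. 0 < gap (real n) (- int i)) sequentially"
    by (intro order_tendstoD(1)[OF gap_tendsto]) simp
  then have "eventually (\<lambda>i. drawdown_cdf n (- int i) = 0) sequentially"
    by eventually_elim (simp add: drawdown_cdf_def)
  then show ?thesis by (rule tendsto_eventually)
qed

end

section \<open>Simple random walks\<close>

definition clk :: "enat \<Rightarrow> nat \<Rightarrow> nat" where
  "clk e t = (case e of enat n \<Rightarrow> min t n | \<infinity> \<Rightarrow> t)"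

lemma clk_0 [simp]: "clk e 0 = 0" by (simp add: clk_def split: enat.split)

lemma clk_before: "enat t \<le> e \<Longrightarrow> clk e t = t" by (auto simp: clk_def split: enat.split)

lemma clk_Suc: "clk e (Suc t) = (if enat t < e then Suc t else clk e t)"
  by (auto simp: clk_def split: enat.split)

lemma clk_le: "clk e t \<le> t" by (auto simp: clk_def split: enat.split)

lemma clk_enat: "m \<le> t \<Longrightarrow> clk (enat m) t = m" by (simp add: clk_def)

lemma clk_infinity [simp]: "clk \<infinity> t = t" by (simp add: clk_def)

lemma clk_mono: "s \<le> t \<Longrightarrow> clk e s \<le> clk e t" by (auto simp: clk_def split: enat.split)

lemma clk_min: "clk (min e f) t = min (clk e t) (clk f t)" 
  by (cases e; cases f) (auto simp: clk_def min_def)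

lemma stopped_clk: "stopped S \<tau> t \<omega> = S (clk (\<tau> \<omega>) t) \<omega>"
  by (simp add: stopped_def clk_def split: enat.split)

lemma Smax_0 [simp]: "Smax S 0 \<omega> = S 0 \<omega>" by (simp add: Smax_def)

lemma Smax_Suc: "Smax S (Suc t) \<omega> = max (Smax S t \<omega>) (S (Suc t) \<omega>)"
proof -
  have "(\<lambda>u. S u \<omega>) ` {..Suc t} = insert (S (Suc t) \<omega>) ((\<lambda>u. S u \<omega>) ` {..t})"
    by (auto simp: atMost_Suc)
  then show ?thesis by (simp add: Smax_def max.commute)
qed

lemma Smax_ge: "u \<le> t \<Longrightarrow> S u \<omega> \<le> Smax S t \<omega>"
  unfolding Smax_def by (rule Max_ge) auto

lemma Smax_mono: "u \<le> t \<Longrightarrow> Smax S u \<omega> \<le> Smax S t \<omega>"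
  unfolding Smax_def by (rule Max_mono) auto

lemma Smax_attained: obtains u where "u \<le> t" "Smax S t \<omega> = S u \<omega>"
proof -
  have "Smax S t \<omega> \<in> (\<lambda>u. S u \<omega>) ` {..t}" unfolding Smax_def by (rule Max_in) auto
  then show ?thesis using that by auto
qed

lemma first_time_le_iff: "first_time P \<le> enat t \<longleftrightarrow> (\<exists>u\<le>t. P u)"
proof
  assume "first_time P \<le> enat t"
  then have "\<exists>u. P u" "(LEAST u. P u) \<le> t" by (auto simp: first_time_def split: if_splits)
  then show "\<exists>u\<le>t. P u" using LeastI_ex by blast
next
  assume "\<exists>u\<le>t. P u"
  then show "first_time P \<le> enat t"
    by (auto simp: first_time_def intro: Least_le order_trans)
qed

lemma less_first_time_iff: "enat t < first_time P \<longleftrightarrow> (\<forall>u\<le>t. \<not> P u)"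
  using first_time_le_iff[of P t] by (auto simp: not_less[symmetric])

lemma first_time_enat: "first_time P = enat t \<Longrightarrow> P t \<and> (\<forall>u<t. \<not> P u)"
  by (auto simp: first_time_def split: if_splits intro: LeastI dest: not_less_Least)

lemma measurable_count_space_op2:
  fixes X :: "'a \<Rightarrow> 'b::countable" and Y :: "'a \<Rightarrow> 'c::countable"
  assumes "X \<in> measurable N (count_space UNIV)" "Y \<in> measurable N (count_space UNIV)"
  shows "(\<lambda>\<omega>. g (X \<omega>) (Y \<omega>)) \<in> measurable N (count_space UNIV)"
  by (rule measurable_compose_countable[where f="\<lambda>x \<omega>. g x (Y \<omega>)" and g=X, OF _ assms(1)])
    (rule measurable_compose[OF assms(2)], simp)

locale ssrw = prob_space M for M :: "'a measure" +
  fixes F :: "nat \<Rightarrow> 'a measure" and S :: "nat \<Rightarrow> 'a \<Rightarrow> int"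
  assumes ssrw: "ssrw_wrt M F S"
begin

lemma space_F [simp]: "space (F t) = space M"
  using ssrw by (auto simp: ssrw_wrt_def is_filtration_def subalgebra_def)

lemma F_subalgebra: "subalgebra M (F t)"
  using ssrw by (auto simp: ssrw_wrt_def is_filtration_def)

lemma F_mono: "s \<le> t \<Longrightarrow> subalgebra (F t) (F s)"
  using ssrw by (auto simp: ssrw_wrt_def is_filtration_def subalgebra_def)

lemma measurable_F_mono: "f \<in> measurable (F s) N \<Longrightarrow> s \<le> t \<Longrightarrow> f \<in> measurable (F t) N"
  using measurable_from_subalg[OF F_mono] by blast

lemma measurable_F_imp_M: "f \<in> measurable (F s) N \<Longrightarrow> f \<in> measurable M N"
  using measurable_from_subalg[OF F_subalgebra] by blast

lemma S_0: "\<omega> \<in> space M \<Longrightarrow> S 0 \<omega> = 0"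
  using ssrw by (simp add: ssrw_wrt_def)

lemma S_adapted: "u \<le> t \<Longrightarrow> S u \<in> measurable (F t) (count_space UNIV)"
proof -
  assume "u \<le> t"
  moreover have "S u \<in> measurable (F u) (count_space UNIV)" using ssrw by (simp only: ssrw_wrt_def)
  ultimately show ?thesis by (rule measurable_F_mono[rotated])
qed

lemma S_measurable [measurable]: "S t \<in> measurable M (count_space UNIV)"
  using measurable_F_imp_M[OF S_adapted[OF order_refl]] .

lemma Smax_adapted: "u \<le> t \<Longrightarrow> Smax S u \<in> measurable (F t) (count_space UNIV)"
proof (induction u)
  case 0
  then show ?case using S_adapted[of 0 t] by (simp add: Smax_def[abs_def])
next
  case (Suc u)
  then show ?case using measurable_count_space_op2[of "Smax S u" "F t" "S (Suc u)" max] S_adapted[of "Suc u" t]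
    by (simp add: Smax_Suc[abs_def])
qed

lemma Smax_measurable [measurable]: "Smax S t \<in> measurable M (count_space UNIV)"
  using measurable_F_imp_M[OF Smax_adapted[OF order_refl]] .

section \<open>One-step expectations and exit from bounded intervals\<close>

definition up :: "nat \<Rightarrow> 'a set" where
  "up t = {\<omega>\<in>space M. S (Suc t) \<omega> - S t \<omega> = 1}"

lemma step_measurable [measurable]:
  "(\<lambda>\<omega>. S (Suc t) \<omega> - S t \<omega>) \<in> measurable M (count_space UNIV)"
  using measurable_count_space_op2[OF S_measurable[of "Suc t"] S_measurable[of t], of "(-)"] by simp

lemma up_events [measurable]: "up t \<in> events" unfolding up_def by measurable

lemma up_indep: "A \<in> sets (F t) \<Longrightarrow> prob (A \<inter> up t) = prob A * (1/2)"
proof -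
  assume A: "A \<in> sets (F t)"
  have "\<forall>t. \<forall>A\<in>sets (F t). \<forall>B. measure M (A \<inter> {\<omega>\<in>space M. S (Suc t) \<omega> - S t \<omega> \<in> B})
      = measure M A * measure M {\<omega>\<in>space M. S (Suc t) \<omega> - S t \<omega> \<in> B}"
    and "measure M {\<omega>\<in>space M. S (Suc t) \<omega> - S t \<omega> = 1} = 1/2"
    using ssrw by (auto simp only: ssrw_wrt_def)
  from this(1)[rule_format, OF A, of "{1}"] this(2) show ?thesis by (simp add: up_def)
qed

lemma AE_step: "AE \<omega> in M. \<forall>t. S (Suc t) \<omega> = S t \<omega> + 1 \<or> S (Suc t) \<omega> = S t \<omega> - 1"
proof (subst AE_all_countable, intro allI)
  fix t
  let ?D = "{\<omega>\<in>space M. S (Suc t) \<omega> - S t \<omega> = -1}"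
  have D: "?D \<in> events" by measurable
  have "prob (up t \<union> ?D) = prob (up t) + prob ?D"
    by (rule finite_measure_Union[OF up_events D]) (auto simp: up_def)
  also have "\<dots> = 1"
  proof -
    have "\<forall>t. measure M {\<omega>\<in>space M. S (Suc t) \<omega> - S t \<omega> = 1} = 1/2
        \<and> measure M {\<omega>\<in>space M. S (Suc t) \<omega> - S t \<omega> = -1} = 1/2"
      using ssrw unfolding ssrw_wrt_def by blast
    from spec[OF this, of t] show ?thesis by (simp add: up_def)
  qed
  finally have "AE \<omega> in M. \<omega> \<in> up t \<union> ?D" using D by (subst (asm) prob_eq_1) auto
  then show "AE \<omega> in M. S (Suc t) \<omega> = S t \<omega> + 1 \<or> S (Suc t) \<omega> = S t \<omega> - 1"
    by eventually_elim (auto simp: up_def)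
qed

lemma AE_S_bound: "AE \<omega> in M. \<forall>t. \<bar>S t \<omega>\<bar> \<le> int t"
  using AE_step AE_space
proof eventually_elim
  case (elim \<omega>)
  have "\<bar>S t \<omega>\<bar> \<le> int t" for t
  proof (induction t)
    case (Suc t)
    then show ?case using elim(1)[rule_format, of t] by auto
  qed (use elim S_0 in simp)
  then show ?case by blast
qed

text \<open>Independence of one event is lifted to expectations through the \<sigma>-algebra of its
  indicator, which has at most four members.\<close>

lemma indep_half:
  fixes f :: "'a \<Rightarrow> real"
  assumes f: "f \<in> borel_measurable (F t)" and i: "integrable M f"
  shows "(\<integral>\<omega>. f \<omega> * indicator (up t) \<omega> \<partial>M) = (\<integral>\<omega>. f \<omega> \<partial>M) / 2"
proof -
  have fM: "f \<in> borel_measurable M" by (rule measurable_F_imp_M[OF f])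
  have "indep_var borel f borel (indicator (up t) :: 'a \<Rightarrow> real)"
    unfolding indep_var_eq
  proof (intro conjI)
    let ?A = "sigma_sets (space M) {f -` A \<inter> space M |A. A \<in> sets borel}"
    let ?B = "sigma_sets (space M) {indicator (up t) -` A \<inter> space M |A. A \<in> sets (borel :: real measure)}"
    have A: "?A \<subseteq> sets (F t)"
    proof -
      have "{f -` A \<inter> space M |A. A \<in> sets borel} \<subseteq> sets (F t)"
        using measurable_sets[OF f] by auto
      then show ?thesis using sets.sigma_sets_subset[of _ "F t"] by simp
    qed
    have "{indicator (up t) -` A \<inter> space M |A. A \<in> sets (borel :: real measure)}
        \<subseteq> sigma_sets (space M) {up t}"
    proof clarsimp
      fix A :: "real set"
      have "indicator (up t) \<omega> \<in> A \<longleftrightarrow> (if \<omega> \<in> up t then 1 \<in> A else 0 \<in> A)" for \<omega> by auto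
      then have "indicator (up t) -` A \<inter> space M = (if 0 \<in> A then if 1 \<in> A then space M else space M - up t
          else if 1 \<in> A then up t else {})"
        by (auto simp: up_def split: if_splits)
      then show "indicator (up t) -` A \<inter> space M \<in> sigma_sets (space M) {up t}"
        using sigma_sets_top[of "space M" "{up t}"] by (auto intro: sigma_sets.intros)
    qed
    then have B: "?B \<subseteq> sigma_sets (space M) {up t}" by (rule sigma_sets_mono)
    have "indep_set (sets (F t)) {up t}"
    proof -
      have "prob (up t) = 1 / 2"
        using up_indep[of "space M" t] sets.top[of "F t"] by (simp add: prob_space sets.Int_space_eq1)
      then have "\<forall>a\<in>sets (F t). prob (a \<inter> up t) = prob a * prob (up t)"
        using up_indep[of _ t] by (simp only:) blast
      then show ?thesis unfolding indep_sets2_eq using F_subalgebra by (auto simp: subalgebra_def)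
    qed
    then have "indep_set (sigma_sets (space M) (sets (F t))) (sigma_sets (space M) {up t})"
      by (rule indep_set_sigma_sets) (auto simp: Int_stable_def)
    then show "indep_set ?A ?B"
      using A B sigma_sets_superset_generator[of "sets (F t)" "space M"] unfolding indep_sets2_eq by blast
  qed (use fM in auto)
  moreover have "integrable M (indicator (up t) :: 'a \<Rightarrow> real)"
    by (rule integrable_const_bound[where B=1]) auto
  ultimately have "(\<integral>\<omega>. f \<omega> * indicator (up t) \<omega> \<partial>M) = (\<integral>\<omega>. f \<omega> \<partial>M) * prob (up t)"
    using indep_var_lebesgue_integral[OF _ i] by simp
  moreover have "prob (up t) = 1 / 2"
    using up_indep[of "space M" t] sets.top[of "F t"] by (simp add: prob_space sets.Int_space_eq1)
  ultimately show ?thesis by simp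
qed

lemma integral_step:
  fixes f g :: "'a \<Rightarrow> real"
  assumes f: "f \<in> borel_measurable (F t)" "integrable M f"
    and g: "g \<in> borel_measurable (F t)" "integrable M g"
  shows "(\<integral>\<omega>. (if \<omega> \<in> up t then f \<omega> else g \<omega>) \<partial>M) = ((\<integral>\<omega>. f \<omega> \<partial>M) + (\<integral>\<omega>. g \<omega> \<partial>M)) / 2"
proof -
  have i: "integrable M (\<lambda>\<omega>. f \<omega> * indicator (up t) \<omega>)" "integrable M (\<lambda>\<omega>. g \<omega> * indicator (up t) \<omega>)"
    using f g by (auto intro!: integrable_mult_indicator integrable_real_mult_indicator)
  have "(\<integral>\<omega>. (if \<omega> \<in> up t then f \<omega> else g \<omega>) \<partial>M)
      = (\<integral>\<omega>. f \<omega> * indicator (up t) \<omega> + (g \<omega> - g \<omega> * indicator (up t) \<omega>) \<partial>M)"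
    by (rule Bochner_Integration.integral_cong) (auto simp: indicator_def)
  also have "\<dots> = (\<integral>\<omega>. f \<omega> * indicator (up t) \<omega> \<partial>M)
      + ((\<integral>\<omega>. g \<omega> \<partial>M) - (\<integral>\<omega>. g \<omega> * indicator (up t) \<omega> \<partial>M))"
    using i g(2) by simp
  finally show ?thesis by (simp add: indep_half[OF f] indep_half[OF g])
qed

lemma measurable_fun_S:
  fixes \<phi> :: "int \<Rightarrow> real" shows "u \<le> t \<Longrightarrow> (\<lambda>\<omega>. \<phi> (S u \<omega>)) \<in> borel_measurable (F t)"
  by (rule measurable_compose[OF S_adapted]) auto

text \<open>Almost surely the argument lies in a finite set, on which every function is bounded; so
  arbitrary functions of the walk are integrable at fixed times.\<close>

lemma integrable_bounded_int_fun:
  fixes \<phi> :: "int \<Rightarrow> real"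
  assumes W: "W \<in> borel_measurable M" "\<And>\<omega>. \<omega> \<in> space M \<Longrightarrow> \<bar>W \<omega>\<bar> \<le> C"
    and X: "X \<in> measurable M (count_space UNIV)" "AE \<omega> in M. \<bar>X \<omega>\<bar> \<le> int t"
  shows "integrable M (\<lambda>\<omega>. W \<omega> * \<phi> (X \<omega>))"
proof (rule integrable_const_bound[where B="\<bar>C\<bar> * Max ((\<lambda>x. \<bar>\<phi> x\<bar>) ` {-int t..int t})"])
  show "AE \<omega> in M. norm (W \<omega> * \<phi> (X \<omega>)) \<le> \<bar>C\<bar> * Max ((\<lambda>x. \<bar>\<phi> x\<bar>) ` {-int t..int t})"
    using X(2) AE_space
  proof eventually_elim
    case (elim \<omega>)
    have "\<bar>W \<omega>\<bar> \<le> \<bar>C\<bar>" using W(2)[OF elim(2)] by linarith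
    moreover have "\<bar>\<phi> (X \<omega>)\<bar> \<le> Max ((\<lambda>x. \<bar>\<phi> x\<bar>) ` {-int t..int t})"
      using elim by (intro Max_ge imageI) auto
    ultimately show ?case by (simp add: abs_mult mult_mono)
  qed
  have "(\<lambda>\<omega>. \<phi> (X \<omega>)) \<in> borel_measurable M" by (rule measurable_compose[OF X(1)]) simp
  then show "(\<lambda>\<omega>. W \<omega> * \<phi> (X \<omega>)) \<in> borel_measurable M" using W(1) by simp
qed

text \<open>The weight \<open>W\<close>, bounded and known at time \<open>t\<close>, takes the place
  of a conditional expectation.\<close>

lemma integral_step_S:
  fixes \<phi> :: "int \<Rightarrow> real"
  assumes W: "W \<in> borel_measurable (F t)" "\<And>\<omega>. \<omega> \<in> space M \<Longrightarrow> \<bar>W \<omega>\<bar> \<le> C"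
  shows "(\<integral>\<omega>. W \<omega> * \<phi> (S (Suc t) \<omega>) \<partial>M)
    = (\<integral>\<omega>. W \<omega> * ((\<phi> (S t \<omega> + 1) + \<phi> (S t \<omega> - 1)) / 2) \<partial>M)"
proof -
  note WM = measurable_F_imp_M[OF W(1)]
  have i: "integrable M (\<lambda>\<omega>. W \<omega> * \<psi> (S t \<omega>))" for \<psi> :: "int \<Rightarrow> real"
    by (rule integrable_bounded_int_fun[OF WM W(2) S_measurable, of t]) (use AE_S_bound in auto)
  have m: "(\<lambda>\<omega>. W \<omega> * \<psi> (S t \<omega>)) \<in> borel_measurable (F t)" for \<psi> :: "int \<Rightarrow> real"
    using W(1) measurable_fun_S[of t t \<psi>] by simp
  have "(\<integral>\<omega>. W \<omega> * \<phi> (S (Suc t) \<omega>) \<partial>M)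
    = (\<integral>\<omega>. (if \<omega> \<in> up t then W \<omega> * \<phi> (S t \<omega> + 1) else W \<omega> * \<phi> (S t \<omega> - 1)) \<partial>M)"
  proof (rule integral_cong_AE)
    show "AE \<omega> in M. W \<omega> * \<phi> (S (Suc t) \<omega>)
        = (if \<omega> \<in> up t then W \<omega> * \<phi> (S t \<omega> + 1) else W \<omega> * \<phi> (S t \<omega> - 1))"
      using AE_step AE_space
    proof eventually_elim
      case (elim \<omega>)
      then show ?case by (cases "S (Suc t) \<omega> = S t \<omega> + 1") (auto simp: up_def dest: spec[of _ t])
    qed
    have "(\<lambda>\<omega>. \<phi> (S (Suc t) \<omega>)) \<in> borel_measurable M" by (rule measurable_compose[OF S_measurable]) simp
    then show "(\<lambda>\<omega>. W \<omega> * \<phi> (S (Suc t) \<omega>)) \<in> borel_measurable M" using WM by simp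
    show "(\<lambda>\<omega>. if \<omega> \<in> up t then W \<omega> * \<phi> (S t \<omega> + 1) else W \<omega> * \<phi> (S t \<omega> - 1)) \<in> borel_measurable M"
      using measurable_F_imp_M[OF m[of "\<lambda>s. \<phi> (s + 1)"]] measurable_F_imp_M[OF m[of "\<lambda>s. \<phi> (s - 1)"]]
      by (intro measurable_If_set) auto
  qed
  also have "\<dots> = ((\<integral>\<omega>. W \<omega> * \<phi> (S t \<omega> + 1) \<partial>M) + (\<integral>\<omega>. W \<omega> * \<phi> (S t \<omega> - 1) \<partial>M)) / 2"
    by (rule integral_step[OF m[of "\<lambda>s. \<phi> (s + 1)"] i[of "\<lambda>s. \<phi> (s + 1)"]
        m[of "\<lambda>s. \<phi> (s - 1)"] i[of "\<lambda>s. \<phi> (s - 1)"]])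
  also have "\<dots> = (\<integral>\<omega>. W \<omega> * \<phi> (S t \<omega> + 1) + W \<omega> * \<phi> (S t \<omega> - 1) \<partial>M) / 2"
    using i[of "\<lambda>s. \<phi> (s + 1)"] i[of "\<lambda>s. \<phi> (s - 1)"] by simp
  also have "\<dots> = (\<integral>\<omega>. (W \<omega> * \<phi> (S t \<omega> + 1) + W \<omega> * \<phi> (S t \<omega> - 1)) / 2 \<partial>M)"
    by simp
  finally show ?thesis by (simp add: distrib_left)
qed

lemma integral_increment:
  assumes W: "W \<in> borel_measurable (F t)" "\<And>\<omega>. \<omega> \<in> space M \<Longrightarrow> \<bar>W \<omega>\<bar> \<le> C"
  shows "integrable M (\<lambda>\<omega>. W \<omega> * real_of_int (S (Suc t) \<omega> - S t \<omega>))"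
    and "(\<integral>\<omega>. W \<omega> * real_of_int (S (Suc t) \<omega> - S t \<omega>) \<partial>M) = 0"
proof -
  note WM = measurable_F_imp_M[OF W(1)]
  have i: "integrable M (\<lambda>\<omega>. W \<omega> * real_of_int (S u \<omega>))" for u
    by (rule integrable_bounded_int_fun[OF WM W(2) S_measurable, of u]) (use AE_S_bound in auto)
  have eq: "W \<omega> * real_of_int (S (Suc t) \<omega> - S t \<omega>)
      = W \<omega> * real_of_int (S (Suc t) \<omega>) - W \<omega> * real_of_int (S t \<omega>)" for \<omega>
    by (simp add: right_diff_distrib)
  show "integrable M (\<lambda>\<omega>. W \<omega> * real_of_int (S (Suc t) \<omega> - S t \<omega>))"
    unfolding eq using i by simp
  have "(\<integral>\<omega>. W \<omega> * real_of_int (S (Suc t) \<omega>) \<partial>M) = (\<integral>\<omega>. W \<omega> * real_of_int (S t \<omega>) \<partial>M)"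
    by (subst integral_step_S[OF W]) (simp_all add: field_simps)
  then show "(\<integral>\<omega>. W \<omega> * real_of_int (S (Suc t) \<omega> - S t \<omega>) \<partial>M) = 0"
    unfolding eq using i by simp
qed

text \<open>The expectation of \<open>(K + 1)\<^sup>2 - S\<^sub>t\<^sup>2\<close> before leaving \<open>[-K, K]\<close> drops by the survival probability.\<close>

lemma AE_exit: "AE \<omega> in M. \<forall>K::nat. \<exists>t. int K < \<bar>S t \<omega>\<bar>"
proof (subst AE_all_countable, intro allI)
  fix K :: nat
  define A where "A t = {\<omega>\<in>space M. \<forall>u\<in>{..t}. \<bar>S u \<omega>\<bar> \<le> int K}" for t
  have pred: "{\<omega>\<in>space M. \<bar>S u \<omega>\<bar> \<le> int K} \<in> sets (F t)" if "u \<le> t" for u t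
    using measurable_sets[OF S_adapted[OF that], of "{x. \<bar>x\<bar> \<le> int K}"] by (simp add: vimage_def Int_def conj_commute)
  have A_eq: "A t = (\<Inter>u\<in>{..t}. {\<omega>\<in>space M. \<bar>S u \<omega>\<bar> \<le> int K})" for t by (auto simp: A_def)
  have A: "A t \<in> sets (F t)" for t
    unfolding A_eq by (intro sets.finite_INT) (use pred in auto)
  have AM [measurable]: "A t \<in> events" for t using A F_subalgebra by (auto simp: subalgebra_def)
  define w where "w t = (\<integral>\<omega>. indicator (A t) \<omega> * ((real K + 1)\<^sup>2 - (real_of_int (S t \<omega>))\<^sup>2) \<partial>M)" for t
  have i: "integrable M (\<lambda>\<omega>. indicator (A t) \<omega> * \<psi> (S u \<omega>))" for t u and \<psi> :: "int \<Rightarrow> real"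
    by (rule integrable_bounded_int_fun[where C=1 and t=u]) (use AE_S_bound in \<open>auto simp: indicator_def\<close>)
  have dec: "w (Suc t) \<le> w t - prob (A t)" for t
  proof -
    \<comment> \<open>On leaving the interval the walk stands at distance \<open>K + 1\<close>,
      where the function is still nonnegative, so dropping the newest constraint cannot lower the
      expectation.\<close>
    have "w (Suc t) \<le> (\<integral>\<omega>. indicator (A t) \<omega> * ((real K + 1)\<^sup>2 - (real_of_int (S (Suc t) \<omega>))\<^sup>2) \<partial>M)"
      unfolding w_def
    proof (rule integral_mono_AE)
      show "AE \<omega> in M. indicator (A (Suc t)) \<omega> * ((real K + 1)\<^sup>2 - (real_of_int (S (Suc t) \<omega>))\<^sup>2)
          \<le> indicator (A t) \<omega> * ((real K + 1)\<^sup>2 - (real_of_int (S (Suc t) \<omega>))\<^sup>2)"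
        using AE_step
      proof eventually_elim
        case (elim \<omega>)
        show ?case
        proof (cases "\<omega> \<in> A t \<and> \<omega> \<notin> A (Suc t)")
          case True
          then have "\<bar>S t \<omega>\<bar> \<le> int K" by (auto simp: A_def)
          then have "\<bar>S (Suc t) \<omega>\<bar> \<le> int K + 1" using elim[rule_format, of t] by auto
          then have "\<bar>real_of_int (S (Suc t) \<omega>)\<bar> \<le> \<bar>real K + 1\<bar>" by linarith
          then have "(real_of_int (S (Suc t) \<omega>))\<^sup>2 \<le> (real K + 1)\<^sup>2" by (rule abs_le_square_iff[THEN iffD1])
          then show ?thesis using True by simp
        next
          case False
          moreover have "\<omega> \<in> A (Suc t) \<Longrightarrow> \<omega> \<in> A t" by (auto simp: A_def)
          ultimately show ?thesis by (auto simp: indicator_def)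
        qed
      qed
    qed (rule i)+
    also have "\<dots> = (\<integral>\<omega>. indicator (A t) \<omega> *
        ((((real K + 1)\<^sup>2 - (real_of_int (S t \<omega> + 1))\<^sup>2) + ((real K + 1)\<^sup>2 - (real_of_int (S t \<omega> - 1))\<^sup>2)) / 2) \<partial>M)"
      by (rule integral_step_S[where C=1]) (use A in \<open>auto simp: indicator_def\<close>)
    also have "\<dots> = (\<integral>\<omega>. indicator (A t) \<omega> * ((real K + 1)\<^sup>2 - (real_of_int (S t \<omega>))\<^sup>2) - indicator (A t) \<omega> \<partial>M)"
      by (rule Bochner_Integration.integral_cong) (auto simp: power2_eq_square algebra_simps field_simps)
    also have "\<dots> = w t - prob (A t)"
      unfolding w_def using i[of t "\<lambda>x. (real K + 1)\<^sup>2 - (real_of_int x)\<^sup>2" t] i[of t "\<lambda>_. 1" t]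
      by (subst Bochner_Integration.integral_diff) auto
    finally show ?thesis .
  qed
  have wnn: "0 \<le> w t" for t
    unfolding w_def
  proof (rule integral_nonneg_AE, rule AE_I2)
    fix \<omega>
    show "0 \<le> indicator (A t) \<omega> * ((real K + 1)\<^sup>2 - (real_of_int (S t \<omega>))\<^sup>2)"
    proof (cases "\<omega> \<in> A t")
      case True
      then have "\<bar>S t \<omega>\<bar> \<le> int K" by (auto simp: A_def)
      then have "\<bar>real_of_int (S t \<omega>)\<bar> \<le> \<bar>real K + 1\<bar>" by linarith
      then have "(real_of_int (S t \<omega>))\<^sup>2 \<le> (real K + 1)\<^sup>2" by (rule abs_le_square_iff[THEN iffD1])
      then show ?thesis using True by simp
    qed simp
  qed
  define N where "N = (\<Inter>t. A t)"
  have N: "N \<in> events" unfolding N_def by auto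
  have "real t * prob N \<le> w 0 - w t" for t
  proof (induction t)
    case (Suc t)
    have "prob N \<le> prob (A t)" by (rule finite_measure_mono) (auto simp: N_def)
    then show ?case using Suc dec[of t] by (simp add: algebra_simps)
  qed simp
  then have le: "real t * prob N \<le> w 0" for t using wnn[of t] by (meson diff_le_eq order_trans le_add_same_cancel1)
  have "prob N = 0"
  proof (rule ccontr)
    assume "prob N \<noteq> 0"
    then have "0 < prob N" by (simp add: zero_less_measure_iff)
    then obtain t where "w 0 < real t * prob N" using reals_Archimedean3 by blast
    then show False using le[of t] by simp
  qed
  then have "AE \<omega> in M. \<omega> \<notin> N" using N by (subst (asm) prob_eq_0) auto
  then show "AE \<omega> in M. \<exists>t. int K < \<bar>S t \<omega>\<bar>"
    using AE_space by eventually_elim (auto simp: N_def A_def not_le)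
qed

end

section \<open>Stopping times and the maximal inequality\<close>

lemma measurable_enatI:
  fixes \<sigma> :: "'a \<Rightarrow> enat"
  assumes le: "\<And>t. {\<omega>\<in>space M. \<sigma> \<omega> \<le> enat t} \<in> sets M"
  shows "\<sigma> \<in> measurable M (count_space UNIV)"
proof (rule measurable_count_space_eq2_countable[THEN iffD2], safe)
  fix e :: enat
  show "\<sigma> -` {e} \<inter> space M \<in> sets M"
  proof (cases e)
    case (enat n)
    show ?thesis
    proof (cases n)
      case 0
      then have "\<sigma> -` {e} \<inter> space M = {\<omega>\<in>space M. \<sigma> \<omega> \<le> enat 0}" using enat by (auto simp: enat_0)
      then show ?thesis using le by simp
    next
      case (Suc m)
      have "\<sigma> \<omega> = enat (Suc m) \<longleftrightarrow> \<sigma> \<omega> \<le> enat (Suc m) \<and> \<not> \<sigma> \<omega> \<le> enat m" for \<omega>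
        by (cases "\<sigma> \<omega>") auto
      then have "\<sigma> -` {e} \<inter> space M = {\<omega>\<in>space M. \<sigma> \<omega> \<le> enat (Suc m)} - {\<omega>\<in>space M. \<sigma> \<omega> \<le> enat m}"
        using enat Suc by auto
      then show ?thesis using le by simp
    qed
  next
    case infinity
    have "\<sigma> \<omega> = \<infinity> \<longleftrightarrow> (\<forall>t. \<not> \<sigma> \<omega> \<le> enat t)" for \<omega> by (cases "\<sigma> \<omega>") auto
    then have "\<sigma> -` {e} \<inter> space M = space M - (\<Union>t. {\<omega>\<in>space M. \<sigma> \<omega> \<le> enat t})"
      using infinity by auto
    then show ?thesis using le by auto
  qed
qed auto

context ssrw
begin

text \<open>Collects almost sure path properties, so that the arguments about single paths become
  deterministic.\<close>

definition good :: "'a \<Rightarrow> bool" where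
  "good \<omega> \<longleftrightarrow> \<omega> \<in> space M \<and> S 0 \<omega> = 0 \<and> (\<forall>t. S (Suc t) \<omega> = S t \<omega> + 1 \<or> S (Suc t) \<omega> = S t \<omega> - 1)
     \<and> (\<forall>t. \<bar>S t \<omega>\<bar> \<le> int t) \<and> (\<forall>K::nat. \<exists>t. int K < \<bar>S t \<omega>\<bar>)"

lemma AE_good: "AE \<omega> in M. good \<omega>"
  using AE_space AE_step AE_S_bound AE_exit
  by eventually_elim (simp add: good_def S_0)

lemma good_step: "good \<omega> \<Longrightarrow> S (Suc t) \<omega> = S t \<omega> + 1 \<or> S (Suc t) \<omega> = S t \<omega> - 1"
  by (simp add: good_def)

lemma Smax_nonneg: "good \<omega> \<Longrightarrow> 0 \<le> Smax S t \<omega>"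
  using Smax_ge[of 0 t S \<omega>] by (simp add: good_def)

lemma less_stopping_sets:
  assumes "stopping_time_wrt M F \<sigma>" shows "{\<omega>\<in>space M. enat t < \<sigma> \<omega>} \<in> sets (F t)"
proof -
  have "{\<omega>\<in>space M. enat t < \<sigma> \<omega>} = space (F t) - {\<omega>\<in>space M. \<sigma> \<omega> \<le> enat t}" by auto
  then show ?thesis using assms by (metis sets.compl_sets stopping_time_wrt_def)
qed

lemma stopping_measurable:
  assumes "stopping_time_wrt M F \<sigma>" shows "\<sigma> \<in> measurable M (count_space UNIV)"
proof (rule measurable_enatI)
  fix t
  have "{\<omega>\<in>space M. \<sigma> \<omega> \<le> enat t} \<in> sets (F t)" using assms unfolding stopping_time_wrt_def by blast
  then show "{\<omega>\<in>space M. \<sigma> \<omega> \<le> enat t} \<in> events" using F_subalgebra[of t] by (auto simp: subalgebra_def)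
qed

lemma clk_measurable:
  assumes "\<sigma> \<in> measurable M (count_space UNIV)"
    and "\<And>u. X u \<in> measurable M (count_space (UNIV :: int set))"
  shows "(\<lambda>\<omega>. X (clk (\<sigma> \<omega>) t) \<omega>) \<in> measurable M (count_space UNIV)"
proof (rule measurable_compose_countable[where f=X and g="\<lambda>\<omega>. clk (\<sigma> \<omega>) t"])
  show "(\<lambda>\<omega>. clk (\<sigma> \<omega>) t) \<in> measurable M (count_space UNIV)"
    by (rule measurable_compose[OF assms(1)]) simp
qed (rule assms(2))

lemma terminal_measurable:
  assumes "\<sigma> \<in> measurable M (count_space UNIV)"
    and "\<And>u. X u \<in> measurable M (count_space (UNIV :: int set))"
  shows "(\<lambda>\<omega>. X (the_enat (\<sigma> \<omega>)) \<omega>) \<in> measurable M (count_space UNIV)"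
proof (rule measurable_compose_countable[where f=X and g="\<lambda>\<omega>. the_enat (\<sigma> \<omega>)"])
  show "(\<lambda>\<omega>. the_enat (\<sigma> \<omega>)) \<in> measurable M (count_space UNIV)"
    by (rule measurable_compose[OF assms(1)]) simp
qed (rule assms(2))

text \<open>A stake fixed before each step earns nothing on average. The factor \<open>W\<close>,
  known at time 0, later carries the barriers.\<close>

lemma integral_sum_increments:
  assumes W: "W \<in> borel_measurable (F 0)" "\<And>\<omega>. \<omega> \<in> space M \<Longrightarrow> \<bar>W \<omega>\<bar> \<le> C"
    and E: "\<And>s. E s \<in> sets (F s)"
  shows "(\<integral>\<omega>. W \<omega> * (\<Sum>s<t. indicator (E s) \<omega> * real_of_int (S (Suc s) \<omega> - S s \<omega>)) \<partial>M) = 0"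
proof -
  have m: "(\<lambda>\<omega>. W \<omega> * indicator (E s) \<omega>) \<in> borel_measurable (F s)" for s
    using measurable_F_mono[OF W(1), of s] E[of s] by simp
  have b: "\<bar>W \<omega> * indicator (E s) \<omega>\<bar> \<le> C" if "\<omega> \<in> space M" for \<omega> s
    using W(2)[OF that] by (auto simp: indicator_def)
  note i = integral_increment[OF m b]
  have "(\<integral>\<omega>. W \<omega> * (\<Sum>s<t. indicator (E s) \<omega> * real_of_int (S (Suc s) \<omega> - S s \<omega>)) \<partial>M)
      = (\<integral>\<omega>. (\<Sum>s<t. W \<omega> * indicator (E s) \<omega> * real_of_int (S (Suc s) \<omega> - S s \<omega>)) \<partial>M)"
    by (simp only: sum_distrib_left mult.assoc)
  also have "\<dots> = (\<Sum>s<t. \<integral>\<omega>. W \<omega> * indicator (E s) \<omega> * real_of_int (S (Suc s) \<omega> - S s \<omega>) \<partial>M)"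
    by (rule Bochner_Integration.integral_sum) (rule i(1))
  also have "\<dots> = 0" using i(2) by simp
  finally show ?thesis .
qed

lemma Smax_ge_sets: "{\<omega>\<in>space M. n \<le> Smax S t \<omega>} \<in> sets (F t)"
  using measurable_sets[OF Smax_adapted[of t t], of "{n..}"]
  by (simp add: vimage_def Int_def conj_commute)

lemma Smax_eq_sets: "{\<omega>\<in>space M. Smax S t \<omega> = n} \<in> sets (F t)"
  using measurable_sets[OF Smax_adapted[of t t], of "{n}"]
  by (simp add: vimage_def Int_def conj_commute)

text \<open>Unit steps from 0 reach \<open>n\<close> exactly, so the gains collected from then on
  add up to the current distance from \<open>n\<close>.\<close>

lemma increments_after_level:
  assumes "good \<omega>" "0 < n"
  shows "(\<Sum>s<t. indicator {\<omega>\<in>space M. enat s < \<sigma> \<omega> \<and> n \<le> Smax S s \<omega>} \<omega> * real_of_int (S (Suc s) \<omega> - S s \<omega>))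
    = (if n \<le> Smax S (clk (\<sigma> \<omega>) t) \<omega> then real_of_int (S (clk (\<sigma> \<omega>) t) \<omega> - n) else 0)"
proof (induction t)
  case 0
  then show ?case using assms by (simp add: good_def)
next
  case (Suc t)
  have sp: "\<omega> \<in> space M" using assms by (simp add: good_def)
  show ?case
  proof (cases "enat t < \<sigma> \<omega>")
    case True
    then have "clk (\<sigma> \<omega>) t = t" by (simp add: clk_before)
    then show ?thesis using Suc True sp good_step[OF assms(1), of t] Smax_ge[of t t S \<omega>]
      by (auto simp: clk_Suc Smax_Suc indicator_def max_def)
  next
    case False
    then show ?thesis using Suc by (simp add: clk_Suc)
  qed
qed

lemma stopped_tendsto:
  assumes "e \<noteq> \<infinity>"
  shows "(\<lambda>t. f (clk e t)) \<longlonglongrightarrow> f (the_enat e)"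
proof -
  obtain m where "e = enat m" using assms by (cases e) auto
  then have "eventually (\<lambda>t. f (clk e t) = f (the_enat e)) sequentially"
    by (auto simp: eventually_sequentially clk_enat intro!: exI[of _ m])
  then show ?thesis by (rule tendsto_eventually)
qed

text \<open>At a bounded time the gain made after reaching \<open>n\<close> has mean 0, so on the
  event \<open>n - k\<close> may be replaced by the stopped value minus \<open>k\<close>. No
  dominating variable is at hand for the limit; uniform integrability allows the payoff to be
  truncated at the cost of \<open>e\<close>.\<close>

lemma maximal_inequality:
  fixes n k :: int
  assumes st: "stopping_time_wrt M F \<sigma>" and fin: "AE \<omega> in M. \<sigma> \<omega> \<noteq> \<infinity>"
    and ui: "unif_integrable M (\<lambda>t \<omega>. real_of_int (stopped S \<sigma> t \<omega>))"
    and n: "0 < n" and kn: "k < n"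
    and int: "integrable M (\<lambda>\<omega>. max 0 (real_of_int (S (the_enat (\<sigma> \<omega>)) \<omega> - k)))"
  shows "real_of_int (n - k) * prob {\<omega>\<in>space M. \<sigma> \<omega> \<noteq> \<infinity> \<and> n \<le> Smax S (the_enat (\<sigma> \<omega>)) \<omega>}
    \<le> (\<integral>\<omega>. max 0 (real_of_int (S (the_enat (\<sigma> \<omega>)) \<omega> - k)) \<partial>M)"
proof -
  note sm = stopping_measurable[OF st]
  define Y where "Y t \<omega> = S (clk (\<sigma> \<omega>) t) \<omega>" for t \<omega>
  define A where "A t = {\<omega>\<in>space M. n \<le> Smax S (clk (\<sigma> \<omega>) t) \<omega>}" for t
  define A' where "A' = {\<omega>\<in>space M. \<sigma> \<omega> \<noteq> \<infinity> \<and> n \<le> Smax S (the_enat (\<sigma> \<omega>)) \<omega>}"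
  have Ym [measurable]: "Y t \<in> measurable M (count_space UNIV)" for t
    unfolding Y_def by (rule clk_measurable[OF sm S_measurable])
  have Yb: "AE \<omega> in M. \<bar>Y t \<omega>\<bar> \<le> int t" for t
    using AE_S_bound
  proof eventually_elim
    case (elim \<omega>)
    then show ?case using clk_le[of "\<sigma> \<omega>" t] by (auto simp: Y_def intro: order_trans[of _ "int (clk (\<sigma> \<omega>) t)"])
  qed
  have Am [measurable]: "A t \<in> events" for t
    using measurable_sets[OF clk_measurable[where t=t, OF sm Smax_measurable], of "{n..}"]
    by (simp add: A_def vimage_def Int_def conj_commute)
  have step1: "real_of_int (n - k) * prob (A t) \<le> (\<integral>\<omega>. max 0 (real_of_int (Y t \<omega> - k)) \<partial>M)" for t
  proof -
    have i: "integrable M (\<lambda>\<omega>. indicator (A t) \<omega> * \<phi> (Y t \<omega>))" for \<phi> :: "int \<Rightarrow> real"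
      by (rule integrable_bounded_int_fun[where C=1 and t=t]) (use Yb in \<open>auto simp: indicator_def\<close>)
    have "(\<integral>\<omega>. 1 * (\<Sum>s<t. indicator {\<omega>\<in>space M. enat s < \<sigma> \<omega> \<and> n \<le> Smax S s \<omega>} \<omega>
        * real_of_int (S (Suc s) \<omega> - S s \<omega>)) \<partial>M) = 0"
    proof (rule integral_sum_increments[where C=1])
      fix s
      have "{\<omega>\<in>space M. enat s < \<sigma> \<omega> \<and> n \<le> Smax S s \<omega>}
          = {\<omega>\<in>space M. enat s < \<sigma> \<omega>} \<inter> {\<omega>\<in>space M. n \<le> Smax S s \<omega>}" by auto
      then show "{\<omega>\<in>space M. enat s < \<sigma> \<omega> \<and> n \<le> Smax S s \<omega>} \<in> sets (F s)"
        using less_stopping_sets[OF st, of s] Smax_ge_sets[of n s] by auto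
    qed auto
    also have "(\<integral>\<omega>. 1 * (\<Sum>s<t. indicator {\<omega>\<in>space M. enat s < \<sigma> \<omega> \<and> n \<le> Smax S s \<omega>} \<omega>
        * real_of_int (S (Suc s) \<omega> - S s \<omega>)) \<partial>M) = (\<integral>\<omega>. indicator (A t) \<omega> * real_of_int (Y t \<omega> - n) \<partial>M)"
    proof (rule integral_cong_AE)
      show "AE \<omega> in M. 1 * (\<Sum>s<t. indicator {\<omega>\<in>space M. enat s < \<sigma> \<omega> \<and> n \<le> Smax S s \<omega>} \<omega>
        * real_of_int (S (Suc s) \<omega> - S s \<omega>)) = indicator (A t) \<omega> * real_of_int (Y t \<omega> - n)"
        using AE_good
      proof eventually_elim
        case (elim \<omega>)
        then have "\<omega> \<in> space M" by (simp add: good_def)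
        then show ?case unfolding increments_after_level[OF elim n] mult_1
          by (auto simp: A_def Y_def indicator_def)
      qed
      have "{\<omega>\<in>space M. enat s < \<sigma> \<omega> \<and> n \<le> Smax S s \<omega>} \<in> events" for s
      proof -
        have "{\<omega>\<in>space M. enat s < \<sigma> \<omega> \<and> n \<le> Smax S s \<omega>}
          = {\<omega>\<in>space M. enat s < \<sigma> \<omega>} \<inter> {\<omega>\<in>space M. n \<le> Smax S s \<omega>}" by auto
        then show ?thesis
          using less_stopping_sets[OF st, of s] Smax_ge_sets[of n s] F_subalgebra[of s] by (auto simp: subalgebra_def)
      qed
      moreover have "(\<lambda>\<omega>. real_of_int (S (Suc s) \<omega> - S s \<omega>)) \<in> borel_measurable M" for s
        by (rule measurable_compose[OF step_measurable]) simp
      ultimately show "(\<lambda>\<omega>. 1 * (\<Sum>s<t. indicator {\<omega>\<in>space M. enat s < \<sigma> \<omega> \<and> n \<le> Smax S s \<omega>} \<omega>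
        * real_of_int (S (Suc s) \<omega> - S s \<omega>))) \<in> borel_measurable M"
        by (intro borel_measurable_times borel_measurable_sum) auto
      show "(\<lambda>\<omega>. indicator (A t) \<omega> * real_of_int (Y t \<omega> - n)) \<in> borel_measurable M"
        using i[of "\<lambda>y. real_of_int (y - n)"] by (rule borel_measurable_integrable)
    qed
    finally have z: "(\<integral>\<omega>. indicator (A t) \<omega> * real_of_int (Y t \<omega> - n) \<partial>M) = 0" .
    have "real_of_int (n - k) * prob (A t) = (\<integral>\<omega>. indicator (A t) \<omega> * real_of_int (n - k) \<partial>M)"
      by simp
    also have "\<dots> = (\<integral>\<omega>. indicator (A t) \<omega> * real_of_int (n - k) + indicator (A t) \<omega> * real_of_int (Y t \<omega> - n) \<partial>M)"
      using i[of "\<lambda>_. real_of_int (n - k)"] i[of "\<lambda>y. real_of_int (y - n)"] z by simp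
    also have "\<dots> \<le> (\<integral>\<omega>. 1 * max 0 (real_of_int (Y t \<omega> - k)) \<partial>M)"
    proof (rule integral_mono)
      show "integrable M (\<lambda>\<omega>. 1 * max 0 (real_of_int (Y t \<omega> - k)))"
        by (rule integrable_bounded_int_fun[where C=1 and t=t]) (use Yb in auto)
      show "integrable M (\<lambda>\<omega>. indicator (A t) \<omega> * real_of_int (n - k) + indicator (A t) \<omega> * real_of_int (Y t \<omega> - n))"
        using i[of "\<lambda>_. real_of_int (n - k)"] i[of "\<lambda>y. real_of_int (y - n)"] by simp
      fix \<omega>
      show "indicator (A t) \<omega> * real_of_int (n - k) + indicator (A t) \<omega> * real_of_int (Y t \<omega> - n)
          \<le> 1 * max 0 (real_of_int (Y t \<omega> - k))" by (auto simp: indicator_def)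
    qed
    finally show ?thesis by simp
  qed
  have Zm: "(\<lambda>\<omega>. S (the_enat (\<sigma> \<omega>)) \<omega>) \<in> measurable M (count_space UNIV)"
    by (rule terminal_measurable[OF sm S_measurable])
  have lim1: "(\<lambda>t. prob (A t)) \<longlonglongrightarrow> prob A'"
  proof -
    have A'm: "A' \<in> events"
    proof -
      have "A' = (\<lambda>\<omega>. \<sigma> \<omega>) -` (UNIV - {\<infinity>}) \<inter> space M \<inter> ((\<lambda>\<omega>. Smax S (the_enat (\<sigma> \<omega>)) \<omega>) -` {n..} \<inter> space M)"
        by (auto simp: A'_def)
      then show ?thesis
        using measurable_sets[OF sm, of "UNIV - {\<infinity>}"]
          measurable_sets[OF terminal_measurable[OF sm Smax_measurable], of "{n..}"] by auto
    qed
    have "(\<lambda>t. \<integral>\<omega>. indicator (A t) \<omega> \<partial>M) \<longlonglongrightarrow> (\<integral>\<omega>. (indicator A' \<omega> :: real) \<partial>M)"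
    proof (rule integral_dominated_convergence[where w="\<lambda>_. 1"])
      show "AE \<omega> in M. (\<lambda>t. indicator (A t) \<omega> :: real) \<longlonglongrightarrow> indicator A' \<omega>"
        using fin AE_space
      proof eventually_elim
        case (elim \<omega>)
        show ?case using stopped_tendsto[OF elim(1), of "\<lambda>u. if n \<le> Smax S u \<omega> then 1 else 0 :: real"] elim
          by (simp add: A_def A'_def indicator_def of_bool_def if_distrib cong: if_cong)
      qed
    qed (use A'm in \<open>auto simp: indicator_def\<close>)
    then show ?thesis using A'm by simp
  qed
  have "real_of_int (n - k) * prob A' \<le> (\<integral>\<omega>. max 0 (real_of_int (S (the_enat (\<sigma> \<omega>)) \<omega> - k)) \<partial>M) + e"
    if e: "0 < e" for e
  proof -
    obtain K where K: "\<And>t. (\<integral>\<omega>. indicator {\<omega>. K < \<bar>real_of_int (stopped S \<sigma> t \<omega>)\<bar>} \<omega>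
        * \<bar>real_of_int (stopped S \<sigma> t \<omega>)\<bar> \<partial>M) < e"
      using ui e unfolding unif_integrable_def by metis
    \<comment> \<open>Either \<open>\<bar>y\<bar> \<le> K\<close>, and then \<open>y - k\<close> is
      at most \<open>C\<close>; or the excess of \<open>y - k\<close> over \<open>C\<close> is at
      most \<open>\<bar>y\<bar>\<close>, because \<open>C\<close> contains
      \<open>\<bar>k\<bar>\<close>.\<close>
    define C where "C = \<bar>K\<bar> + \<bar>real_of_int k\<bar>"
    have C: "0 \<le> C" by (simp add: C_def)
    have bound: "(\<integral>\<omega>. max 0 (real_of_int (Y t \<omega> - k)) \<partial>M)
        \<le> (\<integral>\<omega>. min C (max 0 (real_of_int (Y t \<omega> - k))) \<partial>M) + e" for t
    proof -
      have i: "integrable M (\<lambda>\<omega>. 1 * \<phi> (Y t \<omega>))" for \<phi> :: "int \<Rightarrow> real"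
        by (rule integrable_bounded_int_fun[where C=1 and t=t]) (use Yb in auto)
      define g where "g y = indicator {y. K < \<bar>y\<bar>} (real_of_int y) * \<bar>real_of_int y\<bar>" for y
      have "(\<integral>\<omega>. 1 * max 0 (real_of_int (Y t \<omega> - k)) \<partial>M)
          \<le> (\<integral>\<omega>. 1 * (min C (max 0 (real_of_int (Y t \<omega> - k))) + g (Y t \<omega>)) \<partial>M)"
        by (rule integral_mono[OF i i]) (auto simp: g_def C_def indicator_def split: split_max split_min)
      also have "\<dots> = (\<integral>\<omega>. min C (max 0 (real_of_int (Y t \<omega> - k))) \<partial>M) + (\<integral>\<omega>. g (Y t \<omega>) \<partial>M)"
        using i[of "\<lambda>y. min C (max 0 (real_of_int (y - k)))"] i[of g] by simp
      also have "(\<integral>\<omega>. g (Y t \<omega>) \<partial>M) < e"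
        using K[of t] by (simp add: g_def stopped_clk Y_def indicator_def)
      finally show ?thesis by simp
    qed
    have "(\<lambda>t. \<integral>\<omega>. min C (max 0 (real_of_int (Y t \<omega> - k))) \<partial>M)
        \<longlonglongrightarrow> (\<integral>\<omega>. min C (max 0 (real_of_int (S (the_enat (\<sigma> \<omega>)) \<omega> - k))) \<partial>M)"
    proof (rule integral_dominated_convergence[where w="\<lambda>_. C"])
      show "AE \<omega> in M. (\<lambda>t. min C (max 0 (real_of_int (Y t \<omega> - k))))
          \<longlonglongrightarrow> min C (max 0 (real_of_int (S (the_enat (\<sigma> \<omega>)) \<omega> - k)))"
        using fin
      proof eventually_elim
        case (elim \<omega>)
        show ?case unfolding Y_def
          using stopped_tendsto[OF elim, of "\<lambda>u. min C (max 0 (real_of_int (S u \<omega> - k)))"] .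
      qed
      show "(\<lambda>\<omega>. min C (max 0 (real_of_int (S (the_enat (\<sigma> \<omega>)) \<omega> - k)))) \<in> borel_measurable M"
        by (rule measurable_compose[OF Zm]) simp
      show "(\<lambda>\<omega>. min C (max 0 (real_of_int (Y t \<omega> - k)))) \<in> borel_measurable M" for t
        by (rule measurable_compose[OF Ym]) simp
    qed (use C in auto)
    then have L1: "(\<lambda>t. (\<integral>\<omega>. min C (max 0 (real_of_int (Y t \<omega> - k))) \<partial>M) + e)
        \<longlonglongrightarrow> (\<integral>\<omega>. min C (max 0 (real_of_int (S (the_enat (\<sigma> \<omega>)) \<omega> - k))) \<partial>M) + e"
      by (intro tendsto_intros)
    have L2: "(\<lambda>t. real_of_int (n - k) * prob (A t)) \<longlonglongrightarrow> real_of_int (n - k) * prob A'"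
      by (intro tendsto_intros lim1)
    have "real_of_int (n - k) * prob A'
        \<le> (\<integral>\<omega>. min C (max 0 (real_of_int (S (the_enat (\<sigma> \<omega>)) \<omega> - k))) \<partial>M) + e"
      by (rule LIMSEQ_le[OF L2 L1]) (use step1 bound order_trans in blast)
    also have "(\<integral>\<omega>. min C (max 0 (real_of_int (S (the_enat (\<sigma> \<omega>)) \<omega> - k))) \<partial>M)
        \<le> (\<integral>\<omega>. max 0 (real_of_int (S (the_enat (\<sigma> \<omega>)) \<omega> - k)) \<partial>M)"
    proof (rule integral_mono[OF _ int])
      show "integrable M (\<lambda>\<omega>. min C (max 0 (real_of_int (S (the_enat (\<sigma> \<omega>)) \<omega> - k))))"
      proof (rule integrable_const_bound[where B=C])
        show "(\<lambda>\<omega>. min C (max 0 (real_of_int (S (the_enat (\<sigma> \<omega>)) \<omega> - k)))) \<in> borel_measurable M"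
          by (rule measurable_compose[OF Zm]) simp
      qed (use C in auto)
    qed simp
    finally show ?thesis by simp
  qed
  then show ?thesis unfolding A'_def by (rule field_le_epsilon)
qed

end

section \<open>Stopping at a level-dependent barrier\<close>

context ssrw
begin

text \<open>Only paths still running at \<open>t\<close> change their value, and for them convexity
  raises the mean.\<close>

lemma stopped_convex_mono:
  fixes \<phi> :: "int \<Rightarrow> real"
  assumes st: "stopping_time_wrt M F \<theta>"
    and W: "W \<in> borel_measurable (F 0)" "\<And>\<omega>. \<omega> \<in> space M \<Longrightarrow> 0 \<le> W \<omega>" "\<And>\<omega>. \<omega> \<in> space M \<Longrightarrow> W \<omega> \<le> 1"
    and convex: "\<And>x. 2 * \<phi> x \<le> \<phi> (x + 1) + \<phi> (x - 1)"
  shows "(\<integral>\<omega>. W \<omega> * \<phi> (S (clk (\<theta> \<omega>) t) \<omega>) \<partial>M) \<le> (\<integral>\<omega>. W \<omega> * \<phi> (S (clk (\<theta> \<omega>) (Suc t)) \<omega>) \<partial>M)"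
proof -
  define E where "E = {\<omega>\<in>space M. enat t < \<theta> \<omega>}"
  have E: "E \<in> sets (F t)" unfolding E_def by (rule less_stopping_sets[OF st])
  note sm = stopping_measurable[OF st]
  have WM: "W \<in> borel_measurable M" by (rule measurable_F_imp_M[OF W(1)])
  have W1: "\<bar>W \<omega>\<bar> \<le> 1" if "\<omega> \<in> space M" for \<omega> using W(2,3)[OF that] by simp
  have V: "(\<lambda>\<omega>. W \<omega> * indicator E \<omega>) \<in> borel_measurable (F t)"
    using measurable_F_mono[OF W(1), of t] E by simp
  have V1: "\<bar>W \<omega> * indicator E \<omega>\<bar> \<le> 1" if "\<omega> \<in> space M" for \<omega>
    using W1[OF that] by (auto simp: indicator_def)
  have i1: "integrable M (\<lambda>\<omega>. W \<omega> * indicator E \<omega> * \<psi> (S u \<omega>))" for u and \<psi> :: "int \<Rightarrow> real"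
    by (rule integrable_bounded_int_fun[OF measurable_F_imp_M[OF V] V1 S_measurable, of u]) (use AE_S_bound in auto)
  have i2: "integrable M (\<lambda>\<omega>. W \<omega> * \<phi> (S (clk (\<theta> \<omega>) t) \<omega>))"
  proof (rule integrable_bounded_int_fun[OF WM W1 clk_measurable[OF sm S_measurable], where t=t])
    show "AE \<omega> in M. \<bar>S (clk (\<theta> \<omega>) t) \<omega>\<bar> \<le> int t"
      using AE_S_bound
    proof eventually_elim
      case (elim \<omega>)
      then show ?case using clk_le[of "\<theta> \<omega>" t] by (auto intro: order_trans[of _ "int (clk (\<theta> \<omega>) t)"])
    qed
  qed
  have "0 \<le> (\<integral>\<omega>. W \<omega> * indicator E \<omega> * ((\<phi> (S t \<omega> + 1) + \<phi> (S t \<omega> - 1)) / 2 - \<phi> (S t \<omega>)) \<partial>M)"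
  proof (rule integral_nonneg_AE, rule AE_I2)
    fix \<omega> assume "\<omega> \<in> space M"
    then show "0 \<le> W \<omega> * indicator E \<omega> * ((\<phi> (S t \<omega> + 1) + \<phi> (S t \<omega> - 1)) / 2 - \<phi> (S t \<omega>))"
      using W(2) convex[of "S t \<omega>"] by (intro mult_nonneg_nonneg) auto
  qed
  also have "\<dots> = (\<integral>\<omega>. W \<omega> * indicator E \<omega> * ((\<phi> (S t \<omega> + 1) + \<phi> (S t \<omega> - 1)) / 2) \<partial>M)
      - (\<integral>\<omega>. W \<omega> * indicator E \<omega> * \<phi> (S t \<omega>) \<partial>M)"
    using i1[of "\<lambda>s. (\<phi> (s + 1) + \<phi> (s - 1)) / 2" t] i1[of \<phi> t]
    unfolding right_diff_distrib by (rule Bochner_Integration.integral_diff)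
  also have "(\<integral>\<omega>. W \<omega> * indicator E \<omega> * ((\<phi> (S t \<omega> + 1) + \<phi> (S t \<omega> - 1)) / 2) \<partial>M)
      = (\<integral>\<omega>. W \<omega> * indicator E \<omega> * \<phi> (S (Suc t) \<omega>) \<partial>M)"
    by (rule integral_step_S[OF V V1, symmetric])
  finally have pos: "0 \<le> (\<integral>\<omega>. W \<omega> * indicator E \<omega> * \<phi> (S (Suc t) \<omega>) \<partial>M)
      - (\<integral>\<omega>. W \<omega> * indicator E \<omega> * \<phi> (S t \<omega>) \<partial>M)" .
  have "(\<integral>\<omega>. W \<omega> * \<phi> (S (clk (\<theta> \<omega>) (Suc t)) \<omega>) \<partial>M)
      = (\<integral>\<omega>. W \<omega> * \<phi> (S (clk (\<theta> \<omega>) t) \<omega>) + (W \<omega> * indicator E \<omega> * \<phi> (S (Suc t) \<omega>)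
        - W \<omega> * indicator E \<omega> * \<phi> (S t \<omega>)) \<partial>M)"
    by (rule Bochner_Integration.integral_cong) (auto simp: E_def clk_Suc clk_before indicator_def)
  also have "\<dots> = (\<integral>\<omega>. W \<omega> * \<phi> (S (clk (\<theta> \<omega>) t) \<omega>) \<partial>M)
      + ((\<integral>\<omega>. W \<omega> * indicator E \<omega> * \<phi> (S (Suc t) \<omega>) \<partial>M) - (\<integral>\<omega>. W \<omega> * indicator E \<omega> * \<phi> (S t \<omega>) \<partial>M))"
    using i2 i1[of \<phi> "Suc t"] i1[of \<phi> t] by simp
  finally show ?thesis using pos by simp
qed

lemma stopped_convex_le_terminal:
  fixes \<phi> :: "int \<Rightarrow> real"
  assumes st: "stopping_time_wrt M F \<theta>" and fin: "AE \<omega> in M. \<theta> \<omega> \<noteq> \<infinity>"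
    and W: "W \<in> borel_measurable (F 0)" "\<And>\<omega>. \<omega> \<in> space M \<Longrightarrow> 0 \<le> W \<omega>" "\<And>\<omega>. \<omega> \<in> space M \<Longrightarrow> W \<omega> \<le> 1"
    and convex: "\<And>x. 2 * \<phi> x \<le> \<phi> (x + 1) + \<phi> (x - 1)"
    and bound: "\<And>t. AE \<omega> in M. \<bar>W \<omega> * \<phi> (S (clk (\<theta> \<omega>) t) \<omega>)\<bar> \<le> C"
  shows "(\<integral>\<omega>. W \<omega> * \<phi> (S (clk (\<theta> \<omega>) t) \<omega>) \<partial>M) \<le> (\<integral>\<omega>. W \<omega> * \<phi> (S (the_enat (\<theta> \<omega>)) \<omega>) \<partial>M)"
proof -
  note sm = stopping_measurable[OF st]
  have WM: "W \<in> borel_measurable M" by (rule measurable_F_imp_M[OF W(1)])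
  have mono: "incseq (\<lambda>t. \<integral>\<omega>. W \<omega> * \<phi> (S (clk (\<theta> \<omega>) t) \<omega>) \<partial>M)"
    by (rule incseq_SucI) (rule stopped_convex_mono[OF st W convex])
  have "(\<lambda>t. \<integral>\<omega>. W \<omega> * \<phi> (S (clk (\<theta> \<omega>) t) \<omega>) \<partial>M) \<longlonglongrightarrow> (\<integral>\<omega>. W \<omega> * \<phi> (S (the_enat (\<theta> \<omega>)) \<omega>) \<partial>M)"
  proof (rule integral_dominated_convergence[where w="\<lambda>_. C"])
    show "AE \<omega> in M. (\<lambda>t. W \<omega> * \<phi> (S (clk (\<theta> \<omega>) t) \<omega>)) \<longlonglongrightarrow> W \<omega> * \<phi> (S (the_enat (\<theta> \<omega>)) \<omega>)"
      using fin
    proof eventually_elim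
      case (elim \<omega>)
      show ?case using stopped_tendsto[OF elim, of "\<lambda>u. W \<omega> * \<phi> (S u \<omega>)"] .
    qed
    have "(\<lambda>\<omega>. \<phi> (S (the_enat (\<theta> \<omega>)) \<omega>)) \<in> borel_measurable M"
      by (rule measurable_compose[OF terminal_measurable[OF sm S_measurable]]) simp
    then show "(\<lambda>\<omega>. W \<omega> * \<phi> (S (the_enat (\<theta> \<omega>)) \<omega>)) \<in> borel_measurable M" using WM by simp
    have "(\<lambda>\<omega>. \<phi> (S (clk (\<theta> \<omega>) t) \<omega>)) \<in> borel_measurable M" for t
      by (rule measurable_compose[OF clk_measurable[OF sm S_measurable]]) simp
    then show "(\<lambda>\<omega>. W \<omega> * \<phi> (S (clk (\<theta> \<omega>) t) \<omega>)) \<in> borel_measurable M" for t using WM by simp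
    show "AE \<omega> in M. norm (W \<omega> * \<phi> (S (clk (\<theta> \<omega>) t) \<omega>)) \<le> C" for t using bound[of t] by simp
  qed simp
  then show ?thesis by (rule incseq_le[OF mono])
qed

end

section \<open>The walk stopped at random barriers known at time 0\<close>

locale drawdown = ssrw +
  fixes B :: "nat \<Rightarrow> 'a \<Rightarrow> int"
  assumes B_measurable: "\<And>n. B n \<in> measurable (F 0) (count_space UNIV)"
    and B_le: "\<And>n \<omega>. B n \<omega> \<le> int n"
begin

definition T :: "'a \<Rightarrow> enat" where
  "T \<omega> = first_time (\<lambda>t. S t \<omega> \<le> B (nat (Smax S t \<omega>)) \<omega>)"

definition Y :: "nat \<Rightarrow> 'a \<Rightarrow> int" where
  "Y t \<omega> = S (clk (T \<omega>) t) \<omega>"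

definition Ymax :: "nat \<Rightarrow> 'a \<Rightarrow> int" where
  "Ymax t \<omega> = Smax S (clk (T \<omega>) t) \<omega>"

text \<open>Phrased through the stopped path at some finite time, because finiteness of
  \<open>T\<close> is derived later from the probabilities of these very events.\<close>

definition R :: "nat \<Rightarrow> 'a set" where
  "R n = {\<omega>\<in>space M. \<exists>t. int n \<le> Ymax t \<omega>}"

lemma T_less_iff: "enat t < T \<omega> \<longleftrightarrow> (\<forall>u\<le>t. B (nat (Smax S u \<omega>)) \<omega> < S u \<omega>)"
  by (simp add: T_def less_first_time_iff not_le)

lemma T_enat: "T \<omega> = enat t \<Longrightarrow> S t \<omega> \<le> B (nat (Smax S t \<omega>)) \<omega>"
  unfolding T_def by (drule first_time_enat) simp

lemma T_stopping: "stopping_time_wrt M F T"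
  unfolding stopping_time_wrt_def
proof
  fix t
  have "{\<omega>\<in>space M. S u \<omega> \<le> B (nat (Smax S u \<omega>)) \<omega>} \<in> sets (F t)" if "u \<le> t" for u
  proof -
    have "(\<lambda>\<omega>. nat (Smax S u \<omega>)) \<in> measurable (F t) (count_space UNIV)"
      by (rule measurable_compose[OF Smax_adapted[OF that]]) simp
    then have "(\<lambda>\<omega>. B (nat (Smax S u \<omega>)) \<omega>) \<in> measurable (F t) (count_space UNIV)"
      by (rule measurable_compose_countable[where f=B and g="\<lambda>\<omega>. nat (Smax S u \<omega>)", rotated])
        (rule measurable_F_mono[OF B_measurable], simp)
    from measurable_count_space_op2[OF S_adapted[OF that] this, of "(\<le>)"]
    have "(\<lambda>\<omega>. S u \<omega> \<le> B (nat (Smax S u \<omega>)) \<omega>) -` {True} \<inter> space (F t) \<in> sets (F t)"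
      by (rule measurable_sets) simp
    then show ?thesis by (simp add: vimage_def Int_def conj_commute)
  qed
  then have "(\<Union>u\<in>{..t}. {\<omega>\<in>space M. S u \<omega> \<le> B (nat (Smax S u \<omega>)) \<omega>}) \<in> sets (F t)" by auto
  also have "(\<Union>u\<in>{..t}. {\<omega>\<in>space M. S u \<omega> \<le> B (nat (Smax S u \<omega>)) \<omega>}) = {\<omega>\<in>space M. T \<omega> \<le> enat t}"
    by (auto simp: T_def first_time_le_iff)
  finally show "{\<omega>\<in>space M. T \<omega> \<le> enat t} \<in> sets (F t)" .
qed

lemmas T_measurable [measurable] = stopping_measurable[OF T_stopping]

lemma Y_measurable [measurable]: "Y t \<in> measurable M (count_space UNIV)"
  unfolding Y_def by (rule clk_measurable[OF T_measurable S_measurable])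

lemma Ymax_measurable [measurable]: "Ymax t \<in> measurable M (count_space UNIV)"
  unfolding Ymax_def by (rule clk_measurable[OF T_measurable Smax_measurable])

lemma R_events [measurable]: "R n \<in> events" unfolding R_def by measurable

lemma R_antimono: "m \<le> n \<Longrightarrow> R n \<subseteq> R m"
  unfolding R_def by (rule Collect_mono) (meson of_nat_mono order_trans)

lemma Ymax_mono: "s \<le> t \<Longrightarrow> Ymax s \<omega> \<le> Ymax t \<omega>"
  unfolding Ymax_def by (intro Smax_mono clk_mono)

text \<open>Unit steps cannot jump over the barrier, and a step that raises the maximum puts the
  walk at its maximum, which no barrier exceeds. This is why the walk stops exactly on the
  barrier.\<close>

lemma Y_ge:
  assumes "good \<omega>" shows "B (nat (Ymax t \<omega>)) \<omega> \<le> Y t \<omega>"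
proof (induction t)
  case 0
  then show ?case using assms B_le[of 0 \<omega>] by (simp add: Y_def Ymax_def good_def)
next
  case (Suc t)
  show ?case
  proof (cases "enat t < T \<omega>")
    case True
    then have c: "clk (T \<omega>) (Suc t) = Suc t" by (simp add: clk_Suc)
    have l: "B (nat (Smax S t \<omega>)) \<omega> < S t \<omega>" using True by (simp add: T_less_iff)
    show ?thesis
    proof (cases "Smax S t \<omega> < S (Suc t) \<omega>")
      case True
      then have "Smax S (Suc t) \<omega> = S (Suc t) \<omega>" by (simp add: Smax_Suc)
      then show ?thesis using B_le[of "nat (S (Suc t) \<omega>)" \<omega>] Smax_nonneg[OF assms, of "Suc t"]
        by (simp add: Y_def Ymax_def c)
    next
      case False
      then have "Smax S (Suc t) \<omega> = Smax S t \<omega>" by (simp add: Smax_Suc)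
      then show ?thesis using l good_step[OF assms, of t] by (auto simp: Y_def Ymax_def c)
    qed
  next
    case False
    then show ?thesis using Suc by (simp add: Y_def Ymax_def clk_Suc)
  qed
qed

text \<open>The gain from betting only while the maximum is \<open>n\<close>: the run opens at
  \<open>n\<close> and is closed at \<open>n + 1\<close> by the step that raises the maximum. The
  three values stand for level not reached, level current, level left upwards.\<close>

lemma increments_at_level:
  assumes "good \<omega>"
  shows "(\<Sum>s<t. indicator {\<omega>\<in>space M. enat s < T \<omega> \<and> Smax S s \<omega> = int n} \<omega> * real_of_int (S (Suc s) \<omega> - S s \<omega>))
    = (if Ymax t \<omega> < int n then 0 else if Ymax t \<omega> = int n then real_of_int (Y t \<omega> - int n) else 1)"
proof (induction t)
  case 0
  then show ?case using assms by (simp add: good_def Ymax_def Y_def)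
next
  case (Suc t)
  have sp: "\<omega> \<in> space M" using assms by (simp add: good_def)
  show ?case
  proof (cases "enat t < T \<omega>")
    case True
    then have "clk (T \<omega>) t = t" by (simp add: clk_before)
    then show ?thesis using Suc True sp good_step[OF assms(1), of t] Smax_ge[of t t S \<omega>]
      by (auto simp: clk_Suc Smax_Suc indicator_def max_def Ymax_def Y_def)
  next
    case False
    then show ?thesis using Suc by (simp add: clk_Suc Y_def Ymax_def)
  qed
qed

text \<open>A path that neither stops nor reaches \<open>n\<close> would be confined between
  finitely many barriers and \<open>n\<close>, but good paths leave every bounded interval.\<close>

lemma infinite_reaches:
  assumes "good \<omega>" "T \<omega> = \<infinity>" shows "\<exists>t. int n \<le> Ymax t \<omega>"
proof (rule ccontr)
  assume "\<not> (\<exists>t. int n \<le> Ymax t \<omega>)"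
  then have lt: "Smax S t \<omega> < int n" for t using assms by (simp add: Ymax_def not_le)
  define K where "K = Max ((\<lambda>j. nat \<bar>B j \<omega>\<bar>) ` {..n}) + n"
  obtain t where t: "int K < \<bar>S t \<omega>\<bar>" using assms(1) unfolding good_def by blast
  have "B (nat (Smax S t \<omega>)) \<omega> < S t \<omega>" using assms(2) T_less_iff[of t \<omega>] by simp
  moreover have "nat \<bar>B (nat (Smax S t \<omega>)) \<omega>\<bar> \<le> Max ((\<lambda>j. nat \<bar>B j \<omega>\<bar>) ` {..n})"
    using lt[of t] by (intro Max_ge) auto
  moreover have "S t \<omega> < int n" using Smax_ge[of t t S \<omega>] lt[of t] by simp
  ultimately show False using t unfolding K_def by linarith
qed

lemma R_finite_iff:
  assumes "\<omega> \<in> space M" "T \<omega> = enat m" shows "\<omega> \<in> R n \<longleftrightarrow> int n \<le> Smax S m \<omega>"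
proof -
  have le: "Ymax t \<omega> \<le> Smax S m \<omega>" for t
    unfolding Ymax_def by (intro Smax_mono) (simp add: assms clk_def)
  have eq: "Ymax m \<omega> = Smax S m \<omega>" by (simp add: Ymax_def assms clk_def)
  show ?thesis
  proof
    assume "\<omega> \<in> R n"
    then obtain t where "int n \<le> Ymax t \<omega>" by (auto simp: R_def)
    then show "int n \<le> Smax S m \<omega>" using le[of t] by linarith
  next
    assume "int n \<le> Smax S m \<omega>"
    then have "int n \<le> Ymax m \<omega>" by (simp only: eq)
    then show "\<omega> \<in> R n" using assms(1) unfolding R_def by blast
  qed
qed

lemma S_at_T:
  assumes "good \<omega>" "T \<omega> = enat m" shows "S m \<omega> = B (nat (Smax S m \<omega>)) \<omega>"
  using T_enat[OF assms(2)] Y_ge[OF assms(1), of m] assms(2) by (simp add: Y_def Ymax_def clk_def)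

lemma level_limit:
  assumes "good \<omega>"
  shows "(\<lambda>t. if Ymax t \<omega> < int n then 0 else if Ymax t \<omega> = int n then real_of_int (Y t \<omega> - int n) else 1)
    \<longlonglongrightarrow> (if \<omega> \<in> R (Suc n) then 1 else if \<omega> \<in> R n then real_of_int (B n \<omega> - int n) else 0)"
proof (rule tendsto_eventually)
  have sp: "\<omega> \<in> space M" using assms by (simp add: good_def)
  show "eventually (\<lambda>t. (if Ymax t \<omega> < int n then 0 else if Ymax t \<omega> = int n then real_of_int (Y t \<omega> - int n) else 1)
    = (if \<omega> \<in> R (Suc n) then 1 else if \<omega> \<in> R n then real_of_int (B n \<omega> - int n) else 0)) sequentially"
  proof (cases "T \<omega>")
    case (enat m)
    have "Ymax t \<omega> = Smax S m \<omega>" "Y t \<omega> = S m \<omega>" if "m \<le> t" for t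
      using that by (auto simp: Y_def Ymax_def enat clk_def)
    moreover have nat_eq: "nat (Smax S m \<omega>) = n" if "int n \<le> Smax S m \<omega>" "\<not> 1 + int n \<le> Smax S m \<omega>"
      using that by auto
    ultimately show ?thesis unfolding eventually_sequentially
      using R_finite_iff[OF sp enat] S_at_T[OF assms enat] nat_eq
      by (intro exI[of _ m]) auto
  next
    case infinity
    obtain u where u: "int (Suc n) \<le> Ymax u \<omega>" using infinite_reaches[OF assms infinity] by blast
    then have "int (Suc n) \<le> Ymax t \<omega>" if "u \<le> t" for t using Ymax_mono[OF that, of \<omega>] by linarith
    moreover have "\<omega> \<in> R (Suc n)" using u sp by (auto simp: R_def)
    ultimately show ?thesis unfolding eventually_sequentially
      by (intro exI[of _ u]) force
  qed
qed

text \<open>Gambler's ruin: the chance, starting from \<open>n\<close>, of reaching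
  \<open>n + 1\<close> before \<open>B n\<close>.\<close>

definition r :: "nat \<Rightarrow> 'a \<Rightarrow> real" where
  "r n \<omega> = (real n - real_of_int (B n \<omega>)) / (real n + 1 - real_of_int (B n \<omega>))"

lemma r_measurable: "r n \<in> borel_measurable (F 0)"
  unfolding r_def by (rule measurable_compose[OF B_measurable]) simp

lemma r_bounds: "0 \<le> r n \<omega>" "r n \<omega> \<le> 1"
  using B_le[of n \<omega>] unfolding r_def by (auto simp: divide_le_eq)

text \<open>The gain at level \<open>n\<close> has mean 0 under any weight known at time 0. Its
  limit is 1 on \<open>R (n + 1)\<close> and \<open>B n - n\<close> on the rest of
  \<open>R n\<close>, and the identity is solved for the first part.\<close>

lemma reach_step:
  assumes W: "W \<in> borel_measurable (F 0)" "\<And>\<omega>. \<omega> \<in> space M \<Longrightarrow> \<bar>W \<omega>\<bar> \<le> C"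
  shows "(\<integral>\<omega>. W \<omega> * indicator (R (Suc n)) \<omega> \<partial>M) = (\<integral>\<omega>. W \<omega> * r n \<omega> * indicator (R n) \<omega> \<partial>M)"
proof -
  note WM [measurable] = measurable_F_imp_M[OF W(1)]
  note rM [measurable] = measurable_F_imp_M[OF r_measurable]
  \<comment> \<open>Dividing by \<open>n + 1 - B n\<close> turns the limit into the difference of
    the two claimed integrands, and it keeps \<open>V * N\<close> bounded by
    \<open>\<bar>W\<bar>\<close> although the barriers are unbounded.\<close>
  define V where "V \<omega> = W \<omega> / (real n + 1 - real_of_int (B n \<omega>))" for \<omega>
  have den: "1 \<le> real n + 1 - real_of_int (B n \<omega>)" for \<omega> using B_le[of n \<omega>] by linarith
  have Vm: "V \<in> borel_measurable (F 0)"
    unfolding V_def using W(1) measurable_compose[OF B_measurable, of "\<lambda>b. real n + 1 - real_of_int b" borel n]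
    by simp
  have Vb: "\<bar>V \<omega>\<bar> \<le> C" if "\<omega> \<in> space M" for \<omega>
  proof -
    have "\<bar>V \<omega>\<bar> = \<bar>W \<omega>\<bar> / (real n + 1 - real_of_int (B n \<omega>))" using den[of \<omega>] by (simp add: V_def)
    also have "\<dots> \<le> \<bar>W \<omega>\<bar> / 1" using den[of \<omega>] by (intro divide_left_mono) auto
    finally show ?thesis using W(2)[OF that] by simp
  qed
  note VM [measurable] = measurable_F_imp_M[OF Vm]
  define N where "N t \<omega> = (if Ymax t \<omega> < int n then 0 else if Ymax t \<omega> = int n then real_of_int (Y t \<omega> - int n) else 1)" for t \<omega>
  have Nm [measurable]: "N t \<in> borel_measurable M" for t
    unfolding N_def using measurable_count_space_op2[OF Ymax_measurable[of t] Y_measurable[of t],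
      of "\<lambda>m y. if m < int n then 0 else if m = int n then real_of_int (y - int n) else 1 :: real"]
    by (auto dest: measurable_compose[where g="\<lambda>x. x" and L=borel])
  have E: "{\<omega>\<in>space M. enat s < T \<omega> \<and> Smax S s \<omega> = int n} \<in> sets (F s)" for s
  proof -
    have "{\<omega>\<in>space M. enat s < T \<omega> \<and> Smax S s \<omega> = int n}
        = {\<omega>\<in>space M. enat s < T \<omega>} \<inter> {\<omega>\<in>space M. Smax S s \<omega> = int n}" by auto
    then show ?thesis using less_stopping_sets[OF T_stopping, of s] Smax_eq_sets[of s "int n"] by auto
  qed
  have Es [measurable]: "{\<omega>\<in>space M. enat s < T \<omega> \<and> Smax S s \<omega> = int n} \<in> events" for s
    using E[of s] F_subalgebra[of s] by (auto simp: subalgebra_def)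
  have z: "(\<integral>\<omega>. V \<omega> * N t \<omega> \<partial>M) = 0" for t
  proof -
    have "(\<integral>\<omega>. V \<omega> * N t \<omega> \<partial>M) = (\<integral>\<omega>. V \<omega> * (\<Sum>s<t. indicator {\<omega>\<in>space M. enat s < T \<omega> \<and> Smax S s \<omega> = int n} \<omega>
        * real_of_int (S (Suc s) \<omega> - S s \<omega>)) \<partial>M)"
    proof (rule integral_cong_AE)
      have "(\<lambda>\<omega>. real_of_int (S (Suc s) \<omega> - S s \<omega>)) \<in> borel_measurable M" for s
        by (rule measurable_compose[OF step_measurable]) simp
      then show "(\<lambda>\<omega>. V \<omega> * (\<Sum>s<t. indicator {\<omega>\<in>space M. enat s < T \<omega> \<and> Smax S s \<omega> = int n} \<omega>
        * real_of_int (S (Suc s) \<omega> - S s \<omega>))) \<in> borel_measurable M"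
        by (intro borel_measurable_times borel_measurable_sum VM) auto
      show "AE \<omega> in M. V \<omega> * N t \<omega> = V \<omega> * (\<Sum>s<t. indicator {\<omega>\<in>space M. enat s < T \<omega> \<and> Smax S s \<omega> = int n} \<omega>
        * real_of_int (S (Suc s) \<omega> - S s \<omega>))"
        using AE_good by eventually_elim (simp only: increments_at_level N_def)
    qed measurable
    also have "\<dots> = 0" by (rule integral_sum_increments[OF Vm Vb E])
    finally show ?thesis .
  qed
  have "(\<lambda>t. \<integral>\<omega>. V \<omega> * N t \<omega> \<partial>M)
      \<longlonglongrightarrow> (\<integral>\<omega>. W \<omega> * indicator (R (Suc n)) \<omega> - W \<omega> * r n \<omega> * indicator (R n) \<omega> \<partial>M)"
  proof (rule integral_dominated_convergence[where w="\<lambda>_. C"])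
    show "AE \<omega> in M. (\<lambda>t. V \<omega> * N t \<omega>)
        \<longlonglongrightarrow> W \<omega> * indicator (R (Suc n)) \<omega> - W \<omega> * r n \<omega> * indicator (R n) \<omega>"
      using AE_good
    proof eventually_elim
      case (elim \<omega>)
      have "(\<lambda>t. V \<omega> * N t \<omega>)
        \<longlonglongrightarrow> V \<omega> * (if \<omega> \<in> R (Suc n) then 1 else if \<omega> \<in> R n then real_of_int (B n \<omega> - int n) else 0)"
        unfolding N_def by (intro tendsto_intros level_limit elim)
      also have "V \<omega> * (if \<omega> \<in> R (Suc n) then 1 else if \<omega> \<in> R n then real_of_int (B n \<omega> - int n) else 0)
        = W \<omega> * indicator (R (Suc n)) \<omega> - W \<omega> * r n \<omega> * indicator (R n) \<omega>"
        using den[of \<omega>] R_antimono[of n "Suc n"] by (auto simp: V_def r_def field_simps)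
      finally show ?case .
    qed
    show "AE \<omega> in M. norm (V \<omega> * N t \<omega>) \<le> C" for t
      using AE_good
    proof eventually_elim
      case (elim \<omega>)
      then have "\<omega> \<in> space M" by (simp add: good_def)
      have "\<bar>N t \<omega>\<bar> \<le> real n + 1 - real_of_int (B n \<omega>)"
        using Y_ge[OF elim, of t] B_le[of n \<omega>] Smax_ge[of "clk (T \<omega>) t" "clk (T \<omega>) t" S \<omega>]
        by (auto simp: N_def Ymax_def Y_def)
      then have "\<bar>V \<omega>\<bar> * \<bar>N t \<omega>\<bar> \<le> \<bar>V \<omega>\<bar> * (real n + 1 - real_of_int (B n \<omega>))" by (intro mult_left_mono) auto
      also have "\<dots> = \<bar>W \<omega>\<bar>" using den[of \<omega>] by (simp add: V_def)
      finally show ?case using W(2)[OF \<open>\<omega> \<in> space M\<close>] by (simp add: abs_mult)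
    qed
  qed measurable
  then have "0 = (\<integral>\<omega>. W \<omega> * indicator (R (Suc n)) \<omega> - W \<omega> * r n \<omega> * indicator (R n) \<omega> \<partial>M)"
    unfolding z using LIMSEQ_const_iff by blast
  also have "\<dots> = (\<integral>\<omega>. W \<omega> * indicator (R (Suc n)) \<omega> \<partial>M) - (\<integral>\<omega>. W \<omega> * r n \<omega> * indicator (R n) \<omega> \<partial>M)"
  proof (rule Bochner_Integration.integral_diff)
    show "integrable M (\<lambda>\<omega>. W \<omega> * indicator (R (Suc n)) \<omega>)"
    proof (rule integrable_const_bound[where B="\<bar>C\<bar>"])
      show "AE \<omega> in M. norm (W \<omega> * indicator (R (Suc n)) \<omega>) \<le> \<bar>C\<bar>"
        using W(2) by (intro AE_I2) (force simp: indicator_def)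
    qed measurable
    show "integrable M (\<lambda>\<omega>. W \<omega> * r n \<omega> * indicator (R n) \<omega>)"
    proof (rule integrable_const_bound[where B="\<bar>C\<bar>"])
      show "AE \<omega> in M. norm (W \<omega> * r n \<omega> * indicator (R n) \<omega>) \<le> \<bar>C\<bar>"
      proof (rule AE_I2)
        fix \<omega> assume "\<omega> \<in> space M"
        then have "\<bar>W \<omega>\<bar> * \<bar>r n \<omega>\<bar> \<le> \<bar>C\<bar> * 1" using W(2)[of \<omega>] r_bounds[of n \<omega>] by (intro mult_mono) auto
        then show "norm (W \<omega> * r n \<omega> * indicator (R n) \<omega>) \<le> \<bar>C\<bar>" by (auto simp: indicator_def abs_mult)
      qed
    qed measurable
  qed
  finally show ?thesis by simp
qed

lemma R_0: "AE \<omega> in M. \<omega> \<in> R 0"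
  using AE_good
  by eventually_elim (auto simp: R_def good_def Ymax_def intro!: exI[of _ 0])

text \<open>Each step trades \<open>R (n + 1)\<close> for \<open>R n\<close> and a factor
  \<open>r n\<close>. That factor is known at time 0 and joins the weight, hence the induction over
  arbitrary \<open>W\<close>.\<close>

lemma reach_product:
  assumes W: "W \<in> borel_measurable (F 0)" "\<And>\<omega>. \<omega> \<in> space M \<Longrightarrow> \<bar>W \<omega>\<bar> \<le> C"
  shows "(\<integral>\<omega>. W \<omega> * indicator (R n) \<omega> \<partial>M) = (\<integral>\<omega>. W \<omega> * (\<Prod>j<n. r j \<omega>) \<partial>M)"
  using W
proof (induction n arbitrary: W)
  case 0
  show ?case
  proof (rule integral_cong_AE)
    show "AE \<omega> in M. W \<omega> * indicator (R 0) \<omega> = W \<omega> * (\<Prod>j<0. r j \<omega>)"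
      using R_0 by eventually_elim simp
  qed (use measurable_F_imp_M[OF 0(1)] in auto)
next
  case (Suc n)
  have "(\<integral>\<omega>. W \<omega> * indicator (R (Suc n)) \<omega> \<partial>M) = (\<integral>\<omega>. W \<omega> * r n \<omega> * indicator (R n) \<omega> \<partial>M)"
    by (rule reach_step[OF Suc.prems])
  also have "\<dots> = (\<integral>\<omega>. W \<omega> * r n \<omega> * (\<Prod>j<n. r j \<omega>) \<partial>M)"
  proof (rule Suc.IH)
    show "(\<lambda>\<omega>. W \<omega> * r n \<omega>) \<in> borel_measurable (F 0)" using Suc.prems(1) r_measurable[of n] by simp
    fix \<omega> assume "\<omega> \<in> space M"
    then have "\<bar>W \<omega>\<bar> * \<bar>r n \<omega>\<bar> \<le> C * 1"
      using Suc.prems(2)[of \<omega>] r_bounds[of n \<omega>] by (intro mult_mono) auto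
    then show "\<bar>W \<omega> * r n \<omega>\<bar> \<le> C" by (simp add: abs_mult)
  qed
  finally show ?case by (simp add: mult.assoc mult.commute)
qed

end

context ssrw
begin

lemma below_before_hit:
  assumes "good \<omega>" "0 < n" "enat u < first_time (\<lambda>t. S t \<omega> = n)"
  shows "S u \<omega> < n"
proof -
  have "\<forall>w\<le>u. S w \<omega> \<noteq> n" using assms(3) by (simp add: less_first_time_iff)
  then show ?thesis
  proof (induction u)
    case 0 then show ?case using assms by (simp add: good_def)
  next
    case (Suc u)
    then have "S u \<omega> < n" "S (Suc u) \<omega> \<noteq> n" by auto
    then show ?case using good_step[OF assms(1), of u] by auto
  qed
qed

end

context drawdown
begin

text \<open>A path that is never stopped reaches every level.\<close>

lemma AE_T_finite:
  assumes "(\<lambda>n. prob (R n)) \<longlonglongrightarrow> 0"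
  shows "AE \<omega> in M. T \<omega> \<noteq> \<infinity>"
proof -
  have "prob (\<Inter>n. R n) \<le> prob (R n)" for n by (rule finite_measure_mono) auto
  then have "prob (\<Inter>n. R n) \<le> 0" by (intro LIMSEQ_le_const[OF assms]) auto
  then have "prob (\<Inter>n. R n) = 0" using measure_nonneg[of M "\<Inter>n. R n"] by linarith
  then have "AE \<omega> in M. \<omega> \<notin> (\<Inter>n. R n)" by (subst (asm) prob_eq_0) auto
  then show ?thesis using AE_good
  proof eventually_elim
    case (elim \<omega>)
    then show ?case using infinite_reaches[of \<omega>] by (auto simp: R_def good_def)
  qed
qed

lemma terminal_iff:
  assumes "good \<omega>" "T \<omega> = enat m"
  shows "\<omega> \<in> R n - R (Suc n) \<longleftrightarrow> Smax S m \<omega> = int n"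
    and "\<omega> \<in> R n - R (Suc n) \<Longrightarrow> S m \<omega> = B n \<omega>"
proof -
  have sp: "\<omega> \<in> space M" using assms by (simp add: good_def)
  show 1: "\<omega> \<in> R n - R (Suc n) \<longleftrightarrow> Smax S m \<omega> = int n"
    using R_finite_iff[OF sp assms(2), of n] R_finite_iff[OF sp assms(2), of "Suc n"] by auto
  show "\<omega> \<in> R n - R (Suc n) \<Longrightarrow> S m \<omega> = B n \<omega>"
    using S_at_T[OF assms] 1 by simp
qed

text \<open>
  The submartingale property is used for the walk stopped also at the first visit to \<open>n\<close> and on
  \<open>{B j \<ge> -J, j < n}\<close>, where it is bounded; then \<open>J \<longrightarrow> \<infinity>\<close>.
\<close>

lemma stopped_convex_le:
  fixes \<phi> :: "int \<Rightarrow> real"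
  assumes fin: "AE \<omega> in M. T \<omega> \<noteq> \<infinity>"
    and int: "integrable M (\<lambda>\<omega>. real_of_int (S (the_enat (T \<omega>)) \<omega>))"
    and convex: "\<And>x. 2 * \<phi> x \<le> \<phi> (x + 1) + \<phi> (x - 1)"
    and phi: "\<And>x. 0 \<le> \<phi> x" "\<And>x. \<phi> x \<le> \<bar>real_of_int x\<bar>"
    and tn: "t < n"
  shows "(\<integral>\<omega>. \<phi> (Y t \<omega>) \<partial>M) \<le> (\<integral>\<omega>. \<phi> (S (the_enat (T \<omega>)) \<omega>) \<partial>M) + real n * prob (R n)"
proof -
  define H where "H \<omega> = first_time (\<lambda>t. S t \<omega> = int n)" for \<omega>
  define \<theta> where "\<theta> \<omega> = min (T \<omega>) (H \<omega>)" for \<omega>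
  have n: "0 < int n" using tn by simp
  have st: "stopping_time_wrt M F \<theta>"
    unfolding stopping_time_wrt_def
  proof
    fix t
    have "{\<omega>\<in>space M. S u \<omega> = int n} \<in> sets (F t)" if "u \<le> t" for u
      using measurable_sets[OF S_adapted[OF that], of "{int n}"] by (simp add: vimage_def Int_def conj_commute)
    then have "(\<Union>u\<in>{..t}. {\<omega>\<in>space M. S u \<omega> = int n}) \<in> sets (F t)" by auto
    moreover have "{\<omega>\<in>space M. T \<omega> \<le> enat t} \<in> sets (F t)"
      using T_stopping by (simp add: stopping_time_wrt_def)
    moreover have "{\<omega>\<in>space M. \<theta> \<omega> \<le> enat t}
        = {\<omega>\<in>space M. T \<omega> \<le> enat t} \<union> (\<Union>u\<in>{..t}. {\<omega>\<in>space M. S u \<omega> = int n})"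
      by (auto simp: \<theta>_def H_def min_le_iff_disj first_time_le_iff)
    ultimately show "{\<omega>\<in>space M. \<theta> \<omega> \<le> enat t} \<in> sets (F t)" by simp
  qed
  note \<theta>m = stopping_measurable[OF st]
  have \<theta>fin: "AE \<omega> in M. \<theta> \<omega> \<noteq> \<infinity>"
    using fin by eventually_elim (metis \<theta>_def min.cobounded1 enat_ord_simps(5))
  define W where "W J = (indicator {\<omega>\<in>space M. \<forall>j\<in>{..<n}. - int J \<le> B j \<omega>} :: 'a \<Rightarrow> real)" for J
  have Wset: "{\<omega>\<in>space M. \<forall>j\<in>{..<n}. - int J \<le> B j \<omega>} \<in> sets (F 0)" for J
  proof -
    have "{\<omega>\<in>space M. - int J \<le> B j \<omega>} \<in> sets (F 0)" for j
      using measurable_sets[OF B_measurable, of "{- int J..}" j] by (simp add: vimage_def Int_def conj_commute)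
    then have "(\<Inter>j\<in>{..<n}. {\<omega>\<in>space M. - int J \<le> B j \<omega>}) \<in> sets (F 0)"
      using tn by (intro sets.finite_INT) auto
    also have "(\<Inter>j\<in>{..<n}. {\<omega>\<in>space M. - int J \<le> B j \<omega>}) = {\<omega>\<in>space M. \<forall>j\<in>{..<n}. - int J \<le> B j \<omega>}"
      using tn by auto
    finally show ?thesis .
  qed
  then have Wm: "W J \<in> borel_measurable (F 0)" for J unfolding W_def by simp
  have W01: "0 \<le> W J \<omega>" "W J \<omega> \<le> 1" for J \<omega> by (auto simp: W_def indicator_def)
  have bd: "AE \<omega> in M. \<bar>W J \<omega> * \<phi> (S (clk (\<theta> \<omega>) u) \<omega>)\<bar> \<le> real (max n J)" for J u
    using AE_good
  proof eventually_elim
    case (elim \<omega>)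
    show ?case
    proof (cases "W J \<omega> = 0")
      case False
      then have w: "W J \<omega> = 1" and Bj: "\<And>j. j < n \<Longrightarrow> - int J \<le> B j \<omega>"
        by (auto simp: W_def indicator_def split: if_splits)
      define v where "v = clk (\<theta> \<omega>) u"
      have vT: "enat v \<le> T \<omega>" and vH: "enat v \<le> H \<omega>"
        unfolding v_def \<theta>_def by (cases "T \<omega>"; cases "H \<omega>"; auto simp: clk_def min_def)+
      have lt: "S w \<omega> < int n" if "w < v" for w
      proof (rule below_before_hit[OF elim n])
        show "enat w < first_time (\<lambda>t. S t \<omega> = int n)"
          using that vH unfolding H_def by (metis enat_ord_simps(2) order_less_le_trans)
      qed
      have "S v \<omega> \<le> int n"
      proof (cases v)
        case 0 then show ?thesis using elim n by (simp add: good_def)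
      next
        case (Suc w) then show ?thesis using lt[of w] good_step[OF elim, of w] by auto
      qed
      \<comment> \<open>Before the maximum reaches \<open>n\<close> only barriers of lower levels
        are active, all at least \<open>-J\<close> here; once it reaches \<open>n\<close>, the walk
        is frozen there.\<close>
      moreover have "- int J \<le> S v \<omega> \<or> S v \<omega> = int n"
      proof (cases "Smax S v \<omega> < int n")
        case True
        have "B (nat (Smax S v \<omega>)) \<omega> \<le> S v \<omega>"
          using Y_ge[OF elim, of v] by (simp add: Y_def Ymax_def clk_before[OF vT])
        moreover have "- int J \<le> B (nat (Smax S v \<omega>)) \<omega>" using True n by (intro Bj) auto
        ultimately show ?thesis by linarith
      next
        case False
        obtain w where "w \<le> v" "Smax S v \<omega> = S w \<omega>" by (rule Smax_attained)
        then have "w = v" using lt[of w] False by force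
        then show ?thesis using \<open>S v \<omega> \<le> int n\<close> False \<open>Smax S v \<omega> = S w \<omega>\<close> by auto
      qed
      ultimately have "\<bar>S v \<omega>\<bar> \<le> int (max n J)" using n by auto
      then have "\<bar>real_of_int (S v \<omega>)\<bar> \<le> real (max n J)" by linarith
      then show ?thesis using phi[of "S v \<omega>"] w by (simp add: v_def)
    qed simp
  qed
  have Zm: "(\<lambda>\<omega>. \<phi> (S (the_enat (\<theta> \<omega>)) \<omega>)) \<in> borel_measurable M"
    by (rule measurable_compose[OF terminal_measurable[OF \<theta>m S_measurable]]) simp
  have ZTm: "(\<lambda>\<omega>. \<phi> (S (the_enat (T \<omega>)) \<omega>)) \<in> borel_measurable M"
    by (rule measurable_compose[OF terminal_measurable[OF T_measurable S_measurable]]) simp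
  have iT: "integrable M (\<lambda>\<omega>. \<phi> (S (the_enat (T \<omega>)) \<omega>))"
    by (rule Bochner_Integration.integrable_bound[OF int ZTm]) (use phi in auto)
  have dominated: "AE \<omega> in M. \<phi> (S (the_enat (\<theta> \<omega>)) \<omega>) \<le> \<phi> (S (the_enat (T \<omega>)) \<omega>) + real n * indicator (R n) \<omega>"
    using AE_good fin
  proof eventually_elim
    case (elim \<omega>)
    have sp: "\<omega> \<in> space M" using elim by (simp add: good_def)
    obtain m where m: "T \<omega> = enat m" using elim by (cases "T \<omega>") auto
    show ?case
    proof (cases "T \<omega> \<le> H \<omega>")
      case True
      then show ?thesis by (simp add: \<theta>_def min_def)
    next
      case False
      then obtain h where h: "H \<omega> = enat h" "h < m" using m by (cases "H \<omega>") auto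
      have "S h \<omega> = int n" using first_time_enat[OF h(1)[unfolded H_def]] by simp
      then have "\<omega> \<in> R n" using R_finite_iff[OF sp m] Smax_ge[of h m S \<omega>] h by simp
      moreover have "\<theta> \<omega> = enat h" using False h m by (simp add: \<theta>_def)
      ultimately show ?thesis using \<open>S h \<omega> = int n\<close> phi(2)[of "int n"] phi(1)[of "S m \<omega>"] m by simp
    qed
  qed
  have iR: "integrable M (\<lambda>\<omega>. \<phi> (S (the_enat (T \<omega>)) \<omega>) + real n * indicator (R n) \<omega>)"
  proof -
    have "integrable M (indicator (R n) :: 'a \<Rightarrow> real)" by (rule integrable_const_bound[where B=1]) auto
    then show ?thesis using iT by simp
  qed
  have iZ: "integrable M (\<lambda>\<omega>. \<phi> (S (the_enat (\<theta> \<omega>)) \<omega>))"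
  proof (rule Bochner_Integration.integrable_bound[OF iR Zm])
    show "AE \<omega> in M. norm (\<phi> (S (the_enat (\<theta> \<omega>)) \<omega>))
        \<le> norm (\<phi> (S (the_enat (T \<omega>)) \<omega>) + real n * indicator (R n) \<omega>)"
      using dominated by eventually_elim (simp add: phi(1))
  qed
  have J: "(\<integral>\<omega>. W J \<omega> * \<phi> (S (clk (\<theta> \<omega>) t) \<omega>) \<partial>M) \<le> (\<integral>\<omega>. \<phi> (S (the_enat (\<theta> \<omega>)) \<omega>) \<partial>M)" for J
  proof -
    have "(\<integral>\<omega>. W J \<omega> * \<phi> (S (clk (\<theta> \<omega>) t) \<omega>) \<partial>M) \<le> (\<integral>\<omega>. W J \<omega> * \<phi> (S (the_enat (\<theta> \<omega>)) \<omega>) \<partial>M)"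
      by (rule stopped_convex_le_terminal[OF st \<theta>fin Wm W01 convex bd])
    also have "\<dots> \<le> (\<integral>\<omega>. \<phi> (S (the_enat (\<theta> \<omega>)) \<omega>) \<partial>M)"
    proof (rule integral_mono'[OF iZ])
      fix \<omega>
      show "W J \<omega> * \<phi> (S (the_enat (\<theta> \<omega>)) \<omega>) \<le> \<phi> (S (the_enat (\<theta> \<omega>)) \<omega>)"
        using W01[of J \<omega>] phi(1) by (simp add: mult_left_le_one_le)
    qed (rule phi(1))
    finally show ?thesis .
  qed
  \<comment> \<open>As \<open>t < n\<close>, the walk cannot visit \<open>n\<close> by time
    \<open>t\<close>, so both ways of stopping agree up to \<open>t\<close>.\<close>
  have eqt: "AE \<omega> in M. S (clk (\<theta> \<omega>) t) \<omega> = Y t \<omega>"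
    using AE_good
  proof eventually_elim
    case (elim \<omega>)
    have "\<forall>u\<le>t. S u \<omega> \<noteq> int n"
    proof (intro allI impI)
      fix u assume "u \<le> t"
      moreover have "\<bar>S u \<omega>\<bar> \<le> int u" using elim by (simp add: good_def)
      ultimately show "S u \<omega> \<noteq> int n" using tn by auto
    qed
    then have "enat t < H \<omega>" by (simp add: H_def less_first_time_iff)
    then have "clk (H \<omega>) t = t" by (simp add: clk_before)
    then have "clk (\<theta> \<omega>) t = clk (T \<omega>) t" using clk_le[of "T \<omega>" t] by (simp add: \<theta>_def clk_min)
    then show ?case by (simp add: Y_def)
  qed
  have "(\<lambda>J. \<integral>\<omega>. W J \<omega> * \<phi> (S (clk (\<theta> \<omega>) t) \<omega>) \<partial>M) \<longlonglongrightarrow> (\<integral>\<omega>. \<phi> (Y t \<omega>) \<partial>M)"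
  proof (rule integral_dominated_convergence[where w="\<lambda>_. real t"])
    show "(\<lambda>\<omega>. \<phi> (Y t \<omega>)) \<in> borel_measurable M" by (rule measurable_compose[OF Y_measurable]) simp
    have "(\<lambda>\<omega>. \<phi> (S (clk (\<theta> \<omega>) t) \<omega>)) \<in> borel_measurable M"
      by (rule measurable_compose[OF clk_measurable[OF \<theta>m S_measurable]]) simp
    then show "(\<lambda>\<omega>. W J \<omega> * \<phi> (S (clk (\<theta> \<omega>) t) \<omega>)) \<in> borel_measurable M" for J
      using measurable_F_imp_M[OF Wm[of J]] by simp
    show "AE \<omega> in M. norm (W J \<omega> * \<phi> (S (clk (\<theta> \<omega>) t) \<omega>)) \<le> real t" for J
      using AE_good
    proof eventually_elim
      case (elim \<omega>)
      have "\<bar>S (clk (\<theta> \<omega>) t) \<omega>\<bar> \<le> int (clk (\<theta> \<omega>) t)" using elim by (simp add: good_def)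
      then have "\<bar>real_of_int (S (clk (\<theta> \<omega>) t) \<omega>)\<bar> \<le> real t" using clk_le[of "\<theta> \<omega>" t] by linarith
      then have "\<phi> (S (clk (\<theta> \<omega>) t) \<omega>) \<le> real t" using phi(2) order_trans by blast
      then show ?case using W01[of J \<omega>] phi(1)[of "S (clk (\<theta> \<omega>) t) \<omega>"]
        by (simp add: abs_mult mult_left_le_one_le order_trans[OF mult_left_le_one_le])
    qed
    show "AE \<omega> in M. (\<lambda>J. W J \<omega> * \<phi> (S (clk (\<theta> \<omega>) t) \<omega>)) \<longlonglongrightarrow> \<phi> (Y t \<omega>)"
      using eqt AE_space
    proof eventually_elim
      case (elim \<omega>)
      have "W J \<omega> = 1" if "Max ((\<lambda>j. nat \<bar>B j \<omega>\<bar>) ` {..<n}) \<le> J" for J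
      proof -
        have "- int J \<le> B j \<omega>" if "j < n" for j
        proof -
          have "nat \<bar>B j \<omega>\<bar> \<le> Max ((\<lambda>j. nat \<bar>B j \<omega>\<bar>) ` {..<n})" using that by (intro Max_ge) auto
          then show ?thesis using \<open>Max ((\<lambda>j. nat \<bar>B j \<omega>\<bar>) ` {..<n}) \<le> J\<close> by linarith
        qed
        then show ?thesis using elim by (simp add: W_def)
      qed
      then have "eventually (\<lambda>J. W J \<omega> * \<phi> (S (clk (\<theta> \<omega>) t) \<omega>) = \<phi> (Y t \<omega>)) sequentially"
        unfolding eventually_sequentially elim(1) by (intro exI[of _ "Max ((\<lambda>j. nat \<bar>B j \<omega>\<bar>) ` {..<n})"]) auto
      then show ?case by (rule tendsto_eventually)
    qed
  qed simp
  then have "(\<integral>\<omega>. \<phi> (Y t \<omega>) \<partial>M) \<le> (\<integral>\<omega>. \<phi> (S (the_enat (\<theta> \<omega>)) \<omega>) \<partial>M)"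
    by (rule LIMSEQ_le_const2) (use J in blast)
  also have "\<dots> \<le> (\<integral>\<omega>. \<phi> (S (the_enat (T \<omega>)) \<omega>) + real n * indicator (R n) \<omega> \<partial>M)"
    by (rule integral_mono_AE[OF iZ iR dominated])
  also have "\<dots> = (\<integral>\<omega>. \<phi> (S (the_enat (T \<omega>)) \<omega>) \<partial>M) + real n * prob (R n)"
  proof -
    have "integrable M (indicator (R n) :: 'a \<Rightarrow> real)" by (rule integrable_const_bound[where B=1]) auto
    then show ?thesis using iT by simp
  qed
  finally show ?thesis .
qed

text \<open>Sending \<open>n\<close> to infinity removes the error term, so the mean of a convex
  payoff at any time is at most its terminal mean. Applied to the excess of the modulus over
  \<open>K\<close>, this controls the tails at all times by a single integrable variable.\<close>

lemma unif_integrable_stopped: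
  assumes fin: "AE \<omega> in M. T \<omega> \<noteq> \<infinity>"
    and int: "integrable M (\<lambda>\<omega>. real_of_int (S (the_enat (T \<omega>)) \<omega>))"
    and lim: "(\<lambda>n. real n * prob (R n)) \<longlonglongrightarrow> 0"
  shows "unif_integrable M (\<lambda>t \<omega>. real_of_int (stopped S T t \<omega>))"
proof -
  have st: "stopped S T t \<omega> = Y t \<omega>" for t \<omega> by (simp add: stopped_clk Y_def)
  have Yb: "AE \<omega> in M. \<bar>Y t \<omega>\<bar> \<le> int t" for t
    using AE_S_bound
  proof eventually_elim
    case (elim \<omega>)
    then show ?case using clk_le[of "T \<omega>" t] by (auto simp: Y_def intro: order_trans[of _ "int (clk (T \<omega>) t)"])
  qed
  have iY: "integrable M (\<lambda>\<omega>. 1 * \<psi> (Y t \<omega>))" for t and \<psi> :: "int \<Rightarrow> real"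
    by (rule integrable_bounded_int_fun[where C=1 and t=t]) (use Yb in auto)
  define \<phi> where "\<phi> K x = max 0 (\<bar>real_of_int x\<bar> - real K)" for K :: nat and x :: int
  have conv: "2 * \<phi> K x \<le> \<phi> K (x + 1) + \<phi> K (x - 1)" for K x
    unfolding \<phi>_def by (simp add: max_def) linarith
  have phi: "0 \<le> \<phi> K x" "\<phi> K x \<le> \<bar>real_of_int x\<bar>" for K x by (auto simp: \<phi>_def)
  have le: "(\<integral>\<omega>. \<phi> K (Y t \<omega>) \<partial>M) \<le> (\<integral>\<omega>. \<phi> K (S (the_enat (T \<omega>)) \<omega>) \<partial>M)" for K t
  proof (rule LIMSEQ_le_const)
    show "(\<lambda>n. (\<integral>\<omega>. \<phi> K (S (the_enat (T \<omega>)) \<omega>) \<partial>M) + real n * prob (R n))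
        \<longlonglongrightarrow> (\<integral>\<omega>. \<phi> K (S (the_enat (T \<omega>)) \<omega>) \<partial>M)"
      using tendsto_add[OF tendsto_const lim] by simp
    show "\<exists>N. \<forall>n\<ge>N. (\<integral>\<omega>. \<phi> K (Y t \<omega>) \<partial>M)
        \<le> (\<integral>\<omega>. \<phi> K (S (the_enat (T \<omega>)) \<omega>) \<partial>M) + real n * prob (R n)"
      by (intro exI[of _ "Suc t"] allI impI stopped_convex_le[OF fin int conv phi]) simp
  qed
  have small: "(\<lambda>K. \<integral>\<omega>. \<phi> K (S (the_enat (T \<omega>)) \<omega>) \<partial>M) \<longlonglongrightarrow> (\<integral>\<omega>. 0 \<partial>M)"
  proof (rule integral_dominated_convergence[where w="\<lambda>\<omega>. \<bar>real_of_int (S (the_enat (T \<omega>)) \<omega>)\<bar>"])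
    show "(\<lambda>\<omega>. \<phi> K (S (the_enat (T \<omega>)) \<omega>)) \<in> borel_measurable M" for K
      by (rule measurable_compose[OF terminal_measurable[OF T_measurable S_measurable]]) simp
    show "AE \<omega> in M. (\<lambda>K. \<phi> K (S (the_enat (T \<omega>)) \<omega>)) \<longlonglongrightarrow> 0"
    proof (rule AE_I2)
      fix \<omega>
      have "eventually (\<lambda>K. \<phi> K (S (the_enat (T \<omega>)) \<omega>) = 0) sequentially"
        unfolding eventually_sequentially \<phi>_def
        by (rule exI[of _ "nat \<bar>S (the_enat (T \<omega>)) \<omega>\<bar>"]) (auto simp: max_def)
      then show "(\<lambda>K. \<phi> K (S (the_enat (T \<omega>)) \<omega>)) \<longlonglongrightarrow> 0" by (rule tendsto_eventually)
    qed
  qed (use int phi in auto)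
  show ?thesis
    unfolding unif_integrable_def st
  proof (intro conjI allI impI)
    show "integrable M (\<lambda>\<omega>. real_of_int (Y t \<omega>))" for t using iY[of real_of_int t] by simp
    fix e :: real assume "0 < e"
    then have "eventually (\<lambda>K. (\<integral>\<omega>. \<phi> K (S (the_enat (T \<omega>)) \<omega>) \<partial>M) < e / 2) sequentially"
      using order_tendstoD(2)[OF small, of "e / 2"] by simp
    then obtain K where K: "(\<integral>\<omega>. \<phi> K (S (the_enat (T \<omega>)) \<omega>) \<partial>M) < e / 2"
      by (auto simp: eventually_sequentially)
    show "\<exists>K. \<forall>t. (\<integral>\<omega>. indicator {\<omega>. K < \<bar>real_of_int (Y t \<omega>)\<bar>} \<omega> * \<bar>real_of_int (Y t \<omega>)\<bar> \<partial>M) < e"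
    proof (intro exI allI)
      fix t
      \<comment> \<open>Beyond \<open>2 * K\<close> the modulus is at most twice its excess over
        \<open>K\<close>.\<close>
      have "(\<integral>\<omega>. indicator {\<omega>. 2 * real K < \<bar>real_of_int (Y t \<omega>)\<bar>} \<omega> * \<bar>real_of_int (Y t \<omega>)\<bar> \<partial>M)
          \<le> (\<integral>\<omega>. 1 * (2 * \<phi> K (Y t \<omega>)) \<partial>M)"
        by (rule integral_mono'[OF iY]) (auto simp: indicator_def \<phi>_def)
      also have "\<dots> = 2 * (\<integral>\<omega>. \<phi> K (Y t \<omega>) \<partial>M)" by simp
      also have "\<dots> < e" using le[of K t] K by simp
      finally show "(\<integral>\<omega>. indicator {\<omega>. 2 * real K < \<bar>real_of_int (Y t \<omega>)\<bar>} \<omega> * \<bar>real_of_int (Y t \<omega>)\<bar> \<partial>M) < e" .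
    qed
  qed
qed

end

section \<open>The law of the stopped walk\<close>

lemma (in prob_space) distr_eq_measure_pmf:
  fixes X :: "'a \<Rightarrow> int"
  assumes X: "X \<in> measurable M (count_space UNIV)"
    and law: "\<And>x. prob {\<omega>\<in>space M. X \<omega> = x} = pmf \<mu> x"
  shows "distr M (count_space UNIV) X = measure_pmf \<mu>"
proof (rule measure_eqI_countable[where A=UNIV])
  fix x :: int
  have "emeasure (distr M (count_space UNIV) X) {x} = emeasure M {\<omega>\<in>space M. X \<omega> = x}"
    using X by (subst emeasure_distr) (auto simp: vimage_def Int_def conj_commute)
  also have "\<dots> = emeasure (measure_pmf \<mu>) {x}"
    using law[of x] by (simp add: emeasure_eq_measure emeasure_pmf_single)
  finally show "emeasure (distr M (count_space UNIV) X) {x} = emeasure (measure_pmf \<mu>) {x}" .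
qed auto

lemma (in prob_space) expectation_law:
  fixes X :: "'a \<Rightarrow> int" and h :: "int \<Rightarrow> real"
  assumes X: "X \<in> measurable M (count_space UNIV)"
    and law: "\<And>x. prob {\<omega>\<in>space M. X \<omega> = x} = pmf \<mu> x"
  shows "integrable M (\<lambda>\<omega>. h (X \<omega>)) \<longleftrightarrow> integrable (measure_pmf \<mu>) h"
    and "(\<integral>\<omega>. h (X \<omega>) \<partial>M) = measure_pmf.expectation \<mu> h"
proof -
  show "integrable M (\<lambda>\<omega>. h (X \<omega>)) \<longleftrightarrow> integrable (measure_pmf \<mu>) h"
    using integrable_distr_eq[OF X, of h] distr_eq_measure_pmf[OF assms] by simp
  show "(\<integral>\<omega>. h (X \<omega>) \<partial>M) = measure_pmf.expectation \<mu> h"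
    using integral_distr[OF X, of h] distr_eq_measure_pmf[OF assms] by simp
qed

locale azema_yor = prob_space M + centred_pmf \<mu> for M :: "'a measure" and \<mu> +
  fixes S :: "nat \<Rightarrow> 'a \<Rightarrow> int" and \<eta> :: "nat \<Rightarrow> nat \<Rightarrow> 'a \<Rightarrow> bool"
  assumes walk: "ssrw_wrt M (nat_filt M S) S"
    and eta_indep: "indep_vars (\<lambda>_. count_space UNIV) (\<lambda>(n, k). \<eta> n k) (AYidx \<mu>)"
    and walk_eta_indep: "indep_set
           {(\<lambda>\<omega> t. S t \<omega>) -` A \<inter> space M | A. A \<in> sets (Pi\<^sub>M UNIV (\<lambda>_. count_space UNIV))}
           {(\<lambda>\<omega>. \<lambda>i\<in>AYidx \<mu>. \<eta> (fst i) (snd i) \<omega>) -` B \<inter> space M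
              | B. B \<in> sets (Pi\<^sub>M (AYidx \<mu>) (\<lambda>_. count_space UNIV))}"
    and eta_law: "\<forall>(n, k)\<in>AYidx \<mu>. prob {\<omega>\<in>space M. \<eta> n k \<omega> = False} = rho \<mu> n k"
begin

interpretation W: ssrw M "nat_filt M S" S
  by unfold_locales (rule walk)

section \<open>Initial enlargement of the filtration by the coins\<close>

definition eta_vec :: "'a \<Rightarrow> nat \<times> nat \<Rightarrow> bool" where
  "eta_vec \<omega> = (\<lambda>i\<in>AYidx \<mu>. \<eta> (fst i) (snd i) \<omega>)"

definition VE :: "'a measure" where
  "VE = vimage_algebra (space M) eta_vec (Pi\<^sub>M (AYidx \<mu>) (\<lambda>_. count_space UNIV))"

definition VS :: "'a measure" where
  "VS = vimage_algebra (space M) (\<lambda>\<omega> t. S t \<omega>) (Pi\<^sub>M UNIV (\<lambda>_. count_space UNIV))"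

text \<open>Generated by intersections rather than by a union: they form an intersection-stable
  family, from which independence passes to the generated \<sigma>-algebra.\<close>

definition G :: "nat \<Rightarrow> 'a measure" where
  "G t = sigma (space M) {A \<inter> E |A E. A \<in> sets (nat_filt M S t) \<and> E \<in> sets VE}"

lemma eta_vec_space: "eta_vec \<in> space M \<rightarrow> space (Pi\<^sub>M (AYidx \<mu>) (\<lambda>_. count_space UNIV))"
  by (auto simp: eta_vec_def space_PiM)

lemma space_VE [simp]: "space VE = space M" and space_VS [simp]: "space VS = space M"
  by (auto simp: VE_def VS_def)

lemma indep_VS_VE: "indep_set (sets VS) (sets VE)"
proof -
  have "sets VS = {(\<lambda>\<omega> t. S t \<omega>) -` A \<inter> space M | A. A \<in> sets (Pi\<^sub>M UNIV (\<lambda>_. count_space UNIV))}"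
    unfolding VS_def by (rule sets_vimage_algebra2) (simp add: space_PiM)
  moreover have "sets VE = {(\<lambda>\<omega>. \<lambda>i\<in>AYidx \<mu>. \<eta> (fst i) (snd i) \<omega>) -` B \<inter> space M
              | B. B \<in> sets (Pi\<^sub>M (AYidx \<mu>) (\<lambda>_. count_space UNIV))}"
    unfolding VE_def using sets_vimage_algebra2[OF eta_vec_space] by (simp add: eta_vec_def[abs_def])
  ultimately show ?thesis using walk_eta_indep by simp
qed

lemma VE_subset: "sets VE \<subseteq> events" using indep_setD_ev2[OF indep_VS_VE] .

lemma S_VS: "S u \<in> measurable VS (count_space UNIV)"
proof -
  have "(\<lambda>\<omega> t. S t \<omega>) \<in> measurable VS (Pi\<^sub>M UNIV (\<lambda>_. count_space UNIV))"
    unfolding VS_def by (rule measurable_vimage_algebra1) (simp add: space_PiM)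
  from measurable_compose[OF this measurable_component_singleton[of u]] show ?thesis by simp
qed

lemma nat_filt_sets: "sets (nat_filt M S t) = sigma_sets (space M) {S u -` A \<inter> space M |u A. u \<le> t}"
  unfolding nat_filt_def by (rule sets_measure_of) auto

lemma nat_filt_VS: "sets (nat_filt M S t) \<subseteq> sets VS"
proof -
  have "{S u -` A \<inter> space M |u A. u \<le> t} \<subseteq> sets VS" using measurable_sets[OF S_VS] by auto
  then show ?thesis unfolding nat_filt_sets using sets.sigma_sets_subset[of _ VS] by simp
qed

lemma nat_filt_M: "sets (nat_filt M S t) \<subseteq> events"
  using W.F_subalgebra by (simp add: subalgebra_def)

lemma G_gen: "{A \<inter> E |A E. A \<in> sets (nat_filt M S t) \<and> E \<in> sets VE} \<subseteq> events"
  using nat_filt_M VE_subset by blast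

lemma G_sets: "sets (G t) = sigma_sets (space M) {A \<inter> E |A E. A \<in> sets (nat_filt M S t) \<and> E \<in> sets VE}"
  unfolding G_def using G_gen[of t] sets.space_closed by (intro sets_measure_of) blast

lemma nat_filt_G: "sets (nat_filt M S t) \<subseteq> sets (G t)"
proof
  fix A assume "A \<in> sets (nat_filt M S t)"
  moreover have "A = A \<inter> space M" using sets.sets_into_space[OF \<open>A \<in> sets (nat_filt M S t)\<close>] by auto
  moreover have "space M \<in> sets VE" using sets.top[of VE] by simp
  ultimately show "A \<in> sets (G t)" unfolding G_sets by (intro sigma_sets.Basic) blast
qed

lemma VE_G: "sets VE \<subseteq> sets (G t)"
proof
  fix E assume "E \<in> sets VE"
  moreover have "E = space M \<inter> E" using sets.sets_into_space[OF \<open>E \<in> sets VE\<close>] by auto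
  moreover have "space M \<in> sets (nat_filt M S t)" using sets.top[of "nat_filt M S t"] by simp
  ultimately show "E \<in> sets (G t)" unfolding G_sets by (intro sigma_sets.Basic) blast
qed

lemma space_G [simp]: "space (G t) = space M"
  unfolding G_def using G_gen[of t] sets.space_closed by (intro space_measure_of) blast

text \<open>The independence of the next step is what is at stake. For \<open>A\<close> from the
  past of the walk, \<open>E\<close> from the coins and an event \<open>D\<close> of the next step,
  \<open>E\<close> splits off because \<open>A \<inter> D\<close> belongs to the walk, and
  \<open>A\<close> and \<open>D\<close> separate by the property of the walk in its own
  filtration.\<close>

lemma enlarged_walk: "ssrw_wrt M G S"
  unfolding ssrw_wrt_def
proof (intro conjI allI ballI)
  show "is_filtration M G"
    unfolding is_filtration_def
  proof (intro conjI allI impI)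
    show "subalgebra M (G t)" for t
      unfolding subalgebra_def G_sets using sets.sigma_sets_subset[OF G_gen] by simp
    fix s t :: nat assume "s \<le> t"
    then have "sets (nat_filt M S s) \<subseteq> sets (nat_filt M S t)"
      using W.F_mono by (simp add: subalgebra_def)
    then show "sets (G s) \<subseteq> sets (G t)" unfolding G_sets by (intro sigma_sets_mono') blast
  qed
  show "S 0 \<omega> = 0" if "\<omega> \<in> space M" for \<omega> by (rule W.S_0[OF that])
  show "S t \<in> measurable (G t) (count_space UNIV)" for t
    using measurable_from_subalg[OF _ W.S_adapted[of t t]] nat_filt_G by (simp add: subalgebra_def)
  show "prob {\<omega>\<in>space M. S (Suc t) \<omega> - S t \<omega> = 1} = 1/2"
    "prob {\<omega>\<in>space M. S (Suc t) \<omega> - S t \<omega> = -1} = 1/2" for t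
    using walk unfolding ssrw_wrt_def by blast+
  fix t A B assume A: "A \<in> sets (G t)"
  define D where "D = {\<omega>\<in>space M. S (Suc t) \<omega> - S t \<omega> \<in> B}"
  have DVS: "D \<in> sets VS"
    using measurable_sets[OF measurable_count_space_op2[OF S_VS[of "Suc t"] S_VS[of t], of "(-)"], of B]
    by (simp add: D_def vimage_def Int_def conj_commute)
  have DM: "D \<in> events" using DVS indep_setD_ev1[OF indep_VS_VE] by blast
  have "indep_set {A \<inter> E |A E. A \<in> sets (nat_filt M S t) \<and> E \<in> sets VE} {D}"
  proof (rule indep_setI)
    fix a b assume "a \<in> {A \<inter> E |A E. A \<in> sets (nat_filt M S t) \<and> E \<in> sets VE}" "b \<in> {D}"
    then obtain A E where AE: "a = A \<inter> E" "A \<in> sets (nat_filt M S t)" "E \<in> sets VE" and b: "b = D" by blast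
    have AVS: "A \<in> sets VS" using AE nat_filt_VS by blast
    have "prob ((A \<inter> D) \<inter> E) = prob (A \<inter> D) * prob E"
      using indep_setD[OF indep_VS_VE _ AE(3)] AVS DVS by blast
    moreover have "prob (A \<inter> D) = prob A * prob D"
      using walk AE(2) unfolding ssrw_wrt_def D_def by blast
    moreover have "prob (A \<inter> E) = prob A * prob E" using indep_setD[OF indep_VS_VE AVS AE(3)] .
    moreover have "a \<inter> b = (A \<inter> D) \<inter> E" using AE b by blast
    ultimately show "prob (a \<inter> b) = prob a * prob b" using AE(1) b by simp
  qed (use G_gen DM in auto)
  then have "indep_set (sigma_sets (space M) {A \<inter> E |A E. A \<in> sets (nat_filt M S t) \<and> E \<in> sets VE})
      (sigma_sets (space M) {D})"
  proof (rule indep_set_sigma_sets)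
    show "Int_stable {A \<inter> E |A E. A \<in> sets (nat_filt M S t) \<and> E \<in> sets VE}"
    proof (rule Int_stableI)
      fix a b assume "a \<in> {A \<inter> E |A E. A \<in> sets (nat_filt M S t) \<and> E \<in> sets VE}"
        "b \<in> {A \<inter> E |A E. A \<in> sets (nat_filt M S t) \<and> E \<in> sets VE}"
      then obtain A E A' E' where "a = A \<inter> E" "A \<in> sets (nat_filt M S t)" "E \<in> sets VE"
        "b = A' \<inter> E'" "A' \<in> sets (nat_filt M S t)" "E' \<in> sets VE" by blast
      then have "a \<inter> b = (A \<inter> A') \<inter> (E \<inter> E')" "A \<inter> A' \<in> sets (nat_filt M S t)" "E \<inter> E' \<in> sets VE" by auto
      then show "a \<inter> b \<in> {A \<inter> E |A E. A \<in> sets (nat_filt M S t) \<and> E \<in> sets VE}" by blast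
    qed
  qed (simp add: Int_stable_def)
  from indep_setD[OF this A[unfolded G_sets], of D]
  show "prob (A \<inter> {\<omega>\<in>space M. S (Suc t) \<omega> - S t \<omega> \<in> B}) = prob A * prob {\<omega>\<in>space M. S (Suc t) \<omega> - S t \<omega> \<in> B}"
    by (auto simp: D_def)
qed

text \<open>
  The \<open>min\<close> only matters for \<open>n = 0\<close> when the support ends at \<open>1\<close>: then \<open>Xset \<mu> 0\<close> contains \<open>1\<close>, which is
  selected with probability zero.
\<close>

definition bfun :: "nat \<Rightarrow> (nat \<times> nat \<Rightarrow> bool) \<Rightarrow> int" where
  "bfun n f = (if 0 < tail (int n + 1) \<and> (\<exists>k. (n, k) \<in> AYidx \<mu> \<and> \<not> f (n, k))
     then min (int n) (xk \<mu> n (LEAST k. (n, k) \<in> AYidx \<mu> \<and> \<not> f (n, k))) else int n)"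

lemma bfun_measurable:
  assumes "\<And>k. (n, k) \<in> AYidx \<mu> \<Longrightarrow> (n, k) \<in> K"
  shows "bfun n \<in> measurable (Pi\<^sub>M K (\<lambda>_. count_space UNIV)) (count_space UNIV)"
proof -
  have [measurable]: "(\<lambda>f. (n, k) \<in> AYidx \<mu> \<and> \<not> f (n, k)) \<in> measurable (Pi\<^sub>M K (\<lambda>_. count_space UNIV)) (count_space UNIV)" for k
  proof (cases "(n, k) \<in> AYidx \<mu>")
    case True
    then have "(\<lambda>f. f (n, k)) \<in> measurable (Pi\<^sub>M K (\<lambda>_. count_space UNIV)) (count_space (UNIV :: bool set))"
      using assms by (intro measurable_component_singleton) auto
    then show ?thesis using True by simp
  qed simp
  show ?thesis unfolding bfun_def by measurable
qed

definition B :: "nat \<Rightarrow> 'a \<Rightarrow> int" where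
  "B n \<omega> = bfun n (\<lambda>(n, k). \<eta> n k \<omega>)"

lemma bfun_cong:
  assumes "\<And>k. (n, k) \<in> AYidx \<mu> \<Longrightarrow> f (n, k) = g (n, k)" shows "bfun n f = bfun n g"
proof -
  have "(n, k) \<in> AYidx \<mu> \<and> \<not> f (n, k) \<longleftrightarrow> (n, k) \<in> AYidx \<mu> \<and> \<not> g (n, k)" for k
    using assms by auto
  then show ?thesis unfolding bfun_def by (simp only:)
qed

lemma B_VE: "B n \<in> measurable VE (count_space UNIV)"
proof -
  have "eta_vec \<in> measurable VE (Pi\<^sub>M (AYidx \<mu>) (\<lambda>_. count_space UNIV))"
    unfolding VE_def by (rule measurable_vimage_algebra1[OF eta_vec_space])
  from measurable_compose[OF this bfun_measurable[of n]]
  have "(\<lambda>\<omega>. bfun n (eta_vec \<omega>)) \<in> measurable VE (count_space UNIV)" by simp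
  moreover have "bfun n (eta_vec \<omega>) = B n \<omega>" for \<omega>
    unfolding B_def by (rule bfun_cong) (simp add: eta_vec_def)
  ultimately show ?thesis by simp
qed

lemma B_bound: "B n \<omega> \<le> int n" by (simp add: B_def bfun_def)

sublocale D: drawdown M G S B
proof unfold_locales
  show "ssrw_wrt M G S" by (rule enlarged_walk)
  show "B n \<in> measurable (G 0) (count_space UNIV)" for n
    using measurable_from_subalg[OF _ B_VE[of n]] VE_G by (simp add: subalgebra_def)
qed (rule B_bound)

section \<open>Independence and law of the barriers\<close>

lemma B_indep: "indep_vars (\<lambda>_. count_space UNIV) B UNIV"
proof -
  define K where "K n = {i\<in>AYidx \<mu>. fst i = n}" for n
  have "indep_vars (\<lambda>j. Pi\<^sub>M (K j) (\<lambda>_. count_space UNIV))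
      (\<lambda>j \<omega>. restrict (\<lambda>i. (\<lambda>(n, k). \<eta> n k) i \<omega>) (K j)) UNIV"
    by (rule indep_vars_restrict[OF eta_indep]) (auto simp: K_def disjoint_family_on_def)
  from indep_vars_compose2[OF this, of bfun "\<lambda>_. count_space UNIV"]
  have "indep_vars (\<lambda>_. count_space UNIV) (\<lambda>j \<omega>. bfun j (restrict (\<lambda>i. (\<lambda>(n, k). \<eta> n k) i \<omega>) (K j))) UNIV"
    using bfun_measurable by (auto simp: K_def)
  moreover have "bfun j (restrict (\<lambda>i. (\<lambda>(n, k). \<eta> n k) i \<omega>) (K j)) = B j \<omega>" for j \<omega>
    unfolding B_def by (rule bfun_cong) (simp add: K_def)
  ultimately show ?thesis by simp
qed

lemma B_measurable_M [measurable]: "B n \<in> measurable M (count_space UNIV)"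
  using B_indep by (simp add: indep_vars_def)

lemma eta_measurable: "(n, k) \<in> AYidx \<mu> \<Longrightarrow> \<eta> n k \<in> measurable M (count_space UNIV)"
  using eta_indep by (auto simp: indep_vars_def)

lemma all_eta_prob:
  assumes idx: "\<And>k. 1 \<le> k \<Longrightarrow> k \<le> K \<Longrightarrow> (n, k) \<in> AYidx \<mu>"
  shows "{\<omega>\<in>space M. \<forall>k\<in>{1..K}. \<eta> n k \<omega>} \<in> events"
    and "prob {\<omega>\<in>space M. \<forall>k\<in>{1..K}. \<eta> n k \<omega>} = (\<Prod>k\<in>{1..K}. 1 - rho \<mu> n k)"
proof -
  have ev: "{\<omega>\<in>space M. \<eta> n k \<omega>} \<in> events" if "(n, k) \<in> AYidx \<mu>" for k
    using measurable_sets[OF eta_measurable[OF that], of "{True}"] by (simp add: vimage_def Int_def conj_commute)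
  have eq: "{\<omega>\<in>space M. \<forall>k\<in>{1..K}. \<eta> n k \<omega>} = (\<Inter>k\<in>{1..K}. {\<omega>\<in>space M. \<eta> n k \<omega>}) \<inter> space M" by auto
  show "{\<omega>\<in>space M. \<forall>k\<in>{1..K}. \<eta> n k \<omega>} \<in> events"
  proof (cases "K = 0")
    case False
    then show ?thesis unfolding eq by (intro sets.Int sets.finite_INT ev idx) auto
  qed simp
  have p1: "prob {\<omega>\<in>space M. \<eta> n k \<omega>} = 1 - rho \<mu> n k" if "(n, k) \<in> AYidx \<mu>" for k
  proof -
    have "prob {\<omega>\<in>space M. \<eta> n k \<omega> = False} = 1 - prob {\<omega>\<in>space M. \<eta> n k \<omega>}"
      using prob_neg[OF ev[OF that]] by simp
    then show ?thesis using eta_law that by auto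
  qed
  show "prob {\<omega>\<in>space M. \<forall>k\<in>{1..K}. \<eta> n k \<omega>} = (\<Prod>k\<in>{1..K}. 1 - rho \<mu> n k)"
  proof (cases "K = 0")
    case True then show ?thesis by (simp add: prob_space)
  next
    case False
    define J where "J = Pair n ` {1..K}"
    have "prob (\<Inter>i\<in>J. (\<lambda>(n, k). \<eta> n k) i -` {True} \<inter> space M)
        = (\<Prod>i\<in>J. prob ((\<lambda>(n, k). \<eta> n k) i -` {True} \<inter> space M))"
      by (rule indep_varsD[OF eta_indep]) (use False idx in \<open>auto simp: J_def\<close>)
    moreover have "(\<Inter>i\<in>J. (\<lambda>(n, k). \<eta> n k) i -` {True} \<inter> space M) = {\<omega>\<in>space M. \<forall>k\<in>{1..K}. \<eta> n k \<omega>}"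
      using False by (auto simp: J_def)
    moreover have "(\<Prod>i\<in>J. prob ((\<lambda>(n, k). \<eta> n k) i -` {True} \<inter> space M)) = (\<Prod>k\<in>{1..K}. 1 - rho \<mu> n k)"
      unfolding J_def
    proof (subst prod.reindex)
      show "inj_on (Pair n) {1..K}" by (auto simp: inj_on_def)
      show "prod ((\<lambda>i. prob ((\<lambda>(n, k). \<eta> n k) i -` {True} \<inter> space M)) \<circ> Pair n) {1..K}
          = (\<Prod>k\<in>{1..K}. 1 - rho \<mu> n k)"
        using p1 idx by (intro prod.cong) (auto simp: vimage_def Int_def conj_commute)
    qed
    ultimately show ?thesis by simp
  qed
qed

text \<open>In an infinite list all coins might show 1. The probability that those at levels down to
  \<open>-i\<close> do so is \<open>drawdown_cdf n (- i)\<close>, which tends to 0.\<close>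

lemma AE_ex_eta:
  assumes pos: "0 < tail (int n + 1)"
  shows "AE \<omega> in M. \<exists>k. (n, k) \<in> AYidx \<mu> \<and> \<not> \<eta> n k \<omega>"
proof -
  define Q where "Q i = {\<omega>\<in>space M. \<forall>k\<in>{1..ncount n (- int i)}. \<eta> n k \<omega>}" for i
  have idx: "(n, k) \<in> AYidx \<mu>" if "1 \<le> k" "k \<le> ncount n (- int i)" for k i
    by (rule ncount_AYidx[OF pos that])
  have Q: "Q i \<in> events" "prob (Q i) = drawdown_cdf n (- int i)" for i
    using all_eta_prob[where n=n and K="ncount n (- int i)", OF idx] prod_rho_ncount[OF pos, of "- int i"] by (auto simp: Q_def)
  have "prob (\<Inter>i. Q i) \<le> prob (Q i)" for i using Q by (intro finite_measure_mono) auto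
  then have "prob (\<Inter>i. Q i) \<le> 0"
    by (intro LIMSEQ_le_const[OF drawdown_cdf_tendsto[OF pos]]) (auto simp: Q(2))
  then have "prob (\<Inter>i. Q i) = 0" using measure_nonneg[of M "\<Inter>i. Q i"] by linarith
  moreover have "(\<Inter>i. Q i) \<in> events" using Q(1) by auto
  ultimately have "AE \<omega> in M. \<omega> \<notin> (\<Inter>i. Q i)" by (subst (asm) prob_eq_0) auto
  then show ?thesis using AE_space
  proof eventually_elim
    case (elim \<omega>)
    then obtain i where "\<omega> \<notin> Q i" by auto
    then obtain k where "1 \<le> k" "k \<le> ncount n (- int i)" "\<not> \<eta> n k \<omega>"
      using elim(2) by (auto simp: Q_def)
    then show ?case using idx by blast
  qed
qed

text \<open>The barrier is the level of the first zero coin, so it lies below \<open>x\<close> iff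
  the coins of all levels at or above \<open>x\<close> show 1.\<close>

lemma B_cdf:
  assumes pos: "0 < tail (int n + 1)" and x: "x \<le> int n"
  shows "prob {\<omega>\<in>space M. B n \<omega> < x} = drawdown_cdf n x"
proof -
  have idx: "(n, k) \<in> AYidx \<mu>" if "1 \<le> k" "k \<le> ncount n x" for k by (rule ncount_AYidx[OF pos that])
  have "prob {\<omega>\<in>space M. B n \<omega> < x} = prob {\<omega>\<in>space M. \<forall>k\<in>{1..ncount n x}. \<eta> n k \<omega>}"
  proof (rule finite_measure_eq_AE)
    show "AE \<omega> in M. \<omega> \<in> {\<omega>\<in>space M. B n \<omega> < x} \<longleftrightarrow> \<omega> \<in> {\<omega>\<in>space M. \<forall>k\<in>{1..ncount n x}. \<eta> n k \<omega>}"
      using AE_ex_eta[OF pos] AE_space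
    proof eventually_elim
      case (elim \<omega>)
      define P where "P k \<longleftrightarrow> (n, k) \<in> AYidx \<mu> \<and> \<not> \<eta> n k \<omega>" for k
      define k0 where "k0 = (LEAST k. P k)"
      have Pex: "\<exists>k. P k" using elim(1) by (simp add: P_def)
      have Pk0: "P k0" unfolding k0_def using Pex by (rule LeastI_ex)
      have min: "\<not> P k" if "k < k0" for k using that not_less_Least unfolding k0_def by blast
      have "B n \<omega> = min (int n) (xk \<mu> n k0)"
        using pos Pex unfolding B_def bfun_def k0_def P_def by simp
      then have "B n \<omega> < x \<longleftrightarrow> \<not> x \<le> xk \<mu> n k0" using x by auto
      also have "\<dots> \<longleftrightarrow> ncount n x < k0" using xk_ge_iff[OF pos, of k0 x] Pk0 by (simp add: P_def not_le)
      also have "\<dots> \<longleftrightarrow> (\<forall>k\<in>{1..ncount n x}. \<eta> n k \<omega>)"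
      proof
        assume "ncount n x < k0"
        then show "\<forall>k\<in>{1..ncount n x}. \<eta> n k \<omega>" using min idx by (auto simp: P_def)
      next
        assume "\<forall>k\<in>{1..ncount n x}. \<eta> n k \<omega>"
        moreover have "1 \<le> k0" using Pk0 by (auto simp: P_def AYidx_def)
        ultimately show "ncount n x < k0" using Pk0 by (auto simp: P_def not_le[symmetric])
      qed
      finally show ?case using elim by simp
    qed
    show "{\<omega>\<in>space M. B n \<omega> < x} \<in> events" by measurable
    show "{\<omega>\<in>space M. \<forall>k\<in>{1..ncount n x}. \<eta> n k \<omega>} \<in> events" by (rule all_eta_prob(1)[OF idx])
  qed
  also have "\<dots> = drawdown_cdf n x" using all_eta_prob(2)[OF idx] prod_rho_ncount[OF pos x] by simp
  finally show ?thesis .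
qed

text \<open>The balance relations for \<open>strip\<close>, now with the actual law of the barrier.
  The factor \<open>reach_prob n\<close> stays on the left because it is 0 above the top of the
  support.\<close>

lemma B_law:
  assumes x: "x \<le> int n"
  shows "reach_prob n * prob {\<omega>\<in>space M. B n \<omega> = x}
    = (real n + 1 - real_of_int x) * (strip n x - strip n (x + 1))"
proof (cases "0 < tail (int n + 1)")
  case True
  have c: "prob {\<omega>\<in>space M. B n \<omega> < y} = drawdown_cdf n y" if "y \<le> int n + 1" for y
  proof (cases "y \<le> int n")
    case False
    then have "B n \<omega> < y" for \<omega> using B_bound[of n \<omega>] by linarith
    then have "{\<omega>\<in>space M. B n \<omega> < y} = space M" by simp
    then show ?thesis using False by (simp add: drawdown_cdf_def prob_space)
  qed (rule B_cdf[OF True])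
  have "{\<omega>\<in>space M. B n \<omega> = x} = {\<omega>\<in>space M. B n \<omega> < x + 1} - {\<omega>\<in>space M. B n \<omega> < x}" by auto
  moreover have "prob ({\<omega>\<in>space M. B n \<omega> < x + 1} - {\<omega>\<in>space M. B n \<omega> < x})
      = prob {\<omega>\<in>space M. B n \<omega> < x + 1} - prob {\<omega>\<in>space M. B n \<omega> < x}"
    by (rule finite_measure_Diff) (measurable, auto)
  ultimately show ?thesis using c[of x] c[of "x + 1"] x strip_diff_inside[OF True x] by simp
next
  case False
  then have z: "tail (int n + 1) = 0" using tail_nonneg[of "int n + 1"] by linarith
  have "B n \<omega> = int n" for \<omega> using False by (simp add: B_def bfun_def)
  then show ?thesis using strip_diff_beyond[OF z x] by (cases "x = int n") (auto simp: prob_space)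
qed

section \<open>Where the walk ends, level by level\<close>

lemma expectation_reach:
  fixes h :: "int \<Rightarrow> real"
  assumes h: "\<And>b. \<bar>h b\<bar> \<le> 1"
  shows "(\<integral>\<omega>. h (B n \<omega>) * indicator (D.R n) \<omega> \<partial>M) = (\<integral>\<omega>. h (B n \<omega>) \<partial>M) * (\<Prod>j<n. \<integral>\<omega>. D.r j \<omega> \<partial>M)"
proof -
  \<comment> \<open>Packs the ruin factors for \<open>j < n\<close> and \<open>h\<close> at index
    \<open>n\<close> into one family, so that independence of the barriers factorises all of them at
    once.\<close>
  define f :: "nat \<Rightarrow> int \<Rightarrow> real" where
    "f j b = (if j = n then h b else (real j - real_of_int b) / (real j + 1 - real_of_int b))" for j b
  have fr: "f j (B j \<omega>) = D.r j \<omega>" if "j < n" for j \<omega> using that by (simp add: f_def D.r_def)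
  have fn: "f n b = h b" for b by (simp add: f_def)
  have Wm: "(\<lambda>\<omega>. h (B n \<omega>)) \<in> borel_measurable (G 0)"
    by (rule measurable_compose[OF D.B_measurable]) simp
  have ind: "indep_vars (\<lambda>_. borel) (\<lambda>j \<omega>. f j (B j \<omega>)) {..<Suc n}"
    by (rule indep_vars_compose2[OF indep_vars_subset[OF B_indep]]) auto
  have "integrable M (\<lambda>\<omega>. f j (B j \<omega>))" if "j < Suc n" for j
  proof (rule integrable_const_bound[where B=1])
    show "(\<lambda>\<omega>. f j (B j \<omega>)) \<in> borel_measurable M" by (rule measurable_compose[OF B_measurable_M]) simp
    show "AE \<omega> in M. norm (f j (B j \<omega>)) \<le> 1"
      using h fn D.r_bounds fr that by (intro AE_I2) (cases "j = n"; auto)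
  qed
  then have "(\<integral>\<omega>. (\<Prod>j\<in>{..<Suc n}. f j (B j \<omega>)) \<partial>M) = (\<Prod>j\<in>{..<Suc n}. \<integral>\<omega>. f j (B j \<omega>) \<partial>M)"
    by (intro indep_vars_lebesgue_integral ind) auto
  then have "(\<integral>\<omega>. (\<Prod>j<n. D.r j \<omega>) * h (B n \<omega>) \<partial>M) = (\<Prod>j<n. \<integral>\<omega>. D.r j \<omega> \<partial>M) * (\<integral>\<omega>. h (B n \<omega>) \<partial>M)"
    by (simp add: fr fn)
  moreover have "(\<integral>\<omega>. h (B n \<omega>) * indicator (D.R n) \<omega> \<partial>M) = (\<integral>\<omega>. h (B n \<omega>) * (\<Prod>j<n. D.r j \<omega>) \<partial>M)"
    by (rule D.reach_product[OF Wm]) (rule h)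
  ultimately show ?thesis by (simp add: mult.commute)
qed

text \<open>The chance of reaching \<open>n\<close> given all barriers depends on those of lower
  levels only, and these are independent of \<open>B n\<close>.\<close>

lemma prob_eq_Int_reach:
  "prob ({\<omega>\<in>space M. B n \<omega> = x} \<inter> D.R n) = prob {\<omega>\<in>space M. B n \<omega> = x} * prob (D.R n)"
proof -
  have "prob (D.R n) = (\<integral>\<omega>. 1 * indicator (D.R n) \<omega> \<partial>M)" by simp
  also have "\<dots> = (\<integral>\<omega>. 1 \<partial>M) * (\<Prod>j<n. \<integral>\<omega>. D.r j \<omega> \<partial>M)"
    using expectation_reach[of "\<lambda>_. 1" n] by simp
  finally have R: "prob (D.R n) = (\<Prod>j<n. \<integral>\<omega>. D.r j \<omega> \<partial>M)" by (simp add: prob_space)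
  have ev [measurable]: "{\<omega>\<in>space M. B n \<omega> = x} \<in> events" by measurable
  have "prob ({\<omega>\<in>space M. B n \<omega> = x} \<inter> D.R n)
      = (\<integral>\<omega>. indicator ({\<omega>\<in>space M. B n \<omega> = x} \<inter> D.R n) \<omega> \<partial>M)" by simp
  also have "\<dots> = (\<integral>\<omega>. indicator {x} (B n \<omega>) * indicator (D.R n) \<omega> \<partial>M)"
    by (rule Bochner_Integration.integral_cong) (auto simp: indicator_def)
  also have "\<dots> = (\<integral>\<omega>. indicator {x} (B n \<omega>) \<partial>M) * (\<Prod>j<n. \<integral>\<omega>. D.r j \<omega> \<partial>M)"
    by (rule expectation_reach) (simp add: indicator_def)
  also have "(\<integral>\<omega>. indicator {x} (B n \<omega>) \<partial>M) = (\<integral>\<omega>. indicator {\<omega>\<in>space M. B n \<omega> = x} \<omega> \<partial>M)"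
    by (rule Bochner_Integration.integral_cong) (auto simp: indicator_def)
  also have "\<dots> = prob {\<omega>\<in>space M. B n \<omega> = x}" by simp
  finally show ?thesis by (simp add: R)
qed

lemma prob_eq_Int_reach_Suc:
  "prob ({\<omega>\<in>space M. B n \<omega> = x} \<inter> D.R (Suc n))
    = (real n - real_of_int x) / (real n + 1 - real_of_int x) * prob ({\<omega>\<in>space M. B n \<omega> = x} \<inter> D.R n)"
proof -
  have ev [measurable]: "{\<omega>\<in>space M. B n \<omega> = x} \<in> events" by measurable
  have "(\<lambda>\<omega>. indicator {x} (B n \<omega>) :: real) \<in> borel_measurable (G 0)"
    by (rule measurable_compose[OF D.B_measurable]) simp
  from D.reach_step[OF this, of 1 n]
  have "(\<integral>\<omega>. (indicator {x} (B n \<omega>) * indicator (D.R (Suc n)) \<omega> :: real) \<partial>M)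
      = (\<integral>\<omega>. indicator {x} (B n \<omega>) * D.r n \<omega> * indicator (D.R n) \<omega> \<partial>M)"
    by (simp add: indicator_def)
  also have "(\<integral>\<omega>. (indicator {x} (B n \<omega>) * indicator (D.R (Suc n)) \<omega> :: real) \<partial>M)
      = (\<integral>\<omega>. indicator ({\<omega>\<in>space M. B n \<omega> = x} \<inter> D.R (Suc n)) \<omega> \<partial>M)"
    by (rule Bochner_Integration.integral_cong) (auto simp: indicator_def)
  also have "(\<integral>\<omega>. indicator {x} (B n \<omega>) * D.r n \<omega> * indicator (D.R n) \<omega> \<partial>M)
      = (\<integral>\<omega>. (real n - real_of_int x) / (real n + 1 - real_of_int x)
          * indicator ({\<omega>\<in>space M. B n \<omega> = x} \<inter> D.R n) \<omega> \<partial>M)"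
    by (rule Bochner_Integration.integral_cong) (auto simp: indicator_def D.r_def)
  finally show ?thesis by simp
qed

text \<open>Gambler's ruin leaves the fraction \<open>1 / (n + 1 - x)\<close> at \<open>x\<close>,
  which cancels the factor in \<open>B_law\<close>. The value of \<open>prob (D.R n)\<close> is a
  hypothesis because it comes from the induction in \<open>prob_R\<close>, which relies on this
  lemma.\<close>

lemma exit_at:
  assumes "prob (D.R n) = reach_prob n" "x \<le> int n"
  shows "prob ({\<omega>\<in>space M. B n \<omega> = x} \<inter> (D.R n - D.R (Suc n))) = strip n x - strip n (x + 1)"
proof -
  let ?E = "{\<omega>\<in>space M. B n \<omega> = x}"
  have ev [measurable]: "?E \<in> events" by measurable
  have d: "0 < real n + 1 - real_of_int x" using assms(2) by linarith
  have "?E \<inter> (D.R n - D.R (Suc n)) = ?E \<inter> D.R n - ?E \<inter> D.R (Suc n)" by auto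
  then have "prob (?E \<inter> (D.R n - D.R (Suc n))) = prob (?E \<inter> D.R n) - prob (?E \<inter> D.R (Suc n))"
    using D.R_antimono[of n "Suc n"] by (simp add: finite_measure_Diff le_infI2)
  also have "\<dots> = prob ?E * reach_prob n * (1 - (real n - real_of_int x) / (real n + 1 - real_of_int x))"
    unfolding prob_eq_Int_reach_Suc prob_eq_Int_reach assms(1) by (simp add: algebra_simps)
  also have "1 - (real n - real_of_int x) / (real n + 1 - real_of_int x) = 1 / (real n + 1 - real_of_int x)"
    using d by (simp add: field_simps)
  also have "prob ?E * reach_prob n = (real n + 1 - real_of_int x) * (strip n x - strip n (x + 1))"
    using B_law[OF assms(2)] by (simp add: mult.commute)
  finally show ?thesis using d by simp
qed

lemma exit_above:
  assumes R: "prob (D.R n) = reach_prob n"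
  shows "prob ({\<omega>\<in>space M. x \<le> B n \<omega>} \<inter> (D.R n - D.R (Suc n))) = strip n x"
proof (cases "x \<le> int n + 1")
  case True
  then show ?thesis
  proof (induction x rule: int_le_induct)
    case base
    have "\<not> int n + 1 \<le> B n \<omega>" for \<omega> using B_bound[of n \<omega>] by linarith
    then have e: "{\<omega>\<in>space M. int n + 1 \<le> B n \<omega>} = {}" by blast
    show ?case unfolding e by (simp add: strip_above)
  next
    case (step i)
    have eq: "{\<omega>\<in>space M. i - 1 \<le> B n \<omega>} \<inter> (D.R n - D.R (Suc n))
        = ({\<omega>\<in>space M. B n \<omega> = i - 1} \<inter> (D.R n - D.R (Suc n)))
        \<union> ({\<omega>\<in>space M. i \<le> B n \<omega>} \<inter> (D.R n - D.R (Suc n)))" by auto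
    have [measurable]: "{\<omega>\<in>space M. B n \<omega> = i - 1} \<in> events" "{\<omega>\<in>space M. i \<le> B n \<omega>} \<in> events" by measurable
    have "prob ({\<omega>\<in>space M. i - 1 \<le> B n \<omega>} \<inter> (D.R n - D.R (Suc n)))
      = prob ({\<omega>\<in>space M. B n \<omega> = i - 1} \<inter> (D.R n - D.R (Suc n)))
      + prob ({\<omega>\<in>space M. i \<le> B n \<omega>} \<inter> (D.R n - D.R (Suc n)))"
      unfolding eq by (rule finite_measure_Union) auto
    then show ?case using step exit_at[OF R, of "i - 1"] by simp
  qed
next
  case False
  have "B n \<omega> < x" for \<omega> using B_bound[of n \<omega>] False by linarith
  then have e: "{\<omega>\<in>space M. x \<le> B n \<omega>} = {}" by (auto simp: not_le)
  show ?thesis unfolding e using False by (simp add: strip_above)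
qed

text \<open>The total mass ending at level \<open>n\<close> is the limit of \<open>strip n\<close>
  at minus infinity, namely the drop of \<open>reach_prob\<close>; what remains reaches
  \<open>n + 1\<close>.\<close>

lemma prob_R: "prob (D.R n) = reach_prob n"
proof (induction n)
  case 0
  have "prob (D.R 0) = 1" using D.R_0 by (subst prob_eq_1) auto
  then show ?case by (simp add: reach_prob_def)
next
  case (Suc n)
  let ?E = "D.R n - D.R (Suc n)"
  have [measurable]: "{\<omega>\<in>space M. - int i \<le> B n \<omega>} \<in> events" for i by measurable
  have "(\<lambda>i. prob ({\<omega>\<in>space M. - int i \<le> B n \<omega>} \<inter> ?E)) \<longlonglongrightarrow> prob (\<Union>i. {\<omega>\<in>space M. - int i \<le> B n \<omega>} \<inter> ?E)"
    by (rule finite_Lim_measure_incseq) (auto simp: incseq_def)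
  moreover have "(\<Union>i. {\<omega>\<in>space M. - int i \<le> B n \<omega>} \<inter> ?E) = ?E"
  proof -
    have "\<omega> \<in> (\<Union>i. {\<omega>\<in>space M. - int i \<le> B n \<omega>} \<inter> ?E)" if "\<omega> \<in> ?E" for \<omega>
      using that sets.sets_into_space[OF D.R_events[of n]] by (intro UN_I[of "nat (- B n \<omega>)"]) auto
    then show ?thesis by auto
  qed
  ultimately have "(\<lambda>i. strip n (- int i)) \<longlonglongrightarrow> prob ?E" by (simp add: exit_above[OF Suc])
  then have "prob ?E = reach_prob n - reach_prob (Suc n)"
    using strip_tendsto[of n] LIMSEQ_unique by blast
  moreover have "prob ?E = prob (D.R n) - prob (D.R (Suc n))"
    using D.R_antimono[of n "Suc n"] by (intro finite_measure_Diff) auto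
  ultimately show ?case using Suc by simp
qed

lemma T_finite: "AE \<omega> in M. D.T \<omega> \<noteq> \<infinity>"
  using D.AE_T_finite reach_prob_tendsto by (simp add: prob_R)

lemma S_T_measurable [measurable]: "(\<lambda>\<omega>. S (the_enat (D.T \<omega>)) \<omega>) \<in> measurable M (count_space UNIV)"
  by (rule D.terminal_measurable[OF D.T_measurable D.S_measurable])

text \<open>Paths are sorted by their final maximum, and the strips of all levels add up to
  \<open>tail x\<close> because \<open>reach_prob\<close> tends to 0.\<close>

lemma S_T_tail: "prob {\<omega>\<in>space M. x \<le> S (the_enat (D.T \<omega>)) \<omega>} = tail x"
proof -
  define A where "A n = {\<omega>\<in>space M. x \<le> B n \<omega>} \<inter> (D.R n - D.R (Suc n))" for n
  have [measurable]: "{\<omega>\<in>space M. x \<le> B n \<omega>} \<in> events" for n by measurable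
  have Am: "A n \<in> events" for n by (auto simp: A_def)
  have "disjoint_family A"
    unfolding disjoint_family_on_def
  proof (intro ballI impI)
    fix m n :: nat assume "m \<noteq> n"
    have "A i \<inter> A j = {}" if "i < j" for i j
      using D.R_antimono[of "Suc i" j] that by (auto simp: A_def)
    from this[of m n] this[of n m] show "A m \<inter> A n = {}" using \<open>m \<noteq> n\<close> by (metis Int_commute nat_neq_iff)
  qed
  then have "(\<lambda>n. prob (A n)) sums prob (\<Union>n. A n)"
    using Am by (intro finite_measure_UNION) auto
  then have "(\<lambda>n. strip n x) sums prob (\<Union>n. A n)" by (simp add: A_def exit_above[OF prob_R])
  moreover have "(\<lambda>n. strip n x) sums tail x"
  proof -
    have "(\<lambda>N. tail x - min (tail x) (reach_prob N)) \<longlonglongrightarrow> tail x - min (tail x) 0"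
      by (intro tendsto_intros reach_prob_tendsto)
    then show ?thesis by (simp add: sums_def sum_strip)
  qed
  ultimately have "prob (\<Union>n. A n) = tail x" by (rule sums_unique2)
  moreover have "prob {\<omega>\<in>space M. x \<le> S (the_enat (D.T \<omega>)) \<omega>} = prob (\<Union>n. A n)"
  proof (rule finite_measure_eq_AE)
    show "AE \<omega> in M. \<omega> \<in> {\<omega>\<in>space M. x \<le> S (the_enat (D.T \<omega>)) \<omega>} \<longleftrightarrow> \<omega> \<in> (\<Union>n. A n)"
      using D.AE_good T_finite AE_space
    proof eventually_elim
      case (elim \<omega>)
      obtain m where m: "D.T \<omega> = enat m" using elim by (cases "D.T \<omega>") auto
      define n where "n = nat (Smax S m \<omega>)"
      have n: "Smax S m \<omega> = int n" using D.Smax_nonneg[OF elim(1), of m] by (simp add: n_def)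
      have R: "\<omega> \<in> D.R j - D.R (Suc j) \<longleftrightarrow> j = n" for j
        using D.terminal_iff(1)[OF elim(1) m, of j] n by auto
      have Sm: "S m \<omega> = B n \<omega>" using D.terminal_iff(2)[OF elim(1) m, of n] R by blast
      have "\<omega> \<in> A j \<longleftrightarrow> j = n \<and> x \<le> B n \<omega>" for j
        unfolding A_def using R[of j] elim by auto
      then show ?case using m Sm elim by auto
    qed
    show "{\<omega>\<in>space M. x \<le> S (the_enat (D.T \<omega>)) \<omega>} \<in> events" by measurable
  qed (use Am in auto)
  ultimately show ?thesis by simp
qed

lemma S_T_law: "prob {\<omega>\<in>space M. S (the_enat (D.T \<omega>)) \<omega> = x} = pmf \<mu> x"
proof -
  have "prob {\<omega>\<in>space M. S (the_enat (D.T \<omega>)) \<omega> = x}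
      = prob ({\<omega>\<in>space M. x \<le> S (the_enat (D.T \<omega>)) \<omega>} - {\<omega>\<in>space M. x + 1 \<le> S (the_enat (D.T \<omega>)) \<omega>})"
    by (rule arg_cong[where f=prob]) auto
  also have "\<dots> = prob {\<omega>\<in>space M. x \<le> S (the_enat (D.T \<omega>)) \<omega>} - prob {\<omega>\<in>space M. x + 1 \<le> S (the_enat (D.T \<omega>)) \<omega>}"
    by (rule finite_measure_Diff) (measurable, auto)
  finally show ?thesis using tail_diff[of x] by (simp only: S_T_tail)
qed

lemma T_unif_integrable: "unif_integrable M (\<lambda>t \<omega>. real_of_int (stopped S D.T t \<omega>))"
proof (rule D.unif_integrable_stopped[OF T_finite])
  show "integrable M (\<lambda>\<omega>. real_of_int (S (the_enat (D.T \<omega>)) \<omega>))"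
    using expectation_law(1)[OF S_T_measurable S_T_law, of real_of_int] integrable_id by simp
  show "(\<lambda>n. real n * prob (D.R n)) \<longlonglongrightarrow> 0" using n_reach_prob_tendsto by (simp add: prob_R)
qed

end

section \<open>The Azema-Yor stopping time\<close>

context ssrw
begin

text \<open>Discrete intermediate value property of a path with unit steps.\<close>

lemma visits_below_max:
  assumes "good \<omega>" "0 \<le> N" "N \<le> Smax S u \<omega>"
  shows "\<exists>v\<le>u. S v \<omega> = N"
  using assms(3)
proof (induction u)
  case 0
  then show ?case using assms by (simp add: good_def)
next
  case (Suc u)
  show ?case
  proof (cases "N \<le> Smax S u \<omega>")
    case True
    then show ?thesis using Suc.IH le_SucI by blast
  next
    case False
    then have "S (Suc u) \<omega> = N"
      using Suc.prems good_step[OF assms(1), of u] Smax_ge[of u u S \<omega>] by (auto simp: Smax_Suc)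
    then show ?thesis by blast
  qed
qed

end

context centred_pmf
begin

lemma tail_0_pos: "0 < tail 0"
proof (rule ccontr)
  assume "\<not> 0 < tail 0"
  then have z: "tail 0 = 0" using tail_nonneg[of 0] by linarith
  then show False using call_zero[OF z] call_diff[of "-1"] call_ge[of "-1"] by simp
qed

text \<open>Mean zero puts mass on the nonnegative integers, so a support bounded above has a
  maximum there.\<close>

lemma xbar_attained:
  assumes "\<not> ereal (real n) < xbar \<mu>"
  obtains N where "xbar \<mu> = ereal (real_of_int N)" "0 \<le> N" "N \<le> int n"
proof -
  have le: "y \<le> int n" if "y \<in> set_pmf \<mu>" for y
  proof -
    have "ereal (real_of_int y) \<le> xbar \<mu>" unfolding xbar_def using that by (intro Sup_upper) auto
    also have "xbar \<mu> \<le> ereal (real n)" using assms by simp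
    finally show ?thesis by simp
  qed
  define A where "A = set_pmf \<mu> \<inter> {0..}"
  have "A \<noteq> {}" using tail_0_pos by (auto simp: A_def tail_alt measure_pmf_zero_iff zero_less_measure_iff)
  moreover have "finite A" by (rule finite_subset[of _ "{0..int n}"]) (use le in \<open>auto simp: A_def\<close>)
  ultimately have N: "Max A \<in> A" "\<And>y. y \<in> A \<Longrightarrow> y \<le> Max A" by auto
  have "y \<le> Max A" if "y \<in> set_pmf \<mu>" for y
    using N that by (cases "0 \<le> y") (auto simp: A_def)
  then have "xbar \<mu> = ereal (real_of_int (Max A))"
    unfolding xbar_def using N(1) by (intro antisym Sup_least Sup_upper) (auto simp: A_def)
  then show ?thesis using that N(1) le by (auto simp: A_def)
qed

end

context azema_yor
begin

text \<open>Levels decrease along the list, so the first zero coin marks the highest active level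
  and decides alone. The bound \<open>s \<le> n\<close> makes the cap at \<open>n\<close> in
  \<open>B\<close> harmless.\<close>

lemma stop_iff:
  assumes pos: "0 < tail (int n + 1)" and ex: "\<exists>k. (n, k) \<in> AYidx \<mu> \<and> \<not> \<eta> n k \<omega>" and s: "s \<le> int n"
  shows "(\<exists>k. (n, k) \<in> AYidx \<mu> \<and> s \<le> xk \<mu> n k \<and> \<not> \<eta> n k \<omega>) \<longleftrightarrow> s \<le> B n \<omega>"
proof -
  define P where "P k \<longleftrightarrow> (n, k) \<in> AYidx \<mu> \<and> \<not> \<eta> n k \<omega>" for k
  define k0 where "k0 = (LEAST k. P k)"
  have Pex: "\<exists>k. P k" using ex by (simp add: P_def)
  have Pk0: "P k0" unfolding k0_def using Pex by (rule LeastI_ex)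
  have B: "B n \<omega> = min (int n) (xk \<mu> n k0)"
    using pos Pex unfolding B_def bfun_def k0_def P_def by simp
  have "xk \<mu> n k \<le> xk \<mu> n k0" if "P k" for k
  proof -
    have "k0 \<le> k" unfolding k0_def using that by (rule Least_le)
    then show ?thesis using xk_ge_iff[OF pos, of k0 "xk \<mu> n k"] xk_in(2)[OF pos, of k] that Pk0 by (simp add: P_def)
  qed
  then have "(\<exists>k. P k \<and> s \<le> xk \<mu> n k) \<longleftrightarrow> s \<le> xk \<mu> n k0"
    using Pk0 by (meson order_trans)
  then show ?thesis using s B by (auto simp: P_def)
qed

text \<open>The equality is almost sure because each level below the top of the support must have a
  zero coin. From the top on, \<open>B n = n\<close> stops the walk at once, which reproduces the
  hitting time of the top.\<close>

lemma tauAY_eq_T: "AE \<omega> in M. tauAY \<mu> S \<eta> \<omega> = D.T \<omega>"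
proof -
  have "AE \<omega> in M. \<forall>n. 0 < tail (int n + 1) \<longrightarrow> (\<exists>k. (n, k) \<in> AYidx \<mu> \<and> \<not> \<eta> n k \<omega>)"
    unfolding AE_all_countable
  proof
    fix n
    show "AE \<omega> in M. 0 < tail (int n + 1) \<longrightarrow> (\<exists>k. (n, k) \<in> AYidx \<mu> \<and> \<not> \<eta> n k \<omega>)"
      using AE_ex_eta[of n] by (cases "0 < tail (int n + 1)") auto
  qed
  then show ?thesis using D.AE_good
  proof eventually_elim
    case (elim \<omega>)
    define P where "P t \<longleftrightarrow> (\<exists>k. (nat (Smax S t \<omega>), k) \<in> AYidx \<mu>
             \<and> S t \<omega> \<le> xk \<mu> (nat (Smax S t \<omega>)) k \<and> \<not> \<eta> (nat (Smax S t \<omega>)) k \<omega>)" for t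
    define Q where "Q t \<longleftrightarrow> S t \<omega> \<le> B (nat (Smax S t \<omega>)) \<omega>" for t
    have T: "D.T \<omega> = first_time Q" unfolding D.T_def Q_def ..
    have S_le: "S t \<omega> \<le> int (nat (Smax S t \<omega>))" for t
      using Smax_ge[of t t S \<omega>] D.Smax_nonneg[OF elim(2), of t] by simp
    have PQ: "P t \<longleftrightarrow> Q t" if "0 < tail (int (nat (Smax S t \<omega>)) + 1)" for t
      unfolding P_def Q_def by (rule stop_iff[OF that _ S_le]) (use elim(1) that in blast)
    have Q_top: "Q t" if "\<not> 0 < tail (int (nat (Smax S t \<omega>)) + 1)" for t
      using that S_le[of t] unfolding Q_def B_def bfun_def by auto
    have P_pos: "0 < tail (int (nat (Smax S t \<omega>)) + 1)" if "P t" for t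
      using that unfolding P_def AYidx_def less_xbar_iff[symmetric] by auto
    show ?case
    proof (cases "\<mu> = return_pmf 0")
      case True
      have "tail 1 = 0" unfolding tail_alt using True by simp
      then have "Q 0" using Q_top[of 0] elim(2) by (simp add: D.good_def)
      then have "first_time Q \<le> enat 0" unfolding first_time_le_iff by blast
      then show ?thesis using True T by (simp add: tauAY_def zero_enat_def[symmetric])
    next
      case False
      \<comment> \<open>The stopping conditions do not agree instant by instant, as \<open>Q\<close>
        holds at all times once the maximum has reached the top; so only the existence of a stop up
        to \<open>t\<close> is compared.\<close>
      have "(\<exists>u\<le>t. P u) \<or> Hbar \<mu> S \<omega> \<le> enat t \<longleftrightarrow> (\<exists>u\<le>t. Q u)" for t
      proof
        assume "(\<exists>u\<le>t. P u) \<or> Hbar \<mu> S \<omega> \<le> enat t"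
        then show "\<exists>u\<le>t. Q u"
        proof
          assume "\<exists>u\<le>t. P u"
          then show ?thesis using PQ P_pos by blast
        next
          assume H: "Hbar \<mu> S \<omega> \<le> enat t"
          then obtain u where u: "u \<le> t" "ereal (real_of_int (S u \<omega>)) = xbar \<mu>"
            by (auto simp: Hbar_def first_time_le_iff split: if_splits)
          have "xbar \<mu> \<le> ereal (real (nat (Smax S u \<omega>)))"
            unfolding u(2)[symmetric] ereal_less_eq using S_le[of u] by linarith
          then have "\<not> 0 < tail (int (nat (Smax S u \<omega>)) + 1)"
            unfolding less_xbar_iff[symmetric] by simp
          then show ?thesis using Q_top u(1) by blast
        qed
      next
        assume "\<exists>u\<le>t. Q u"
        then obtain u where u: "u \<le> t" "Q u" by blast
        show "(\<exists>u\<le>t. P u) \<or> Hbar \<mu> S \<omega> \<le> enat t"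
        proof (cases "0 < tail (int (nat (Smax S u \<omega>)) + 1)")
          case True
          then show ?thesis using PQ u by blast
        next
          case False
          then have "\<not> ereal (real (nat (Smax S u \<omega>))) < xbar \<mu>" unfolding less_xbar_iff .
          then obtain N where N: "xbar \<mu> = ereal (real_of_int N)" "0 \<le> N" "N \<le> int (nat (Smax S u \<omega>))"
            by (rule xbar_attained)
          then have "N \<le> Smax S u \<omega>" using D.Smax_nonneg[OF elim(2), of u] by simp
          then obtain v where "v \<le> u" "S v \<omega> = N" using D.visits_below_max[OF elim(2) N(2)] by blast
          then have "Hbar \<mu> S \<omega> \<le> enat t"
            using N(1) u(1) by (auto simp: Hbar_def first_time_le_iff intro!: exI[of _ v])
          then show ?thesis ..
        qed
      qed
      moreover have "tauAY \<mu> S \<eta> \<omega> \<le> enat t \<longleftrightarrow> (\<exists>u\<le>t. P u) \<or> Hbar \<mu> S \<omega> \<le> enat t" for t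
        using False by (simp add: tauAY_def P_def[symmetric] min_le_iff_disj first_time_le_iff)
      ultimately have iff: "tauAY \<mu> S \<eta> \<omega> \<le> enat t \<longleftrightarrow> D.T \<omega> \<le> enat t" for t
        unfolding T by (simp only: first_time_le_iff)
      show ?thesis
      proof (rule antisym)
        show "tauAY \<mu> S \<eta> \<omega> \<le> D.T \<omega>" using iff by (cases "D.T \<omega>") auto
        show "D.T \<omega> \<le> tauAY \<mu> S \<eta> \<omega>" using iff by (cases "tauAY \<mu> S \<eta> \<omega>") auto
      qed
    qed
  qed
qed

section \<open>The stopping property when coins are revealed level by level\<close>

lemma FSeta_sets: "sets (FSeta M \<mu> S \<eta> t) = sigma_sets (space M)
     ({S u -` A \<inter> space M | u A. u \<le> t} \<union> {eta_obs \<mu> S \<eta> u k -` B \<inter> space M | u k B. u \<le> t})"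
  unfolding FSeta_def by (rule sets_measure_of) auto

lemma space_FSeta [simp]: "space (FSeta M \<mu> S \<eta> t) = space M"
  unfolding FSeta_def by (rule space_measure_of) auto

lemma S_FSeta: "u \<le> t \<Longrightarrow> S u \<in> measurable (FSeta M \<mu> S \<eta> t) (count_space UNIV)"
  by (rule measurableI) (auto simp: FSeta_sets intro!: sigma_sets.Basic)

lemma Smax_FSeta: "u \<le> t \<Longrightarrow> Smax S u \<in> measurable (FSeta M \<mu> S \<eta> t) (count_space UNIV)"
proof (induction u)
  case 0
  then show ?case using S_FSeta[of 0 t] by (simp add: Smax_def[abs_def])
next
  case (Suc u)
  then have "Smax S u \<in> measurable (FSeta M \<mu> S \<eta> t) (count_space UNIV)" by simp
  from measurable_count_space_op2[OF this S_FSeta[OF Suc.prems], of max]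
  show ?case by (simp add: Smax_Suc[abs_def])
qed

text \<open>Equality with \<open>T\<close> does not help here: it is almost sure only, and
  \<open>T\<close> is a stopping time of the enlarged filtration. Instead the definition is taken
  apart: at time \<open>u\<close> it consults the coins of the current level, and these are visible
  through \<open>eta_obs\<close>.\<close>

lemma tauAY_stopping: "stopping_time_wrt M (FSeta M \<mu> S \<eta>) (tauAY \<mu> S \<eta>)"
  unfolding stopping_time_wrt_def
proof
  fix t
  let ?F = "FSeta M \<mu> S \<eta> t"
  show "{\<omega>\<in>space M. tauAY \<mu> S \<eta> \<omega> \<le> enat t} \<in> sets ?F"
  proof (cases "\<mu> = return_pmf 0")
    case True
    then have "{\<omega>\<in>space M. tauAY \<mu> S \<eta> \<omega> \<le> enat t} = space ?F"
      unfolding space_FSeta by (simp add: tauAY_def)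
    then show ?thesis by (simp only: sets.top)
  next
    case False
    define A where "A u k = {\<omega>\<in>space M. eta_obs \<mu> S \<eta> u k \<omega> = Some False}
      \<inter> {\<omega>\<in>space M. S u \<omega> \<le> xk \<mu> (nat (Smax S u \<omega>)) k}" for u k
    define C where "C u = {\<omega>\<in>space M. xbar \<mu> \<noteq> \<infinity> \<and> ereal (real_of_int (S u \<omega>)) = xbar \<mu>}" for u
    have A: "A u k \<in> sets ?F" if "u \<le> t" for u k
      unfolding A_def
    proof (rule sets.Int)
      have "eta_obs \<mu> S \<eta> u k -` {Some False} \<inter> space M \<in> sets ?F"
        unfolding FSeta_sets using that by (intro sigma_sets.Basic) blast
      then show "{\<omega>\<in>space M. eta_obs \<mu> S \<eta> u k \<omega> = Some False} \<in> sets ?F"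
        by (simp add: vimage_def Int_def conj_commute)
      have "(\<lambda>\<omega>. S u \<omega> \<le> xk \<mu> (nat (Smax S u \<omega>)) k) -` {True} \<inter> space ?F \<in> sets ?F"
        using measurable_count_space_op2[OF S_FSeta[OF that] Smax_FSeta[OF that],
            of "\<lambda>s m. s \<le> xk \<mu> (nat m) k"] by (rule measurable_sets) simp
      then show "{\<omega>\<in>space M. S u \<omega> \<le> xk \<mu> (nat (Smax S u \<omega>)) k} \<in> sets ?F"
        by (simp add: vimage_def Int_def conj_commute)
    qed
    have C: "C u \<in> sets ?F" if "u \<le> t" for u
    proof -
      have "C u = S u -` {s. xbar \<mu> \<noteq> \<infinity> \<and> ereal (real_of_int s) = xbar \<mu>} \<inter> space ?F"
        unfolding space_FSeta C_def by auto
      also have "\<dots> \<in> sets ?F" by (rule measurable_sets[OF S_FSeta[OF that]]) simp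
      finally show ?thesis .
    qed
    have obs: "eta_obs \<mu> S \<eta> u k \<omega> = Some False
        \<longleftrightarrow> (nat (Smax S u \<omega>), k) \<in> AYidx \<mu> \<and> \<not> \<eta> (nat (Smax S u \<omega>)) k \<omega>" for u k \<omega>
      by (simp add: eta_obs_def)
    have "{\<omega>\<in>space M. tauAY \<mu> S \<eta> \<omega> \<le> enat t} = (\<Union>u\<in>{..t}. (\<Union>k. A u k) \<union> C u)"
      using False
      by (auto simp: tauAY_def min_le_iff_disj first_time_le_iff Hbar_def A_def C_def obs split: if_splits)
    also have "\<dots> \<in> sets ?F" using A C by (intro sets.finite_UN sets.Un sets.countable_UN) auto
    finally show ?thesis .
  qed
qed

lemma FSeta_events: "sets (FSeta M \<mu> S \<eta> t) \<subseteq> events"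
proof -
  have "eta_obs \<mu> S \<eta> u k \<in> measurable M (count_space UNIV)" for u k
  proof -
    have "(\<lambda>\<omega>. if (n, k) \<in> AYidx \<mu> then Some (\<eta> n k \<omega>) else None) \<in> measurable M (count_space UNIV)" for n
      using measurable_compose[OF eta_measurable[of n k], of Some "count_space UNIV"]
      by (cases "(n, k) \<in> AYidx \<mu>") auto
    moreover have "(\<lambda>\<omega>. nat (Smax S u \<omega>)) \<in> measurable M (count_space UNIV)"
      by (rule measurable_compose[OF D.Smax_measurable]) simp
    ultimately show ?thesis
      unfolding eta_obs_def
      by (rule measurable_compose_countable[where
            f="\<lambda>n \<omega>. if (n, k) \<in> AYidx \<mu> then Some (\<eta> n k \<omega>) else None"])
  qed
  then have "{S u -` A \<inter> space M | u A. u \<le> t} \<union> {eta_obs \<mu> S \<eta> u k -` B \<inter> space M | u k B. u \<le> t} \<subseteq> events"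
    using measurable_sets[OF D.S_measurable] measurable_sets[of "eta_obs \<mu> S \<eta> _ _" M "count_space UNIV"] by fastforce
  then show ?thesis unfolding FSeta_sets by (rule sets.sigma_sets_subset)
qed

section \<open>Transfer from \<open>T\<close> to the Azema-Yor time, and optimality\<close>

lemma tauAY_measurable: "tauAY \<mu> S \<eta> \<in> measurable M (count_space UNIV)"
proof (rule measurable_enatI)
  fix t
  have "{\<omega>\<in>space M. tauAY \<mu> S \<eta> \<omega> \<le> enat t} \<in> sets (FSeta M \<mu> S \<eta> t)"
    using tauAY_stopping unfolding stopping_time_wrt_def by blast
  then show "{\<omega>\<in>space M. tauAY \<mu> S \<eta> \<omega> \<le> enat t} \<in> events" using FSeta_events by blast
qed

lemma tauAY_terminal_events:
  assumes "\<And>u. X u \<in> measurable M (count_space (UNIV :: int set))"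
  shows "{\<omega>\<in>space M. tauAY \<mu> S \<eta> \<omega> \<noteq> \<infinity> \<and> X (the_enat (tauAY \<mu> S \<eta> \<omega>)) \<omega> \<in> A} \<in> events"
proof -
  have "{\<omega>\<in>space M. tauAY \<mu> S \<eta> \<omega> \<noteq> \<infinity> \<and> X (the_enat (tauAY \<mu> S \<eta> \<omega>)) \<omega> \<in> A}
    = (tauAY \<mu> S \<eta> -` (- {\<infinity>}) \<inter> space M) \<inter> ((\<lambda>\<omega>. X (the_enat (tauAY \<mu> S \<eta> \<omega>)) \<omega>) -` A \<inter> space M)"
    by auto
  also have "\<dots> \<in> events"
  proof (rule sets.Int)
    show "tauAY \<mu> S \<eta> -` (- {\<infinity>}) \<inter> space M \<in> events"
      by (rule measurable_sets[OF tauAY_measurable]) simp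
    show "(\<lambda>\<omega>. X (the_enat (tauAY \<mu> S \<eta> \<omega>)) \<omega>) -` A \<inter> space M \<in> events"
      by (rule measurable_sets[OF D.terminal_measurable[OF tauAY_measurable assms]]) simp
  qed
  finally show ?thesis .
qed

lemma tauAY_finite: "AE \<omega> in M. tauAY \<mu> S \<eta> \<omega> \<noteq> \<infinity>"
  using tauAY_eq_T T_finite by eventually_elim simp

lemma tauAY_SEP: "SEP M (FSeta M \<mu> S \<eta>) S \<mu> (tauAY \<mu> S \<eta>)"
  unfolding SEP_def
proof (intro conjI allI tauAY_stopping tauAY_finite)
  fix x
  have "prob {\<omega>\<in>space M. tauAY \<mu> S \<eta> \<omega> \<noteq> \<infinity> \<and> S (the_enat (tauAY \<mu> S \<eta> \<omega>)) \<omega> = x}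
      = prob {\<omega>\<in>space M. S (the_enat (D.T \<omega>)) \<omega> = x}"
  proof (rule finite_measure_eq_AE)
    show "AE \<omega> in M. \<omega> \<in> {\<omega>\<in>space M. tauAY \<mu> S \<eta> \<omega> \<noteq> \<infinity> \<and> S (the_enat (tauAY \<mu> S \<eta> \<omega>)) \<omega> = x}
        \<longleftrightarrow> \<omega> \<in> {\<omega>\<in>space M. S (the_enat (D.T \<omega>)) \<omega> = x}"
      using tauAY_eq_T T_finite by eventually_elim simp
    show "{\<omega>\<in>space M. tauAY \<mu> S \<eta> \<omega> \<noteq> \<infinity> \<and> S (the_enat (tauAY \<mu> S \<eta> \<omega>)) \<omega> = x} \<in> events"
      using tauAY_terminal_events[of S, OF D.S_measurable, of "{x}"] by simp
    show "{\<omega>\<in>space M. S (the_enat (D.T \<omega>)) \<omega> = x} \<in> events" by measurable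
  qed
  then show "prob {\<omega>\<in>space M. tauAY \<mu> S \<eta> \<omega> \<noteq> \<infinity> \<and> S (the_enat (tauAY \<mu> S \<eta> \<omega>)) \<omega> = x} = pmf \<mu> x"
    by (simp add: S_T_law)
next
  have eq: "AE \<omega> in M. stopped S (tauAY \<mu> S \<eta>) t \<omega> = stopped S D.T t \<omega>" for t
    using tauAY_eq_T by eventually_elim (simp add: stopped_clk)
  have m1: "stopped S (tauAY \<mu> S \<eta>) t \<in> measurable M (count_space UNIV)" for t
    using D.clk_measurable[OF tauAY_measurable D.S_measurable, where t=t] by (simp add: stopped_clk[abs_def])
  have m2: "stopped S D.T t \<in> measurable M (count_space UNIV)" for t
    using D.clk_measurable[OF D.T_measurable D.S_measurable, where t=t] by (simp add: stopped_clk[abs_def])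
  have b1: "(\<lambda>\<omega>. h (stopped S (tauAY \<mu> S \<eta>) t \<omega>)) \<in> borel_measurable M" for h :: "int \<Rightarrow> real" and t
    by (rule measurable_compose[OF m1]) simp
  have b2: "(\<lambda>\<omega>. h (stopped S D.T t \<omega>)) \<in> borel_measurable M" for h :: "int \<Rightarrow> real" and t
    by (rule measurable_compose[OF m2]) simp
  show "unif_integrable M (\<lambda>t \<omega>. real_of_int (stopped S (tauAY \<mu> S \<eta>) t \<omega>))"
    unfolding unif_integrable_def
  proof (intro conjI allI impI)
    fix t
    have "integrable M (\<lambda>\<omega>. real_of_int (stopped S D.T t \<omega>))"
      using T_unif_integrable unfolding unif_integrable_def by blast
    then show "integrable M (\<lambda>\<omega>. real_of_int (stopped S (tauAY \<mu> S \<eta>) t \<omega>))"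
      by (rule integrable_cong_AE_imp[OF _ b1]) (use eq[of t] in \<open>eventually_elim, simp\<close>)
  next
    fix e :: real assume "0 < e"
    then obtain K where K: "\<And>t. (\<integral>\<omega>. indicator {\<omega>. K < \<bar>real_of_int (stopped S D.T t \<omega>)\<bar>} \<omega>
        * \<bar>real_of_int (stopped S D.T t \<omega>)\<bar> \<partial>M) < e"
      using T_unif_integrable unfolding unif_integrable_def by blast
    have "(\<integral>\<omega>. indicator {\<omega>. K < \<bar>real_of_int (stopped S (tauAY \<mu> S \<eta>) t \<omega>)\<bar>} \<omega>
        * \<bar>real_of_int (stopped S (tauAY \<mu> S \<eta>) t \<omega>)\<bar> \<partial>M)
      = (\<integral>\<omega>. indicator {\<omega>. K < \<bar>real_of_int (stopped S D.T t \<omega>)\<bar>} \<omega>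
        * \<bar>real_of_int (stopped S D.T t \<omega>)\<bar> \<partial>M)" for t
    proof (rule integral_cong_AE)
      show "AE \<omega> in M. indicator {\<omega>. K < \<bar>real_of_int (stopped S (tauAY \<mu> S \<eta>) t \<omega>)\<bar>} \<omega>
        * \<bar>real_of_int (stopped S (tauAY \<mu> S \<eta>) t \<omega>)\<bar>
        = indicator {\<omega>. K < \<bar>real_of_int (stopped S D.T t \<omega>)\<bar>} \<omega> * \<bar>real_of_int (stopped S D.T t \<omega>)\<bar>"
        using eq[of t] by eventually_elim (simp add: indicator_def)
      show "(\<lambda>\<omega>. indicator {\<omega>. K < \<bar>real_of_int (stopped S (tauAY \<mu> S \<eta>) t \<omega>)\<bar>} \<omega>
        * \<bar>real_of_int (stopped S (tauAY \<mu> S \<eta>) t \<omega>)\<bar>) \<in> borel_measurable M"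
        using b1[of "\<lambda>y. indicator {y. K < \<bar>y\<bar>} (real_of_int y) * \<bar>real_of_int y\<bar>" t] by (simp add: indicator_def)
      show "(\<lambda>\<omega>. indicator {\<omega>. K < \<bar>real_of_int (stopped S D.T t \<omega>)\<bar>} \<omega>
        * \<bar>real_of_int (stopped S D.T t \<omega>)\<bar>) \<in> borel_measurable M"
        using b2[of "\<lambda>y. indicator {y. K < \<bar>y\<bar>} (real_of_int y) * \<bar>real_of_int y\<bar>" t] by (simp add: indicator_def)
    qed
    then show "\<exists>K. \<forall>t. (\<integral>\<omega>. indicator {\<omega>. K < \<bar>real_of_int (stopped S (tauAY \<mu> S \<eta>) t \<omega>)\<bar>} \<omega>
        * \<bar>real_of_int (stopped S (tauAY \<mu> S \<eta>) t \<omega>)\<bar> \<partial>M) < e"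
      using K by (intro exI[of _ K] allI) (simp only:)
  qed
qed

lemma tauAY_max_law:
  assumes "1 \<le> n"
  shows "prob {\<omega>\<in>space M. tauAY \<mu> S \<eta> \<omega> \<noteq> \<infinity> \<and> int n \<le> Smax S (the_enat (tauAY \<mu> S \<eta> \<omega>)) \<omega>} = AYbound \<mu> n"
proof -
  have "prob {\<omega>\<in>space M. tauAY \<mu> S \<eta> \<omega> \<noteq> \<infinity> \<and> int n \<le> Smax S (the_enat (tauAY \<mu> S \<eta> \<omega>)) \<omega>} = prob (D.R n)"
  proof (rule finite_measure_eq_AE)
    show "AE \<omega> in M. \<omega> \<in> {\<omega>\<in>space M. tauAY \<mu> S \<eta> \<omega> \<noteq> \<infinity> \<and> int n \<le> Smax S (the_enat (tauAY \<mu> S \<eta> \<omega>)) \<omega>}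
        \<longleftrightarrow> \<omega> \<in> D.R n"
      using tauAY_eq_T T_finite AE_space
    proof eventually_elim
      case (elim \<omega>)
      then obtain m where m: "D.T \<omega> = enat m" by (cases "D.T \<omega>") auto
      then show ?case using elim D.R_finite_iff[OF elim(3) m, of n] by simp
    qed
    show "{\<omega>\<in>space M. tauAY \<mu> S \<eta> \<omega> \<noteq> \<infinity> \<and> int n \<le> Smax S (the_enat (tauAY \<mu> S \<eta> \<omega>)) \<omega>} \<in> events"
      using tauAY_terminal_events[of "Smax S", OF D.Smax_measurable, of "{int n..}"] by simp
  qed auto
  then show ?thesis using assms by (simp add: prob_R reach_prob_def)
qed

text \<open>The maximal inequality is applied at the contact \<open>b\<close> of level
  \<open>n\<close>; its right-hand side \<open>call b\<close> depends on \<sigma> only through the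
  law \<mu>.\<close>

lemma SEP_max_bound:
  assumes F: "ssrw_wrt M F S" and sep: "SEP M F S \<mu> \<sigma>" and n: "1 \<le> n"
  shows "prob {\<omega>\<in>space M. \<sigma> \<omega> \<noteq> \<infinity> \<and> int n \<le> Smax S (the_enat (\<sigma> \<omega>)) \<omega>} \<le> AYbound \<mu> n"
proof -
  interpret F: ssrw M F S by unfold_locales (rule F)
  have st: "stopping_time_wrt M F \<sigma>" and fin: "AE \<omega> in M. \<sigma> \<omega> \<noteq> \<infinity>"
    and law: "\<And>x. prob {\<omega>\<in>space M. \<sigma> \<omega> \<noteq> \<infinity> \<and> S (the_enat (\<sigma> \<omega>)) \<omega> = x} = pmf \<mu> x"
    and ui: "unif_integrable M (\<lambda>t \<omega>. real_of_int (stopped S \<sigma> t \<omega>))"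
    using sep unfolding SEP_def by blast+
  obtain b where b: "b < int n" "0 \<le> gap (real n) b" "b = int n - 1 \<or> gap (real n) (b + 1) < 0"
    using ex_optimal[OF n] by blast
  note sm = F.stopping_measurable[OF st]
  have Zm [measurable]: "(\<lambda>\<omega>. S (the_enat (\<sigma> \<omega>)) \<omega>) \<in> measurable M (count_space UNIV)"
    by (rule F.terminal_measurable[OF sm F.S_measurable])
  have law': "prob {\<omega>\<in>space M. S (the_enat (\<sigma> \<omega>)) \<omega> = x} = pmf \<mu> x" for x
  proof -
    have "prob {\<omega>\<in>space M. S (the_enat (\<sigma> \<omega>)) \<omega> = x}
        = prob {\<omega>\<in>space M. \<sigma> \<omega> \<noteq> \<infinity> \<and> S (the_enat (\<sigma> \<omega>)) \<omega> = x}"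
    proof (rule finite_measure_eq_AE)
      show "AE \<omega> in M. \<omega> \<in> {\<omega>\<in>space M. S (the_enat (\<sigma> \<omega>)) \<omega> = x}
          \<longleftrightarrow> \<omega> \<in> {\<omega>\<in>space M. \<sigma> \<omega> \<noteq> \<infinity> \<and> S (the_enat (\<sigma> \<omega>)) \<omega> = x}"
        using fin by eventually_elim simp
      show "{\<omega>\<in>space M. S (the_enat (\<sigma> \<omega>)) \<omega> = x} \<in> events" by measurable
      have "{\<omega>\<in>space M. \<sigma> \<omega> \<noteq> \<infinity> \<and> S (the_enat (\<sigma> \<omega>)) \<omega> = x}
          = (\<sigma> -` (- {\<infinity>}) \<inter> space M) \<inter> ((\<lambda>\<omega>. S (the_enat (\<sigma> \<omega>)) \<omega>) -` {x} \<inter> space M)" by auto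
      then show "{\<omega>\<in>space M. \<sigma> \<omega> \<noteq> \<infinity> \<and> S (the_enat (\<sigma> \<omega>)) \<omega> = x} \<in> events"
        using measurable_sets[OF sm, of "- {\<infinity>}"] measurable_sets[OF Zm, of "{x}"] by auto
    qed
    then show ?thesis by (simp only: law)
  qed
  note E = expectation_law[OF Zm law', of "\<lambda>x. max 0 (real_of_int (x - b))"]
  have c: "(\<lambda>x. max 0 (real_of_int (x - b))) = (\<lambda>x. max 0 (real_of_int x - real_of_int b))" by simp
  have "real_of_int (int n - b) * prob {\<omega>\<in>space M. \<sigma> \<omega> \<noteq> \<infinity> \<and> int n \<le> Smax S (the_enat (\<sigma> \<omega>)) \<omega>}
      \<le> (\<integral>\<omega>. max 0 (real_of_int (S (the_enat (\<sigma> \<omega>)) \<omega> - b)) \<partial>M)"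
  proof (rule F.maximal_inequality[OF st fin ui _ b(1)])
    show "integrable M (\<lambda>\<omega>. max 0 (real_of_int (S (the_enat (\<sigma> \<omega>)) \<omega> - b)))"
      unfolding E(1) c by (rule integrable_call)
  qed (use n in simp)
  also have "\<dots> = call b" unfolding E(2) c call_def ..
  also have "\<dots> = real_of_int (int n - b) * AYbound \<mu> n"
    using reach_prob_optimal[OF b] n by (simp add: reach_prob_def)
  finally show ?thesis using b(1) by simp
qed

end

theorem theorem2:
  fixes M :: "'a measure" and S :: "nat \<Rightarrow> 'a \<Rightarrow> int"
    and \<eta> :: "nat \<Rightarrow> nat \<Rightarrow> 'a \<Rightarrow> bool" and \<mu> :: "int pmf"
  assumes "prob_space M"
    and "integrable (measure_pmf \<mu>) real_of_int"
    and "measure_pmf.expectation \<mu> real_of_int = 0"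
    and "ssrw_wrt M (nat_filt M S) S"
    and "prob_space.indep_vars M (\<lambda>_. count_space UNIV) (\<lambda>(n, k). \<eta> n k) (AYidx \<mu>)"
    and "prob_space.indep_set M
           {(\<lambda>\<omega> t. S t \<omega>) -` A \<inter> space M | A. A \<in> sets (Pi\<^sub>M UNIV (\<lambda>_. count_space UNIV))}
           {(\<lambda>\<omega>. \<lambda>i\<in>AYidx \<mu>. \<eta> (fst i) (snd i) \<omega>) -` B \<inter> space M
              | B. B \<in> sets (Pi\<^sub>M (AYidx \<mu>) (\<lambda>_. count_space UNIV))}"
    and "\<forall>(n, k)\<in>AYidx \<mu>. measure M {\<omega>\<in>space M. \<eta> n k \<omega> = False} = rho \<mu> n k"
  shows "SEP M (FSeta M \<mu> S \<eta>) S \<mu> (tauAY \<mu> S \<eta>)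
    \<and> (\<forall>F \<sigma> (n::nat). ssrw_wrt M F S \<and> SEP M F S \<mu> \<sigma> \<and> 1 \<le> n \<longrightarrow>
          measure M {\<omega>\<in>space M. \<sigma> \<omega> \<noteq> \<infinity> \<and> int n \<le> Smax S (the_enat (\<sigma> \<omega>)) \<omega>}
          \<le> measure M {\<omega>\<in>space M. tauAY \<mu> S \<eta> \<omega> \<noteq> \<infinity>
                         \<and> int n \<le> Smax S (the_enat (tauAY \<mu> S \<eta> \<omega>)) \<omega>})
    \<and> (\<forall>n::nat. 1 \<le> n \<longrightarrow>
          measure M {\<omega>\<in>space M. tauAY \<mu> S \<eta> \<omega> \<noteq> \<infinity>
                         \<and> int n \<le> Smax S (the_enat (tauAY \<mu> S \<eta> \<omega>)) \<omega>} = AYbound \<mu> n)"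
proof -
  interpret prob_space M by (rule assms(1))
  interpret azema_yor M \<mu> S \<eta>
    by unfold_locales (rule assms)+
  show ?thesis
  proof (intro conjI allI impI tauAY_SEP tauAY_max_law)
    fix F \<sigma> and n :: nat
    assume *: "ssrw_wrt M F S \<and> SEP M F S \<mu> \<sigma> \<and> 1 \<le> n"
    then have "prob {\<omega>\<in>space M. \<sigma> \<omega> \<noteq> \<infinity> \<and> int n \<le> Smax S (the_enat (\<sigma> \<omega>)) \<omega>} \<le> AYbound \<mu> n"
      by (intro SEP_max_bound) auto
    then show "prob {\<omega>\<in>space M. \<sigma> \<omega> \<noteq> \<infinity> \<and> int n \<le> Smax S (the_enat (\<sigma> \<omega>)) \<omega>}
        \<le> prob {\<omega>\<in>space M. tauAY \<mu> S \<eta> \<omega> \<noteq> \<infinity> \<and> int n \<le> Smax S (the_enat (tauAY \<mu> S \<eta> \<omega>)) \<omega>}"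
      using * tauAY_max_law[of n] by simp
  qed
qed

end
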